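(* Let $\Omega\subset\mathbb{R}^n$ ($n\ge2$) be a bounded domain, let $p\in(1,\infty)$, let $\omega\in A_p$, and let $\varphi\in\Phi_{\mathrm w}(\Omega)$ satisfy (A1)$_\omega$ and (aInc)$_p$. Put $\psi(x,t):=\varphi(x,t)\omega(x)$. Then there exists a constant $C>0$ such that $$\|u\|_{L^\varphi_\omega(\Omega)}\le C\,\operatorname{diam}(\Omega)\,\|\nabla u\|_{L^\varphi_\omega(\Omega)}$$ for every $u\in W^{1,\psi}_0(\Omega)$.
   Context: Weights. A weight $\omega$ is a non-negative locally integrable function on $\mathbb{R}^n$; $\omega(E):=\int_E\omega\,dx$. For $1<\gamma<\infty$, $\omega\in A_\gamma$ means $[\omega]_{A_\gamma}:=\sup_B\left(\frac1{|B|}\int_B\omega\,dx\right)\left(\frac1{|B|}\int_B\omega^{-\frac1{\gamma-1}}dx\right)^{\gamma-1}<\infty$, the supremum over all balls $B\subset\mathbb{R}^n$. $f$ is almost increasing with constant $L\ge1$ if $f(s)\le Lf(t)$ whenever $s\le t$; increasing if $L=1$. $\Phi$-functions. A $\Phi$-prefunction on $\Omega$ is a function $\varphi:\Omega\times[0,\infty)\to[0,\infty]$ such that $x\mapsto\varphi(x,|f(x)|)$ is measurable for every measurable $f$ on $\Omega$, and, for every $x\in\Omega$, $t\mapsto\varphi(x,t)$ is increasing, $\varphi(x,0)=\lim_{t\to0^+}\varphi(x,t)=0$ and $\lim_{t\to\infty}\varphi(x,t)=\infty$. $\Phi_{\mathrm w}(\Omega)$ is the set of $\Phi$-prefunctions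 satisfying (aInc)$_1$. Conditions: (aInc)$_\gamma$: for every $x\in\Omega$, $t\mapsto t^{-\gamma}\varphi(x,t)$ is almost increasing on $(0,\infty)$ with a constant $L\ge 1$ independent of $x$. (A1)$_\omega$: with $\varphi^{-1}(x,t):=\inf\{\tau\ge0:\varphi(x,\tau)\ge t\}$, there is $\beta_1\in(0,1]$ such that $\beta_1\varphi^{-1}(x,t)\le\varphi^{-1}(y,t)$ for every $t\in[1,\frac1{\omega(B)}]$, almost every $x,y\in B\cap\Omega$ and every ball $B$ with $\omega(B)\le1$. Spaces. $L^\varphi_\omega(\Omega)=L^\psi(\Omega)$ is the set of measurable $f$ with $\|f\|_{L^\varphi_\omega(\Omega)}=\|f\|_{L^\psi(\Omega)}:=\inf\{\lambda>0:\int_\Omega\varphi(x,|f|/\lambda)\omega\,dx\le1\}<\infty$; for vector fields, $\|\nabla u\|:=\||\nabla u|\|$. $W^{1,\psi}(\Omega)$ is the set of $f\in L^\psi(\Omega)\cap L^1_{\mathrm{loc}}(\Omega)$ with weak gradient satisfying $\|f\|_{W^{1,\psi}(\Omega)}:=\|f\|_{L^\psi(\Omega)}+\||\nabla f|\|_{L^\psi(\Omega)}<\infty$, and $W^{1,\psi}_0(\Omega)$ is the closure of $C_0^\infty(\Omega)$ in $W^{1,\psi}(\Omega)$. *)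

theory Defs
  imports "HOL-Analysis.Analysis"
begin

section \<open>Weights\<close>

definition weight :: "(real ^ 'n \<Rightarrow> real) \<Rightarrow> bool" where
  "weight \<omega> \<longleftrightarrow>
     (\<forall>x. 0 \<le> \<omega> x) \<and> (\<forall>K. compact K \<longrightarrow> \<omega> absolutely_integrable_on K)"

definition weight_of :: "(real ^ 'n \<Rightarrow> real) \<Rightarrow> (real ^ 'n) set \<Rightarrow> ennreal" where
  "weight_of \<omega> E = (\<integral>\<^sup>+x\<in>E. ennreal (\<omega> x) \<partial>lebesgue)"

text \<open>Powers in \<open>[0,\<infinity>]\<close>. Unlike \<open>powr\<close> on the reals, where \<open>0 powr a = 0\<close>,
  a negative power of zero is infinite; this matters at the zeros of a weight.\<close>

definition ennreal_powr :: "ennreal \<Rightarrow> real \<Rightarrow> ennreal" where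
  "ennreal_powr x a =
     (if a = 0 then 1
      else if x = 0 then (if a < 0 then \<infinity> else 0)
      else if x = \<infinity> then (if a < 0 then 0 else \<infinity>)
      else ennreal (enn2real x powr a))"

text \<open>The product is taken in \<open>[0,\<infinity>]\<close> with \<open>0 \<cdot> \<infinity> = 0\<close>; this convention is only relevant
  for the weight that vanishes almost everywhere.\<close>

definition Ap_const :: "real \<Rightarrow> (real ^ 'n \<Rightarrow> real) \<Rightarrow> ennreal" where
  "Ap_const \<gamma> \<omega> =
     (SUP (c, r) \<in> UNIV \<times> {0<..}.
        ((\<integral>\<^sup>+x\<in>ball c r. ennreal (\<omega> x) \<partial>lebesgue) / emeasure lebesgue (ball c r)) *
        ennreal_powr
          ((\<integral>\<^sup>+x\<in>ball c r. ennreal_powr (ennreal (\<omega> x)) (- 1 / (\<gamma> - 1)) \<partial>lebesgue)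
            / emeasure lebesgue (ball c r))
          (\<gamma> - 1))"

definition Ap :: "real \<Rightarrow> (real ^ 'n \<Rightarrow> real) set" where
  "Ap \<gamma> = {\<omega>. weight \<omega> \<and> Ap_const \<gamma> \<omega> < \<infinity>}"


section \<open>Generalized \<open>\<Phi>\<close>-functions\<close>

definition almost_increasing_on :: "real set \<Rightarrow> real \<Rightarrow> (real \<Rightarrow> ennreal) \<Rightarrow> bool" where
  "almost_increasing_on S L f \<longleftrightarrow> (\<forall>s\<in>S. \<forall>t\<in>S. s \<le> t \<longrightarrow> f s \<le> ennreal L * f t)"

text \<open>A function \<open>\<phi> :: real ^ 'n \<Rightarrow> real \<Rightarrow> ennreal\<close> stands for a map
  \<open>\<Omega> \<times> [0,\<infinity>) \<rightarrow> [0,\<infinity>]\<close>; its values for \<open>x \<notin> \<Omega>\<close> or \<open>t < 0\<close> are never used.\<close>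

definition Phi_prefunction :: "(real ^ 'n) set \<Rightarrow> (real ^ 'n \<Rightarrow> real \<Rightarrow> ennreal) \<Rightarrow> bool" where
  "Phi_prefunction \<Omega> \<phi> \<longleftrightarrow>
     (\<forall>f \<in> borel_measurable (lebesgue_on \<Omega>).
        (\<lambda>x. \<phi> x \<bar>f x :: real\<bar>) \<in> borel_measurable (lebesgue_on \<Omega>)) \<and>
     (\<forall>x\<in>\<Omega>. mono_on {0..} (\<phi> x) \<and> \<phi> x 0 = 0 \<and>
        ((\<phi> x) \<longlongrightarrow> 0) (at_right 0) \<and> ((\<phi> x) \<longlongrightarrow> \<infinity>) at_top)"

definition aInc :: "(real ^ 'n) set \<Rightarrow> real \<Rightarrow> (real ^ 'n \<Rightarrow> real \<Rightarrow> ennreal) \<Rightarrow> bool" where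
  "aInc \<Omega> \<gamma> \<phi> \<longleftrightarrow>
     (\<exists>L\<ge>1. \<forall>x\<in>\<Omega>. almost_increasing_on {0<..} L (\<lambda>t. ennreal (t powr (- \<gamma>)) * \<phi> x t))"

definition Phi_w :: "(real ^ 'n) set \<Rightarrow> (real ^ 'n \<Rightarrow> real \<Rightarrow> ennreal) set" where
  "Phi_w \<Omega> = {\<phi>. Phi_prefunction \<Omega> \<phi> \<and> aInc \<Omega> 1 \<phi>}"

text \<open>For a \<open>\<Phi>\<close>-prefunction the set below is nonempty, as \<open>\<phi> x t \<rightarrow> \<infinity>\<close> for \<open>t \<rightarrow> \<infinity>\<close>,
  so the real infimum is the intended one.\<close>

definition left_inverse :: "(real ^ 'n \<Rightarrow> real \<Rightarrow> ennreal) \<Rightarrow> real ^ 'n \<Rightarrow> real \<Rightarrow> real" where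
  "left_inverse \<phi> x t = Inf {\<tau>. 0 \<le> \<tau> \<and> \<phi> x \<tau> \<ge> ennreal t}"

text \<open>The quotient \<open>1 / weight_of \<omega> B\<close> is taken in \<open>[0,\<infinity>]\<close>. The exceptional null sets may depend
  on \<open>t\<close> and on the ball.\<close>

definition A1 :: "(real ^ 'n) set \<Rightarrow> (real ^ 'n \<Rightarrow> real) \<Rightarrow> (real ^ 'n \<Rightarrow> real \<Rightarrow> ennreal) \<Rightarrow> bool" where
  "A1 \<Omega> \<omega> \<phi> \<longleftrightarrow>
     (\<exists>\<beta>. 0 < \<beta> \<and> \<beta> \<le> 1 \<and>
       (\<forall>c r t. 0 < r \<longrightarrow> weight_of \<omega> (ball c r) \<le> 1 \<longrightarrow>
          1 \<le> t \<longrightarrow> ennreal t \<le> 1 / weight_of \<omega> (ball c r) \<longrightarrow>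
          (AE x in lebesgue_on (ball c r \<inter> \<Omega>). AE y in lebesgue_on (ball c r \<inter> \<Omega>).
             \<beta> * left_inverse \<phi> x t \<le> left_inverse \<phi> y t)))"

definition weighted :: "(real ^ 'n \<Rightarrow> real \<Rightarrow> ennreal) \<Rightarrow> (real ^ 'n \<Rightarrow> real) \<Rightarrow>
    real ^ 'n \<Rightarrow> real \<Rightarrow> ennreal" where
  "weighted \<phi> \<omega> = (\<lambda>x t. \<phi> x t * ennreal (\<omega> x))"


section \<open>Musielak-Orlicz spaces\<close>

text \<open>Valued in \<open>[0,\<infinity>]\<close>, with \<open>Inf {} = \<infinity>\<close>.\<close>

definition lux_norm :: "(real ^ 'n) set \<Rightarrow> (real ^ 'n \<Rightarrow> real \<Rightarrow> ennreal) \<Rightarrow>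
    (real ^ 'n \<Rightarrow> real) \<Rightarrow> ennreal" where
  "lux_norm \<Omega> \<psi> f =
     Inf {ennreal l | l. 0 < l \<and> (\<integral>\<^sup>+x. \<psi> x (\<bar>f x\<bar> / l) \<partial>lebesgue_on \<Omega>) \<le> 1}"

definition L_space :: "(real ^ 'n) set \<Rightarrow> (real ^ 'n \<Rightarrow> real \<Rightarrow> ennreal) \<Rightarrow>
    (real ^ 'n \<Rightarrow> real) set" where
  "L_space \<Omega> \<psi> = {f \<in> borel_measurable (lebesgue_on \<Omega>). lux_norm \<Omega> \<psi> f < \<infinity>}"


section \<open>Weak gradients and Sobolev spaces\<close>

definition L1_loc :: "(real ^ 'n) set \<Rightarrow> (real ^ 'n \<Rightarrow> 'b :: euclidean_space) set" where
  "L1_loc \<Omega> = {f. \<forall>K. compact K \<and> K \<subseteq> \<Omega> \<longrightarrow> f absolutely_integrable_on K}"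

definition partial_deriv :: "'n \<Rightarrow> (real ^ 'n \<Rightarrow> real) \<Rightarrow> real ^ 'n \<Rightarrow> real" where
  "partial_deriv i f x = frechet_derivative f (at x) (axis i 1)"

primrec C_diff :: "nat \<Rightarrow> (real ^ 'n \<Rightarrow> real) \<Rightarrow> bool" where
  "C_diff 0 f \<longleftrightarrow> continuous_on UNIV f"
| "C_diff (Suc k) f \<longleftrightarrow>
     (\<forall>x. f differentiable (at x)) \<and> (\<forall>i. C_diff k (partial_deriv i f))"

text \<open>\<open>C\<^sub>0\<^sup>\<infinity>(\<Omega>)\<close>, with functions extended by zero to the whole space.\<close>

definition test_functions :: "(real ^ 'n) set \<Rightarrow> (real ^ 'n \<Rightarrow> real) set" where
  "test_functions \<Omega> =
     {\<eta>. (\<forall>k. C_diff k \<eta>) \<and> compact (closure {x. \<eta> x \<noteq> 0}) \<and> closure {x. \<eta> x \<noteq> 0} \<subseteq> \<Omega>}"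

definition has_weak_gradient :: "(real ^ 'n) set \<Rightarrow> (real ^ 'n \<Rightarrow> real) \<Rightarrow>
    (real ^ 'n \<Rightarrow> real ^ 'n) \<Rightarrow> bool" where
  "has_weak_gradient \<Omega> f v \<longleftrightarrow> f \<in> L1_loc \<Omega> \<and> v \<in> L1_loc \<Omega> \<and>
     (\<forall>\<eta> \<in> test_functions \<Omega>. \<forall>i.
        (\<integral>x. f x * partial_deriv i \<eta> x \<partial>lebesgue_on \<Omega>) =
        - (\<integral>x. v x $ i * \<eta> x \<partial>lebesgue_on \<Omega>))"

text \<open>The weak gradient is determined only up to null sets; the choice of the representative
  does not affect \<open>lux_norm\<close>.\<close>

definition weak_gradient :: "(real ^ 'n) set \<Rightarrow> (real ^ 'n \<Rightarrow> real) \<Rightarrow> real ^ 'n \<Rightarrow> real ^ 'n" where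
  "weak_gradient \<Omega> f = (SOME v. has_weak_gradient \<Omega> f v)"

text \<open>Meaningful only for functions that have a weak gradient.\<close>

definition W1_norm :: "(real ^ 'n) set \<Rightarrow> (real ^ 'n \<Rightarrow> real \<Rightarrow> ennreal) \<Rightarrow>
    (real ^ 'n \<Rightarrow> real) \<Rightarrow> ennreal" where
  "W1_norm \<Omega> \<psi> f = lux_norm \<Omega> \<psi> f + lux_norm \<Omega> \<psi> (\<lambda>x. norm (weak_gradient \<Omega> f x))"

definition W1 :: "(real ^ 'n) set \<Rightarrow> (real ^ 'n \<Rightarrow> real \<Rightarrow> ennreal) \<Rightarrow>
    (real ^ 'n \<Rightarrow> real) set" where
  "W1 \<Omega> \<psi> = {f \<in> L_space \<Omega> \<psi> \<inter> L1_loc \<Omega>.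
     (\<exists>v. has_weak_gradient \<Omega> f v) \<and> W1_norm \<Omega> \<psi> f < \<infinity>}"

text \<open>For general \<open>\<psi>\<close> not every test function need lie in \<open>W1 \<Omega> \<psi>\<close>; the closure is that
  of the test functions that do.\<close>

definition W1_0 :: "(real ^ 'n) set \<Rightarrow> (real ^ 'n \<Rightarrow> real \<Rightarrow> ennreal) \<Rightarrow>
    (real ^ 'n \<Rightarrow> real) set" where
  "W1_0 \<Omega> \<psi> = {u \<in> W1 \<Omega> \<psi>. \<forall>\<epsilon>>0. \<exists>\<eta> \<in> test_functions \<Omega> \<inter> W1 \<Omega> \<psi>.
     W1_norm \<Omega> \<psi> (\<lambda>x. u x - \<eta> x) < ennreal \<epsilon>}"

end

theory Submission
  imports Defs "HOL-Computational_Algebra.Polynomial"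
begin

text \<open>For a test function \<open>\<eta>\<close>, integrating \<open>\<nabla>\<eta>\<close> along segments and averaging over their directions bounds
  \<open>\<bar>\<eta>(x)\<bar>\<close> by \<open>R \<Sum>\<^sub>k 2\<^sup>-\<^sup>k\<close> times the average of \<open>\<bar>\<nabla>\<eta>\<bar>\<close> over a ball of radius comparable to \<open>2\<^sup>-\<^sup>k R\<close>,
  which can be chosen to depend only on the cell of a grid of that width containing \<open>x\<close>.
  Because of the weights \<open>2\<^sup>-\<^sup>k\<close> no maximal function is needed: it suffices that averaging at one
  fixed scale is bounded, uniformly in the scale, and for this \<open>A\<^sub>p\<close> is used on single balls only,
  without any self-improvement.

  For a ball \<open>B\<close> let \<open>a\<close> be the average over \<open>B\<close> of \<open>\<phi>(y, f(y))\<^sup>1\<^sup>/\<^sup>p\<close>. If the modular of \<open>f\<close> is at most one,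
  \<open>A\<^sub>p\<close> gives \<open>a\<^sup>p \<omega>(B) \<le> K\<close>, so (A1) applies at the level \<open>T = max 1 (a\<^sup>p / K)\<close> and says that
  \<open>\<phi>\<^sup>-\<^sup>1(\<sqdot>, T)\<close> is comparable to a constant \<open>S\<close> on \<open>B\<close>. By (aInc)\<open>\<^sub>p\<close> the average of \<open>f\<close> over \<open>B\<close> is then
  at most a multiple of \<open>S\<close>, whence \<open>\<phi>(x, \<kappa> avg f) \<le> T \<le> 1 + a\<^sup>p / K\<close> on \<open>B\<close>; integrating
  against \<open>\<omega>\<close> and applying \<open>A\<^sub>p\<close> once more gives the modular bound. Balls with \<open>\<omega>(B) > 1\<close> are
  covered by the level \<open>T = 1\<close>, at which \<open>\<phi>\<^sup>-\<^sup>1\<close> is comparable to a constant on all of \<open>\<Omega>\<close> by compactness.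

  The passage to \<open>W\<^sub>0\<^sup>1\<close> uses that the norm is a quasi-norm and that weak gradients are unique
  almost everywhere.\<close>

section \<open>Weights and left inverses\<close>

text \<open>The exponent p links the two growth conditions: for h = \<phi>(., f)^(1/p) the integral
  of h^p \<omega> is the modular of f, so A_p bounds the averages of h, and (aInc)_p is just strong
  enough to pass from h back to f.

  \<phi>(x, .) is not assumed convex or continuous. Jensen's inequality over the scales is replaced
  by \<open>aInc1_countable_average\<close>, the triangle inequality by
  \<open>lux_norm_quasi_triangle\<close>, and spare factors 2 keep arguments strictly away from the
  left inverse, at which the value of \<phi> is not controlled.

  The constant may depend on \<Omega>, so its size is not tracked: a bound without the diameter is
  proved, and its constant is divided by the positive diameter at the very end.

  The weight that vanishes almost everywhere has a finite A_p constant under 0 * \<infinity> = 0. It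
  is treated apart; every other A_p weight is positive almost everywhere.\<close>

lemma L1_loc_measurable:
  fixes f :: "real ^ 'n \<Rightarrow> 'b :: euclidean_space"
  assumes "open \<Omega>" "f \<in> L1_loc \<Omega>"
  shows "f \<in> borel_measurable (lebesgue_on \<Omega>)"
proof -
  obtain C where C: "\<And>n. compact (C n)" "\<And>n. C n \<subseteq> \<Omega>" "\<And>n. C n \<subseteq> interior (C (Suc n))"
      "\<Union>(range C) = \<Omega>"
    using open_Union_compact_subsets[OF assms(1)] by metis
  have mono: "C m \<subseteq> C n" if "m \<le> n" for m n
    using C(3) interior_subset lift_Suc_mono_le[of C, OF _ that] by (meson order_trans)
  \<comment> \<open>The truncations to the compact sets of an exhaustion are measurable, and at each
    point they eventually agree with f.\<close>
  show ?thesis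
  proof (rule borel_measurable_LIMSEQ_metric)
    fix i
    have "f absolutely_integrable_on C i"
      using assms(2) C unfolding L1_loc_def by auto
    then have "(\<lambda>x. indicator (C i) x *\<^sub>R f x) \<in> borel_measurable lebesgue"
      unfolding set_integrable_def by auto
    then show "(\<lambda>x. indicator (C i) x *\<^sub>R f x) \<in> borel_measurable (lebesgue_on \<Omega>)"
      by (rule measurable_restrict_space1)
  next
    fix x assume "x \<in> space (lebesgue_on \<Omega>)"
    then have "x \<in> \<Omega>" by (simp add: space_restrict_space)
    then obtain m where "x \<in> C m" using C(4) by auto
    then have "\<forall>n\<ge>m. indicator (C n) x *\<^sub>R f x = f x"
      using mono by (auto simp: indicator_def)
    then show "(\<lambda>i. indicator (C i) x *\<^sub>R f x) \<longlonglongrightarrow> f x"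
      by (intro tendsto_eventually) (auto simp: eventually_sequentially)
  qed
qed

lemma weight_measurable:
  assumes "weight \<omega>"
  shows "\<omega> \<in> borel_measurable lebesgue"
proof -
  have "\<omega> \<in> L1_loc UNIV"
    using assms unfolding weight_def L1_loc_def by auto
  from L1_loc_measurable[OF open_UNIV this] show ?thesis
    by (simp add: lebesgue_on_UNIV_eq)
qed

lemma weight_of_mono: "A \<subseteq> B \<Longrightarrow> weight_of \<omega> A \<le> weight_of \<omega> B"
  unfolding weight_of_def by (intro nn_integral_mono) (auto simp: indicator_def)

lemma weight_of_finite:
  assumes "weight \<omega>" "bounded A"
  shows "weight_of \<omega> A < \<infinity>"
proof -
  obtain b where b: "A \<subseteq> cball 0 b"
    using bounded_subset_ballD[OF assms(2), of 0] ball_subset_cball by blast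
  have nn: "\<And>x. 0 \<le> \<omega> x" using assms by (auto simp: weight_def)
  have "integrable lebesgue (\<lambda>x. indicator (cball 0 b) x *\<^sub>R \<omega> x)"
    using assms(1) unfolding weight_def set_integrable_def by auto
  from integrableD(2)[OF this] have *: "(\<integral>\<^sup>+x. ennreal (indicator (cball 0 b) x *\<^sub>R \<omega> x) \<partial>lebesgue) \<noteq> \<infinity>"
    by (simp add: nn)
  have "weight_of \<omega> (cball 0 b) = (\<integral>\<^sup>+x. ennreal (indicator (cball 0 b) x *\<^sub>R \<omega> x) \<partial>lebesgue)"
    unfolding weight_of_def by (intro nn_integral_cong) (simp add: indicator_def nn)
  with * have "weight_of \<omega> (cball 0 b) < \<infinity>"
    by (metis infinity_ennreal_def less_top)
  with weight_of_mono[OF b] show ?thesis by (rule le_less_trans)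
qed

lemma weight_of_eq_0_iff:
  assumes "weight \<omega>" "A \<in> sets lebesgue"
  shows "weight_of \<omega> A = 0 \<longleftrightarrow> (AE x in lebesgue. x \<in> A \<longrightarrow> \<omega> x = 0)"
proof -
  have [measurable]: "\<omega> \<in> borel_measurable lebesgue" "A \<in> sets lebesgue"
    using assms weight_measurable by auto
  have nn: "\<And>x. 0 \<le> \<omega> x" using assms by (auto simp: weight_def)
  show ?thesis unfolding weight_of_def
    by (subst nn_integral_0_iff_AE) (auto simp: nn antisym indicator_def intro!: AE_cong)
qed

lemma emeasure_lebesgue_ball:
  fixes c :: "real ^ 'n"
  assumes "0 < r"
  shows "emeasure lebesgue (ball c r) > 0" "emeasure lebesgue (ball c r) < \<infinity>"
proof -
  have "negligible (ball c r) \<longleftrightarrow> emeasure lebesgue (ball c r) = 0"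
    using lmeasurable_ball[of c r] by (auto simp: negligible_iff_null_sets null_sets_def fmeasurable_def)
  moreover have "\<not> negligible (ball c r)"
    using assms by (simp add: open_not_negligible)
  ultimately show "emeasure lebesgue (ball c r) > 0"
    by (simp add: zero_less_iff_neq_zero)
  show "emeasure lebesgue (ball c r) < \<infinity>"
    using lmeasurable_ball[of c r] by (auto simp: fmeasurable_def)
qed

lemma ennreal_powr_real:
  assumes "0 < x" "a \<noteq> 0"
  shows "ennreal_powr (ennreal x) a = ennreal (x powr a)"
  using assms by (auto simp: ennreal_powr_def)

text \<open>By monotonicity and the two limits of \<phi> x, its values are known strictly below and
  strictly above the left inverse. Without continuity nothing is known at the left inverse itself,
  so both comparisons are strict.\<close>

lemma left_inverse_facts:
  assumes "Phi_prefunction \<Omega> \<phi>" "x \<in> \<Omega>" "0 < t"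
  shows left_inverse_pos: "0 < left_inverse \<phi> x t"
    and left_inverse_less: "left_inverse \<phi> x t < \<tau> \<Longrightarrow> ennreal t \<le> \<phi> x \<tau>"
    and less_left_inverse: "0 \<le> \<tau> \<Longrightarrow> \<tau> < left_inverse \<phi> x t \<Longrightarrow> \<phi> x \<tau> < ennreal t"
proof -
  let ?S = "{\<tau>. 0 \<le> \<tau> \<and> \<phi> x \<tau> \<ge> ennreal t}"
  have mono: "mono_on {0..} (\<phi> x)" and z: "\<phi> x 0 = 0" and l0: "((\<phi> x) \<longlongrightarrow> 0) (at_right 0)"
    and linf: "((\<phi> x) \<longlongrightarrow> \<infinity>) at_top"
    using assms unfolding Phi_prefunction_def by auto
  have bdd: "bdd_below ?S" by (rule bdd_belowI[of _ 0]) auto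
  have "\<forall>\<^sub>F \<tau> in at_top. \<phi> x \<tau> > ennreal t"
    using linf by (rule order_tendstoD) auto
  then have "\<forall>\<^sub>F \<tau> in at_top. \<phi> x \<tau> > ennreal t \<and> 0 \<le> \<tau>"
    using eventually_ge_at_top[of "0::real"] by eventually_elim auto
  then obtain \<tau>0 where "\<phi> x \<tau>0 > ennreal t" "0 \<le> \<tau>0"
    using eventually_happens'[OF trivial_limit_at_top_linorder] by blast
  then have ne: "?S \<noteq> {}" by (auto intro!: exI[of _ \<tau>0])
  have "\<forall>\<^sub>F \<tau> in at_right 0. \<phi> x \<tau> < ennreal t"
    using l0 by (rule order_tendstoD) (use assms in auto)
  then obtain b where b: "b > 0" "\<And>\<tau>. 0 < \<tau> \<Longrightarrow> \<tau> < b \<Longrightarrow> \<phi> x \<tau> < ennreal t"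
    unfolding eventually_at_right_field by auto
  \<comment> \<open>Positivity comes from the limit 0 at 0+: up to b the function stays below t, so
    b is a lower bound of the set.\<close>
  have "b \<le> \<tau>" if "\<tau> \<in> ?S" for \<tau>
  proof (rule ccontr)
    assume "\<not> b \<le> \<tau>"
    then have "\<phi> x \<tau> < ennreal t"
      using b(2)[of \<tau>] z that assms(3) by (cases "\<tau> = 0") auto
    then show False using that by auto
  qed
  then have "b \<le> left_inverse \<phi> x t"
    unfolding left_inverse_def by (intro cInf_greatest ne)
  with b show "0 < left_inverse \<phi> x t" by auto
  show "ennreal t \<le> \<phi> x \<tau>" if less: "left_inverse \<phi> x t < \<tau>"
  proof -
    obtain \<sigma> where "\<sigma> \<in> ?S" "\<sigma> < \<tau>"
      using cInf_lessD[OF ne less[unfolded left_inverse_def]] by blast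
    then have "ennreal t \<le> \<phi> x \<sigma>" "\<phi> x \<sigma> \<le> \<phi> x \<tau>"
      by (auto intro!: mono_onD[OF mono])
    then show ?thesis by (rule order_trans)
  qed
  show "\<phi> x \<tau> < ennreal t" if "0 \<le> \<tau>" "\<tau> < left_inverse \<phi> x t"
  proof (rule ccontr)
    assume "\<not> \<phi> x \<tau> < ennreal t"
    then have "\<tau> \<in> ?S" using that by auto
    from cInf_lower[OF this bdd] that(2) show False unfolding left_inverse_def by simp
  qed
qed

text \<open>No joint measurability of \<open>F\<close> is available, so the nested quantifiers cannot be swapped by
  Fubini; the supremum over the points that are good for the inner one replaces this.\<close>

lemma AE_comparable_imp_bounds:
  fixes F :: "'a \<Rightarrow> real"
  assumes comp: "AE x in M. AE y in M. \<beta> * F x \<le> F y"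
    and "0 < \<beta>" and pos: "\<And>x. x \<in> space M \<Longrightarrow> 0 < F x"
  shows "\<exists>S>0. AE y in M. \<beta> / 2 * S \<le> F y \<and> F y \<le> S"
\<comment> \<open>On a null space any S will do; otherwise almost every point being good yields at
  least one good point.\<close>
proof (cases "AE x in M. False")
  case True
  then show ?thesis by (intro exI[of _ 1]) (auto elim: AE_mp)
next
  case False
  define G where "G = {x \<in> space M. AE y in M. \<beta> * F x \<le> F y}"
  have AEG: "AE x in M. x \<in> G"
    using comp by (auto simp: G_def)
  have "G \<noteq> {}" using AEG False by auto
  \<comment> \<open>If F were unbounded on G, countably many good points would force F y to exceed
    every real number at almost every y.\<close>
  have bdd: "bdd_above (F ` G)"
  proof (rule ccontr)
    assume "\<not> bdd_above (F ` G)"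
    then have "\<forall>n::nat. \<exists>x\<in>G. F x > real n"
      unfolding bdd_above_def by (metis imageE not_le)
    then obtain g where g: "\<And>n. g n \<in> G" "\<And>n. F (g n) > real n" by metis
    have "AE y in M. \<beta> * F (g n) \<le> F y" for n
      using g(1)[of n] by (auto simp: G_def)
    then have "AE y in M. \<forall>n. \<beta> * F (g n) \<le> F y"
      by (simp add: AE_all_countable)
    then have "AE y in M. False"
    proof eventually_elim
      case (elim y)
      obtain n where n: "real n > F y / \<beta>" using reals_Archimedean2 by blast
      then have "F y < \<beta> * real n" using \<open>0 < \<beta>\<close> by (simp add: field_simps)
      also have "\<dots> \<le> \<beta> * F (g n)" using g(2)[of n] \<open>0 < \<beta>\<close> by simp
      finally show ?case using elim by (meson not_le)
    qed
    with False show False by simp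
  qed
  define S where "S = Sup (F ` G)"
  have up: "F y \<le> S" if "y \<in> G" for y
    unfolding S_def using bdd that by (intro cSup_upper) auto
  have "S > 0" using up pos \<open>G \<noteq> {}\<close> by (force simp: G_def)
  \<comment> \<open>The supremum need not be attained; a good point above S / 2 costs the factor 1/2
    in the lower bound.\<close>
  then obtain x where x: "x \<in> G" "F x > S / 2"
    using less_cSup_iff[of "F ` G" "S / 2"] bdd \<open>G \<noteq> {}\<close> unfolding S_def by auto
  have "AE y in M. \<beta> * F x \<le> F y" using x by (auto simp: G_def)
  with AEG have "AE y in M. \<beta> / 2 * S \<le> F y \<and> F y \<le> S"
  proof eventually_elim
    case (elim y)
    have "\<beta> / 2 * S \<le> \<beta> * F x" using x(2) \<open>0 < \<beta>\<close> by (simp add: field_simps)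
    then show ?case using elim up by auto
  qed
  with \<open>S > 0\<close> show ?thesis by auto
qed

section \<open>The Muckenhoupt condition on a ball\<close>

lemma Ap_weight: "\<omega> \<in> Ap p \<Longrightarrow> weight \<omega>"
  by (simp add: Ap_def)

lemma Ap_ball_bound:
  assumes "\<omega> \<in> Ap p" "0 < r"
  shows "(weight_of \<omega> (ball c r) / emeasure lebesgue (ball c r)) *
      ennreal_powr
        ((\<integral>\<^sup>+x\<in>ball c r. ennreal_powr (ennreal (\<omega> x)) (- 1 / (p - 1)) \<partial>lebesgue)
          / emeasure lebesgue (ball c r)) (p - 1) \<le> Ap_const p \<omega>"
  unfolding Ap_const_def weight_of_def
  by (rule SUP_upper2[of "(c, r)"]) (use assms in auto)

lemma ball_sets_lebesgue: "ball (c :: 'a :: euclidean_space) r \<in> sets lebesgue"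
  by simp

lemma ennreal_powr_weight_measurable:
  assumes "weight \<omega>"
  shows "(\<lambda>x. ennreal_powr (ennreal (\<omega> x)) a) \<in> borel_measurable lebesgue"
proof -
  have [measurable]: "\<omega> \<in> borel_measurable lebesgue"
    using assms by (rule weight_measurable)
  show ?thesis unfolding ennreal_powr_def by measurable
qed

text \<open>Otherwise the second factor of the A_p product on this ball would be infinite while the
  first is positive.\<close>

lemma Ap_dual_finite:
  assumes "\<omega> \<in> Ap p" "1 < p" "0 < r" "weight_of \<omega> (ball c r) > 0"
  shows "(\<integral>\<^sup>+x\<in>ball c r. ennreal_powr (ennreal (\<omega> x)) (- 1 / (p - 1)) \<partial>lebesgue) < \<infinity>"
proof (rule ccontr)
  let ?I = "\<integral>\<^sup>+x\<in>ball c r. ennreal_powr (ennreal (\<omega> x)) (- 1 / (p - 1)) \<partial>lebesgue"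
  assume "\<not> ?I < \<infinity>"
  then have I: "?I = top" by (simp add: less_top[symmetric])
  note E = emeasure_lebesgue_ball[OF assms(3), of c]
  have "?I / emeasure lebesgue (ball c r) = top"
    using E unfolding I by (simp add: ennreal_divide_eq_top_iff less_top)
  then have "ennreal_powr (?I / emeasure lebesgue (ball c r)) (p - 1) = top"
    using assms by (simp add: ennreal_powr_def)
  moreover have "weight_of \<omega> (ball c r) / emeasure lebesgue (ball c r) \<noteq> 0"
    using assms E by (simp add: ennreal_divide_eq_0_iff zero_less_iff_neq_zero less_top)
  ultimately have "top \<le> Ap_const p \<omega>"
    using Ap_ball_bound[OF assms(1,3), of c] by (simp add: ennreal_mult_top)
  moreover have "Ap_const p \<omega> < top" using assms(1) by (simp add: Ap_def)
  ultimately show False by simp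
qed

text \<open>On a ball of positive weight the dual integral is finite, so the negative power of
  \<omega> is finite almost everywhere there, which excludes zeros of \<omega>. Balls that exhaust
  the space give the claim.\<close>

lemma Ap_AE_pos:
  assumes "\<omega> \<in> Ap p" "1 < p" "\<not> (AE x in lebesgue. \<omega> x = 0)"
  shows "AE x in lebesgue. 0 < \<omega> x"
proof -
  note w = Ap_weight[OF assms(1)] and [measurable] = ball_sets_lebesgue
  have [measurable]: "\<omega> \<in> borel_measurable lebesgue" using w by (rule weight_measurable)
  have nn: "\<And>x. 0 \<le> \<omega> x" using w by (auto simp: weight_def)
  have "\<exists>k::nat. weight_of \<omega> (ball 0 (Suc k)) \<noteq> 0"
  proof (rule ccontr)
    assume "\<not> ?thesis"
    then have "\<forall>k::nat. AE x in lebesgue. x \<in> ball 0 (Suc k) \<longrightarrow> \<omega> x = 0"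
      using weight_of_eq_0_iff[OF w, of "ball 0 (Suc _)"] by fastforce
    then have "AE x in lebesgue. \<forall>k::nat. x \<in> ball 0 (Suc k) \<longrightarrow> \<omega> x = 0"
      unfolding AE_all_countable .
    then have "AE x in lebesgue. \<omega> x = 0"
    proof eventually_elim
      case (elim x)
      obtain k :: nat where "norm x < k" using reals_Archimedean2 by blast
      then show ?case using elim[rule_format, of k] by auto
    qed
    with assms(3) show False by simp
  qed
  then obtain k0 :: nat where k0: "weight_of \<omega> (ball 0 (Suc k0)) \<noteq> 0" by auto
  \<comment> \<open>The maximum with \<open>k0\<close> makes each ball contain one that is known to
    have positive weight.\<close>
  have "AE x in lebesgue. x \<in> ball 0 (Suc (max k0 k)) \<longrightarrow> 0 < \<omega> x" for k
  proof -
    let ?B = "ball 0 (real (Suc (max k0 k))) :: (real ^ 'a) set"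
    have "ball 0 (real (Suc k0)) \<subseteq> ?B" by (rule subset_ball) auto
    then have "weight_of \<omega> ?B > 0"
      using k0 weight_of_mono[of "ball 0 (real (Suc k0))" ?B \<omega>] by (auto simp: zero_less_iff_neq_zero)
    from Ap_dual_finite[OF assms(1,2) _ this]
    have "(\<integral>\<^sup>+x\<in>?B. ennreal_powr (ennreal (\<omega> x)) (- 1 / (p - 1)) \<partial>lebesgue) \<noteq> \<infinity>"
      by simp
    then have "AE x in lebesgue. ennreal_powr (ennreal (\<omega> x)) (- 1 / (p - 1)) * indicator ?B x \<noteq> \<infinity>"
      by (intro nn_integral_PInf_AE borel_measurable_times_ennreal ennreal_powr_weight_measurable w)
        measurable
    then show ?thesis
    proof eventually_elim
      case (elim x)
      then show ?case
        using assms(2) nn[of x] by (cases "\<omega> x = 0") (auto simp: ennreal_powr_def indicator_def)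
    qed
  qed
  then have "AE x in lebesgue. \<forall>k. x \<in> ball 0 (Suc (max k0 k)) \<longrightarrow> 0 < \<omega> x"
    by (simp only: AE_all_countable) blast
  then show ?thesis
  proof eventually_elim
    case (elim x)
    obtain k :: nat where "norm x < k" using reals_Archimedean2 by blast
    then show ?case using elim[rule_format, of k] by auto
  qed
qed

lemma weight_of_ball_pos:
  assumes "weight \<omega>" "AE x in lebesgue. 0 < \<omega> x" "0 < r"
  shows "weight_of \<omega> (ball c r) > 0"
proof (rule ccontr)
  assume "\<not> ?thesis"
  then have "AE x in lebesgue. x \<in> ball c r \<longrightarrow> \<omega> x = 0"
    using weight_of_eq_0_iff[OF assms(1), of "ball c r"] by (auto simp: zero_less_iff_neq_zero)
  with assms(2) have "AE x in lebesgue. x \<notin> ball c r"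
    by eventually_elim auto
  then have "ball c r \<in> null_sets lebesgue"
    by (subst AE_iff_null_sets) auto
  with emeasure_lebesgue_ball(1)[OF assms(3), of c] show False by (auto simp: null_sets_def)
qed

text \<open>A pointwise substitute for Hoelder's inequality: integrated over a ball and optimised
  over c, it bounds the integral of h by twice the Hoelder product. If h exceeds the first summand,
  the negative power h^(1 - p) is at most c^(1 - p) w.\<close>

lemma le_add_powr_mult:
  fixes h w c p :: real
  assumes "0 \<le> h" "0 < w" "0 < c" "1 < p"
  shows "h \<le> c * w powr (- 1 / (p - 1)) + c powr (1 - p) * (h powr p * w)"
proof (cases "h \<le> c * w powr (- 1 / (p - 1))")
  case True
  then show ?thesis using assms by (simp add: add_increasing2)
next
  case False
  let ?s = "w powr (- 1 / (p - 1))"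
  have h: "0 < c * ?s" "c * ?s < h" using False assms by auto
  have "h = h powr p * h powr (1 - p)"
    using h by (simp add: powr_add[symmetric])
  also have "h powr (1 - p) \<le> (c * ?s) powr (1 - p)"
    using h assms by (intro powr_mono2') auto
  also have "(c * ?s) powr (1 - p) = c powr (1 - p) * w"
  proof -
    have "- 1 / (p - 1) * (1 - p) = 1" using assms by (simp add: field_simps)
    then show ?thesis using assms by (simp add: powr_mult powr_powr del: divide_minus_left)
  qed
  finally have "h \<le> c powr (1 - p) * (h powr p * w)"
    using h by (simp add: mult_ac mult_left_mono)
  moreover have "0 \<le> c * ?s" using h by simp
  ultimately show ?thesis by linarith
qed

text \<open>This is the boundedness of averaging on L^p with weight \<omega>, with K independent of
  the ball and of h. The number a, at least the average of h, is real so that a^p can be formed; K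
  depends only on p and the A_p constant.\<close>

lemma Ap_averaging:
  assumes Ap: "\<omega> \<in> Ap p" and p: "1 < p" and pos: "AE x in lebesgue. 0 < \<omega> x"
  shows "\<exists>K>0. \<forall>c r h. 0 < r \<longrightarrow> h \<in> borel_measurable lebesgue \<longrightarrow> (\<forall>x. 0 \<le> h x) \<longrightarrow>
     (\<integral>\<^sup>+x\<in>ball c r. ennreal (h x powr p * \<omega> x) \<partial>lebesgue) < \<infinity> \<longrightarrow>
     (\<exists>a\<ge>0. (\<integral>\<^sup>+x\<in>ball c r. ennreal (h x) \<partial>lebesgue) \<le> ennreal a * emeasure lebesgue (ball c r) \<and>
        ennreal (a powr p) * weight_of \<omega> (ball c r)
          \<le> ennreal K * (\<integral>\<^sup>+x\<in>ball c r. ennreal (h x powr p * \<omega> x) \<partial>lebesgue))"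
proof -
  note w = Ap_weight[OF Ap] and [measurable] = ball_sets_lebesgue
  have [measurable]: "\<omega> \<in> borel_measurable lebesgue" using w by (rule weight_measurable)
  have nn: "\<And>x. 0 \<le> \<omega> x" using w by (auto simp: weight_def)
  obtain k where k: "Ap_const p \<omega> = ennreal k" "0 \<le> k"
    using Ap by (cases "Ap_const p \<omega>") (auto simp: Ap_def)
  \<comment> \<open>The factor 2^p pays for the 2 lost against Hoelder's inequality; the summand 1
    makes K positive.\<close>
  define K where "K = 2 powr p * k + 1"
  have "K > 0" using k by (simp add: K_def add_nonneg_pos)
  moreover have "\<exists>a\<ge>0. (\<integral>\<^sup>+x\<in>ball c r. ennreal (h x) \<partial>lebesgue) \<le> ennreal a * emeasure lebesgue (ball c r) \<and>
        ennreal (a powr p) * weight_of \<omega> (ball c r)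
          \<le> ennreal K * (\<integral>\<^sup>+x\<in>ball c r. ennreal (h x powr p * \<omega> x) \<partial>lebesgue)"
    if r: "0 < r" and h[measurable]: "h \<in> borel_measurable lebesgue" and hn: "\<And>x. 0 \<le> h x"
      and fin: "(\<integral>\<^sup>+x\<in>ball c r. ennreal (h x powr p * \<omega> x) \<partial>lebesgue) < \<infinity>" for c r h
  proof -
    let ?B = "ball c r"
    let ?sig = "\<lambda>x. ennreal_powr (ennreal (\<omega> x)) (- 1 / (p - 1))"
    have [measurable]: "(\<lambda>x. ennreal_powr (ennreal (\<omega> x)) b) \<in> borel_measurable lebesgue" for b
      using w by (rule ennreal_powr_weight_measurable)
    obtain j where j: "(\<integral>\<^sup>+x\<in>?B. ennreal (h x powr p * \<omega> x) \<partial>lebesgue) = ennreal j" "0 \<le> j"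
      using fin by (cases "\<integral>\<^sup>+x\<in>?B. ennreal (h x powr p * \<omega> x) \<partial>lebesgue") auto
    have Wpos: "weight_of \<omega> ?B > 0" using weight_of_ball_pos[OF w pos r] .
    obtain W where W: "weight_of \<omega> ?B = ennreal W" "0 < W"
      using weight_of_finite[OF w bounded_ball, of c r] Wpos by (cases "weight_of \<omega> ?B") auto
    obtain v where v: "emeasure lebesgue ?B = ennreal v" "0 < v"
      using emeasure_lebesgue_ball[OF r, of c] by (cases "emeasure lebesgue ?B") auto
    have sfin: "(\<integral>\<^sup>+x\<in>?B. ?sig x \<partial>lebesgue) < \<infinity>" by (rule Ap_dual_finite[OF Ap p r Wpos])
    \<comment> \<open>The division by s below needs s > 0: a negative power of the finite value
      \<omega> x never vanishes.\<close>
    have "(\<integral>\<^sup>+x\<in>?B. ?sig x \<partial>lebesgue) \<noteq> 0"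
    proof
      assume "(\<integral>\<^sup>+x\<in>?B. ?sig x \<partial>lebesgue) = 0"
      moreover have "(\<lambda>x. ?sig x * indicator ?B x) \<in> borel_measurable lebesgue" by measurable
      ultimately have "AE x in lebesgue. ?sig x * indicator ?B x = 0"
        by (simp only: nn_integral_0_iff_AE)
      then have "AE x in lebesgue. x \<notin> ?B"
        by eventually_elim (use p nn in \<open>auto simp: ennreal_powr_def indicator_def ennreal_eq_0_iff antisym split: if_splits\<close>)
      then have "?B \<in> null_sets lebesgue"
        by (subst AE_iff_null_sets) auto
      with emeasure_lebesgue_ball(1)[OF r, of c] show False by (auto simp: null_sets_def)
    qed
    then obtain s where s: "(\<integral>\<^sup>+x\<in>?B. ?sig x \<partial>lebesgue) = ennreal s" "0 < s"
      using sfin by (cases "\<integral>\<^sup>+x\<in>?B. ?sig x \<partial>lebesgue") (auto simp: ennreal_eq_0_iff not_le)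
    have kb: "W / v * (s / v) powr (p - 1) \<le> k"
    proof -
      have "ennreal (W / v) * ennreal ((s / v) powr (p - 1)) \<le> ennreal k"
        using Ap_ball_bound[OF Ap r, of c] v s W p
        unfolding k(1) v(1) s(1) W(1) by (simp add: divide_ennreal ennreal_powr_real)
      then show ?thesis using k(2) v s W by (simp add: ennreal_mult''[symmetric])
    qed
    have bound: "(\<integral>\<^sup>+x\<in>?B. ennreal (h x) \<partial>lebesgue) \<le> ennreal (d * s + d powr (1 - p) * j)"
      if "0 < d" for d
    proof -
      have "(\<integral>\<^sup>+x\<in>?B. ennreal (h x) \<partial>lebesgue) \<le>
        (\<integral>\<^sup>+x. ennreal d * (?sig x * indicator ?B x) +
            ennreal (d powr (1 - p)) * (ennreal (h x powr p * \<omega> x) * indicator ?B x) \<partial>lebesgue)"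
      proof (rule nn_integral_mono_AE)
        show "AE x in lebesgue. ennreal (h x) * indicator ?B x \<le> ennreal d * (?sig x * indicator ?B x) +
            ennreal (d powr (1 - p)) * (ennreal (h x powr p * \<omega> x) * indicator ?B x)"
          using pos
        proof eventually_elim
          case (elim x)
          have "h x \<le> d * \<omega> x powr (- 1 / (p - 1)) + d powr (1 - p) * (h x powr p * \<omega> x)"
            using le_add_powr_mult[OF hn elim \<open>0 < d\<close> p] .
          then have "ennreal (h x) \<le> ennreal d * ennreal (\<omega> x powr (- 1 / (p - 1))) +
              ennreal (d powr (1 - p)) * ennreal (h x powr p * \<omega> x)"
            using \<open>0 < d\<close> nn[of x]
            by (simp add: ennreal_mult''[symmetric] ennreal_plus[symmetric] ennreal_leI del: ennreal_plus)
          also have "ennreal (\<omega> x powr (- 1 / (p - 1))) = ?sig x"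
            using elim p by (simp add: ennreal_powr_real)
          finally show ?case by (auto simp: indicator_def)
        qed
      qed
      also have "\<dots> = ennreal d * ennreal s + ennreal (d powr (1 - p)) * ennreal j"
        by (subst nn_integral_add) (auto simp: nn_integral_cmult s(1)[simplified] j(1))
      also have "\<dots> = ennreal (d * s + d powr (1 - p) * j)"
        using \<open>0 < d\<close> s j by (simp add: ennreal_mult''[symmetric] ennreal_plus[symmetric] del: ennreal_plus)
      finally show ?thesis .
    qed
    show ?thesis
    \<comment> \<open>For j = 0 no optimal d exists, but letting d tend to 0 shows that the integral
      of h vanishes.\<close>
    proof (cases "j = 0")
      case True
      have "(\<integral>\<^sup>+x\<in>?B. ennreal (h x) \<partial>lebesgue) \<le> 0"
      proof (rule ennreal_le_epsilon)
        fix e :: real assume "0 < e"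
        then show "(\<integral>\<^sup>+x\<in>?B. ennreal (h x) \<partial>lebesgue) \<le> 0 + ennreal e"
          using bound[of "e / s"] s(2) True by simp
      qed
      then show ?thesis using p by (intro exI[of _ 0]) auto
    next
      case False
      then have j0: "0 < j" using j by simp
      \<comment> \<open>This d makes the two summands d s and d^(1 - p) j of \<open>bound\<close>
        equal.\<close>
      define d where "d = (j / s) powr (1 / p)"
      define a where "a = (d * s + d powr (1 - p) * j) / v"
      have d: "0 < d" using j0 s by (simp add: d_def)
      have dp: "d powr p = j / s" using j0 s p by (simp add: d_def powr_powr)
      have "d powr (1 - p) * j = d * s"
        using d j0 s by (simp add: powr_diff dp)
      then have a: "a = 2 * d * s / v" by (simp add: a_def)
      have "a powr p * W = 2 powr p * j * (W / v * (s / v) powr (p - 1))"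
        using d s v j0 by (simp add: a powr_mult powr_divide dp powr_diff mult_ac)
      also have "\<dots> \<le> 2 powr p * j * k"
        using kb j0 by (intro mult_left_mono) auto
      also have "\<dots> \<le> K * j" using j0 by (simp add: K_def algebra_simps)
      finally have "ennreal (a powr p) * ennreal W \<le> ennreal K * ennreal j"
        using W(2) j0 \<open>K > 0\<close> by (simp add: ennreal_mult''[symmetric] ennreal_leI)
      moreover have "(\<integral>\<^sup>+x\<in>?B. ennreal (h x) \<partial>lebesgue) \<le> ennreal a * ennreal v"
        using bound[OF d] v d s j0 by (simp add: a_def ennreal_mult''[symmetric])
      moreover have "0 \<le> a" using a d s v by simp
      ultimately show ?thesis unfolding j(1) W(1) v(1) by blast
    qed
  qed
  ultimately show ?thesis by blast
qed

section \<open>Growth and measurability of \<phi>, and weights of small balls\<close>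

lemma aInc_scale:
  assumes "aInc \<Omega> \<gamma> \<phi>"
  obtains L where "1 \<le> L" "\<And>x s t. x \<in> \<Omega> \<Longrightarrow> 0 < s \<Longrightarrow> s \<le> t \<Longrightarrow>
     ennreal ((t / s) powr \<gamma>) * \<phi> x s \<le> ennreal L * \<phi> x t"
proof -
  obtain L where L: "1 \<le> L"
    "\<forall>x\<in>\<Omega>. almost_increasing_on {0<..} L (\<lambda>t. ennreal (t powr (- \<gamma>)) * \<phi> x t)"
    using assms unfolding aInc_def by blast
  have "ennreal ((t / s) powr \<gamma>) * \<phi> x s \<le> ennreal L * \<phi> x t"
    if "x \<in> \<Omega>" "0 < s" "s \<le> t" for x s t
  proof -
    have "ennreal (s powr (- \<gamma>)) * \<phi> x s \<le> ennreal L * (ennreal (t powr (- \<gamma>)) * \<phi> x t)"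
      using L(2) that unfolding almost_increasing_on_def by auto
    then have "ennreal (t powr \<gamma>) * (ennreal (s powr (- \<gamma>)) * \<phi> x s)
        \<le> ennreal (t powr \<gamma>) * (ennreal L * (ennreal (t powr (- \<gamma>)) * \<phi> x t))"
      by (rule mult_left_mono) simp
    also have "\<dots> = (ennreal (t powr \<gamma>) * ennreal (t powr (- \<gamma>))) * (ennreal L * \<phi> x t)"
      by (simp add: mult_ac)
    also have "ennreal (t powr \<gamma>) * ennreal (t powr (- \<gamma>)) = 1"
      using that by (simp add: ennreal_mult''[symmetric] powr_minus)
    also have "ennreal (t powr \<gamma>) * (ennreal (s powr (- \<gamma>)) * \<phi> x s)
        = ennreal ((t / s) powr \<gamma>) * \<phi> x s"
    proof -
      have "ennreal (t powr \<gamma>) * ennreal (s powr (- \<gamma>)) = ennreal ((t / s) powr \<gamma>)"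
        using that by (simp add: ennreal_mult''[symmetric] powr_divide powr_minus_divide)
      then show ?thesis by (metis mult.assoc)
    qed
    finally show ?thesis by simp
  qed
  with L(1) that show ?thesis by blast
qed

lemma Phi_prefunction_measurable:
  assumes "Phi_prefunction \<Omega> \<phi>" "f \<in> borel_measurable (lebesgue_on \<Omega>)" "\<Omega> \<in> sets lebesgue"
    "\<And>x. x \<in> \<Omega> \<Longrightarrow> 0 \<le> f x"
  shows "(\<lambda>x. \<phi> x (f x) * indicator \<Omega> x) \<in> borel_measurable lebesgue"
proof -
  have "(\<lambda>x. \<phi> x \<bar>f x\<bar>) \<in> borel_measurable (lebesgue_on \<Omega>)"
    using assms unfolding Phi_prefunction_def by auto
  then have "(\<lambda>x. \<phi> x \<bar>f x\<bar> * indicator \<Omega> x) \<in> borel_measurable lebesgue"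
    using assms(3) by (subst borel_measurable_restrict_space_iff_ennreal[symmetric]) auto
  moreover have "(\<lambda>x. \<phi> x \<bar>f x\<bar> * indicator \<Omega> x) = (\<lambda>x. \<phi> x (f x) * indicator \<Omega> x)"
    using assms(4) by (auto simp: indicator_def fun_eq_iff)
  ultimately show ?thesis by simp
qed

lemma ennreal_le_inverse:
  assumes "0 < W" "T * W \<le> 1"
  shows "ennreal T \<le> 1 / ennreal W"
proof -
  have "1 / ennreal W = ennreal (1 / W)"
    using assms by (simp flip: ennreal_1 add: divide_ennreal)
  then show ?thesis using assms by (simp add: field_simps ennreal_leI)
qed

text \<open>Continuity from above of the measure \<omega> dx along balls that shrink to the null set
  {z}. Such balls will cover the closure of \<Omega>, with (A1) available on each of them.\<close>

lemma weight_of_small_ball: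
  assumes "weight \<omega>"
  shows "\<exists>r>0. weight_of \<omega> (ball z r) \<le> 1"
proof -
  have [measurable]: "\<omega> \<in> borel_measurable lebesgue" using assms by (rule weight_measurable)
  let ?N = "density lebesgue (\<lambda>x. ennreal (\<omega> x))"
  let ?A = "\<lambda>i::nat. ball z (1 / Suc i)"
  have N: "emeasure ?N A = weight_of \<omega> A" if "A \<in> sets lebesgue" for A
    unfolding weight_of_def by (rule emeasure_density) (use that in auto)
  have "(\<lambda>i. emeasure ?N (?A i)) \<longlonglongrightarrow> emeasure ?N (\<Inter>i. ?A i)"
  proof (rule Lim_emeasure_decseq)
    show "range ?A \<subseteq> sets ?N" by auto
    show "decseq ?A"
      by (intro decseq_SucI subset_ball) (simp add: field_simps)
    show "emeasure ?N (?A i) \<noteq> \<infinity>" for i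
      using weight_of_finite[OF assms bounded_ball, of z "1 / Suc i"] by (simp add: N)
  qed
  moreover have "(\<Inter>i. ?A i) = {z}"
  proof -
    have "x = z" if "\<forall>i. dist z x < 1 / Suc i" for x
    proof (rule ccontr)
      assume "x \<noteq> z"
      then obtain n where "inverse (of_nat (Suc n)) < dist z x"
        using reals_Archimedean[of "dist z x"] by auto
      with that[rule_format, of n] show False by (simp add: inverse_eq_divide)
    qed
    then show ?thesis by (auto simp: set_eq_iff)
  qed
  moreover have "emeasure ?N {z} = 0"
  proof -
    have "{z} \<in> null_sets lebesgue"
      by (metis negligible_iff_null_sets negligible_sing)
    then have "AE x in lebesgue. x \<in> {z} \<longrightarrow> \<omega> x = 0"
      by (rule AE_not_in[THEN AE_mp]) auto
    then show ?thesis
      by (subst N) (auto simp: weight_of_eq_0_iff[OF assms])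
  qed
  ultimately have "(\<lambda>i. emeasure ?N (?A i)) \<longlonglongrightarrow> 0" by simp
  then have "\<forall>\<^sub>F i in sequentially. emeasure ?N (?A i) < 1"
    by (rule order_tendstoD) simp
  then obtain i where "emeasure ?N (?A i) < 1"
    unfolding eventually_sequentially by blast
  then show ?thesis by (intro exI[of _ "1 / Suc i"]) (auto simp: N)
qed

text \<open>The setting of the nontrivial case: \<open>\<omega>_pos\<close> excludes the weight that
  vanishes almost everywhere and is supplied by \<open>Ap_AE_pos\<close>.\<close>

locale weighted_orlicz =
  fixes \<Omega> :: "(real ^ 'n) set" and p :: real and \<omega> :: "real ^ 'n \<Rightarrow> real"
    and \<phi> :: "real ^ 'n \<Rightarrow> real \<Rightarrow> ennreal"
  assumes open_\<Omega>: "open \<Omega>" and bounded_\<Omega>: "bounded \<Omega>" and p: "1 < p"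
    and Ap: "\<omega> \<in> Ap p" and Phi_w: "\<phi> \<in> Phi_w \<Omega>" and A1: "A1 \<Omega> \<omega> \<phi>" and aInc_p: "aInc \<Omega> p \<phi>"
    and \<omega>_pos: "AE x in lebesgue. 0 < \<omega> x"
begin

lemma weight: "weight \<omega>"
  using Ap by (simp add: Ap_def)

lemma \<omega>_measurable [measurable]: "\<omega> \<in> borel_measurable lebesgue"
  using weight by (rule weight_measurable)

lemma \<omega>_nonneg: "0 \<le> \<omega> x"
  using weight by (auto simp: weight_def)

lemma sets_\<Omega> [measurable]: "\<Omega> \<in> sets lebesgue"
  using open_\<Omega> by simp

lemma Phi: "Phi_prefunction \<Omega> \<phi>"
  using Phi_w by (auto simp: Phi_w_def)

lemma \<phi>_mono: "x \<in> \<Omega> \<Longrightarrow> 0 \<le> s \<Longrightarrow> s \<le> t \<Longrightarrow> \<phi> x s \<le> \<phi> x t"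
  using Phi by (auto simp: Phi_prefunction_def intro: mono_onD)

lemma \<phi>_0: "x \<in> \<Omega> \<Longrightarrow> \<phi> x 0 = 0"
  using Phi by (auto simp: Phi_prefunction_def)

text \<open>Turns the pairwise comparison in (A1) into bounds by a single number S. The ratio b is
  uniform, while S depends on the ball and on the level T.\<close>

lemma left_inverse_bounds_ball:
  "\<exists>b>0. \<forall>c r T. 0 < r \<longrightarrow> weight_of \<omega> (ball c r) \<le> 1 \<longrightarrow> 1 \<le> T \<longrightarrow>
     ennreal T \<le> 1 / weight_of \<omega> (ball c r) \<longrightarrow>
     (\<exists>S>0. AE y in lebesgue. y \<in> ball c r \<inter> \<Omega> \<longrightarrow>
        b * S \<le> left_inverse \<phi> y T \<and> left_inverse \<phi> y T \<le> S)"
proof -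
  obtain \<beta> where \<beta>: "0 < \<beta>" and
    A: "\<And>c r t. 0 < r \<Longrightarrow> weight_of \<omega> (ball c r) \<le> 1 \<Longrightarrow>
          1 \<le> t \<Longrightarrow> ennreal t \<le> 1 / weight_of \<omega> (ball c r) \<Longrightarrow>
          (AE x in lebesgue_on (ball c r \<inter> \<Omega>). AE y in lebesgue_on (ball c r \<inter> \<Omega>).
             \<beta> * left_inverse \<phi> x t \<le> left_inverse \<phi> y t)"
    using A1 unfolding A1_def by blast
  have "\<exists>S>0. AE y in lebesgue. y \<in> ball c r \<inter> \<Omega> \<longrightarrow>
        \<beta> / 2 * S \<le> left_inverse \<phi> y T \<and> left_inverse \<phi> y T \<le> S"
    if "0 < r" "weight_of \<omega> (ball c r) \<le> 1" "1 \<le> T" "ennreal T \<le> 1 / weight_of \<omega> (ball c r)" for c r T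
  proof -
    have "\<exists>S>0. AE y in lebesgue_on (ball c r \<inter> \<Omega>).
        \<beta> / 2 * S \<le> left_inverse \<phi> y T \<and> left_inverse \<phi> y T \<le> S"
      by (rule AE_comparable_imp_bounds[OF A[OF that] \<beta>])
        (use left_inverse_pos[OF Phi] that in \<open>auto simp: space_restrict_space\<close>)
    then show ?thesis
      by (subst (asm) AE_restrict_space_iff) auto
  qed
  with \<beta> show ?thesis by (intro exI[of _ "\<beta> / 2"]) auto
qed

text \<open>Needed for balls of weight above 1, about which (A1) says nothing. Finitely many balls
  of weight at most 1 cover the compact closure of \<Omega>, and level 1 is admissible on
  each.\<close>

lemma left_inverse_bounds_1:
  "\<exists>m>0. \<exists>S>0. AE y in lebesgue. y \<in> \<Omega> \<longrightarrow> m \<le> left_inverse \<phi> y 1 \<and> left_inverse \<phi> y 1 \<le> S"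
proof -
  obtain b where b: "b > 0" and B0: "\<And>c r T. 0 < r \<Longrightarrow> weight_of \<omega> (ball c r) \<le> 1 \<Longrightarrow> 1 \<le> T \<Longrightarrow>
     ennreal T \<le> 1 / weight_of \<omega> (ball c r) \<Longrightarrow>
     (\<exists>S>0. AE y in lebesgue. y \<in> ball c r \<inter> \<Omega> \<longrightarrow>
        b * S \<le> left_inverse \<phi> y T \<and> left_inverse \<phi> y T \<le> S)"
    using left_inverse_bounds_ball by blast
  have B: "\<exists>S>0. AE y in lebesgue. y \<in> ball c r \<inter> \<Omega> \<longrightarrow>
        b * S \<le> left_inverse \<phi> y 1 \<and> left_inverse \<phi> y 1 \<le> S"
    if "0 < r" "weight_of \<omega> (ball c r) \<le> 1" for c r
  proof (rule B0[OF that order_refl])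
    show "ennreal 1 \<le> 1 / weight_of \<omega> (ball c r)"
      using weight_of_ball_pos[OF weight \<omega>_pos that(1), of c] that(2)
      by (cases "weight_of \<omega> (ball c r)") (auto intro: ennreal_le_inverse[of _ 1, simplified] simp: top_unique)
  qed
  obtain R where R: "\<And>z. R z > 0" "\<And>z. weight_of \<omega> (ball z (R z)) \<le> 1"
    using weight_of_small_ball[OF weight] by metis
  obtain S where S: "\<And>z. S z > 0" "\<And>z. AE y in lebesgue. y \<in> ball z (R z) \<inter> \<Omega> \<longrightarrow>
        b * S z \<le> left_inverse \<phi> y 1 \<and> left_inverse \<phi> y 1 \<le> S z"
  proof -
    from B[OF R] have "\<forall>z. \<exists>S>0. AE y in lebesgue. y \<in> ball z (R z) \<inter> \<Omega> \<longrightarrow>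
        b * S \<le> left_inverse \<phi> y 1 \<and> left_inverse \<phi> y 1 \<le> S" ..
    from choice[OF this] show ?thesis using that by auto
  qed
  have "compact (closure \<Omega>)" using bounded_\<Omega> by simp
  then obtain Z where Z: "finite Z" "closure \<Omega> \<subseteq> (\<Union>z\<in>Z. ball z (R z))"
  proof (rule compactE_image[of _ "closure \<Omega>" "\<lambda>z. ball z (R z)"])
    show "closure \<Omega> \<subseteq> (\<Union>z\<in>closure \<Omega>. ball z (R z))" using R by force
  qed auto
  \<comment> \<open>Inserting 1 keeps both finite sets nonempty, so that \<open>Max\<close> and
    \<open>Min\<close> are meaningful.\<close>
  define M where "M = Max (insert 1 (S ` Z))"
  define m where "m = Min (insert 1 ((\<lambda>z. b * S z) ` Z))"
  have "m > 0" unfolding m_def using Z b S by (subst Min_gr_iff) auto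
  moreover have "M > 0" unfolding M_def using Z by (subst Max_gr_iff) auto
  moreover have "AE y in lebesgue. y \<in> \<Omega> \<longrightarrow> m \<le> left_inverse \<phi> y 1 \<and> left_inverse \<phi> y 1 \<le> M"
  proof -
    have "AE y in lebesgue. \<forall>z\<in>Z. y \<in> ball z (R z) \<inter> \<Omega> \<longrightarrow>
        b * S z \<le> left_inverse \<phi> y 1 \<and> left_inverse \<phi> y 1 \<le> S z"
      using Z(1) S(2) by (intro AE_finite_allI) auto
    then show ?thesis
    proof eventually_elim
      case (elim y)
      show ?case
      proof
        assume "y \<in> \<Omega>"
        then have "y \<in> (\<Union>z\<in>Z. ball z (R z))"
          using Z(2) closure_subset[of \<Omega>] by (blast dest: subsetD)
        then obtain z where z: "z \<in> Z" "y \<in> ball z (R z)" by (rule UN_E)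
        have "m \<le> b * S z" "S z \<le> M"
          unfolding m_def M_def using Z z by (auto intro!: Min_le Max_ge)
        then show "m \<le> left_inverse \<phi> y 1 \<and> left_inverse \<phi> y 1 \<le> M"
          using elim[rule_format, OF z(1)] z(2) \<open>y \<in> \<Omega>\<close> by (auto intro: order_trans)
      qed
    qed
  qed
  ultimately show ?thesis by blast
qed

end

section \<open>Averages over balls and grid cells\<close>

context weighted_orlicz
begin

text \<open>Q will be a grid cell and g a number not above the average of f over the ball. The form
  of the bound allows summation over cells: the weights of disjoint Q add up to at most
  \<omega>(\<Omega>), and the integrals over the balls are controlled by the overlap of the
  balls.\<close>

lemma modular_average_ball:
  "\<exists>\<kappa>>0. \<forall>f c r Q g. f \<in> borel_measurable lebesgue \<longrightarrow> (\<forall>x. 0 \<le> f x) \<longrightarrow> (\<forall>x. x \<notin> \<Omega> \<longrightarrow> f x = 0) \<longrightarrow>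
     (\<integral>\<^sup>+x\<in>\<Omega>. \<phi> x (f x) * ennreal (\<omega> x) \<partial>lebesgue) \<le> 1 \<longrightarrow>
     0 < r \<longrightarrow> Q \<in> sets lebesgue \<longrightarrow> Q \<subseteq> ball c r \<longrightarrow> 0 \<le> g \<longrightarrow>
     ennreal g * emeasure lebesgue (ball c r) \<le> (\<integral>\<^sup>+x\<in>ball c r. ennreal (f x) \<partial>lebesgue) \<longrightarrow>
     (\<integral>\<^sup>+x\<in>Q \<inter> \<Omega>. \<phi> x (\<kappa> * g) * ennreal (\<omega> x) \<partial>lebesgue)
       \<le> weight_of \<omega> (Q \<inter> \<Omega>) + (\<integral>\<^sup>+x\<in>ball c r \<inter> \<Omega>. \<phi> x (f x) * ennreal (\<omega> x) \<partial>lebesgue)"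
proof -
  obtain L where L: "1 \<le> L" and scale: "\<And>x s t. x \<in> \<Omega> \<Longrightarrow> 0 < s \<Longrightarrow> s \<le> t \<Longrightarrow>
     ennreal ((t / s) powr p) * \<phi> x s \<le> ennreal L * \<phi> x t"
    using aInc_scale[OF aInc_p] by blast
  obtain K where K: "K > 0" and avg: "\<And>c r h. 0 < r \<Longrightarrow> h \<in> borel_measurable lebesgue \<Longrightarrow> (\<forall>x. 0 \<le> h x) \<Longrightarrow>
     (\<integral>\<^sup>+x\<in>ball c r. ennreal (h x powr p * \<omega> x) \<partial>lebesgue) < \<infinity> \<Longrightarrow>
     (\<exists>a\<ge>0. (\<integral>\<^sup>+x\<in>ball c r. ennreal (h x) \<partial>lebesgue) \<le> ennreal a * emeasure lebesgue (ball c r) \<and>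
        ennreal (a powr p) * weight_of \<omega> (ball c r)
          \<le> ennreal K * (\<integral>\<^sup>+x\<in>ball c r. ennreal (h x powr p * \<omega> x) \<partial>lebesgue))"
    using Ap_averaging[OF Ap p \<omega>_pos] by blast
  obtain b1 where b1: "b1 > 0" and lev: "\<And>c r T. 0 < r \<Longrightarrow> weight_of \<omega> (ball c r) \<le> 1 \<Longrightarrow> 1 \<le> T \<Longrightarrow>
     ennreal T \<le> 1 / weight_of \<omega> (ball c r) \<Longrightarrow>
     (\<exists>S>0. AE y in lebesgue. y \<in> ball c r \<inter> \<Omega> \<longrightarrow>
        b1 * S \<le> left_inverse \<phi> y T \<and> left_inverse \<phi> y T \<le> S)"
    using left_inverse_bounds_ball by blast
  obtain m S1 where m: "0 < m" "0 < S1" and lev1: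
      "AE y in lebesgue. y \<in> \<Omega> \<longrightarrow> m \<le> left_inverse \<phi> y 1 \<and> left_inverse \<phi> y 1 \<le> S1"
    using left_inverse_bounds_1 by blast
  \<comment> \<open>One constant for both cases: \<open>b1\<close> serves the balls of weight at
    most 1, m / S1 the heavier ones.\<close>
  define b where "b = min b1 (m / S1)"
  have b: "0 < b" using b1 m by (simp add: b_def)
  \<comment> \<open>The average of f will turn out to be at most 2 S M; then \<kappa> g <= b S / 2,
    which lies strictly below the left inverse.\<close>
  define M where "M = 1 + (L * K) powr (1 / p)"
  have M: "1 \<le> M" by (simp add: M_def)
  define \<kappa> where "\<kappa> = b / (4 * M)"
  have \<kappa>: "0 < \<kappa>" using b M by (simp add: \<kappa>_def)
  have "(\<integral>\<^sup>+x\<in>Q \<inter> \<Omega>. \<phi> x (\<kappa> * g) * ennreal (\<omega> x) \<partial>lebesgue)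
       \<le> weight_of \<omega> (Q \<inter> \<Omega>) + (\<integral>\<^sup>+x\<in>ball c r \<inter> \<Omega>. \<phi> x (f x) * ennreal (\<omega> x) \<partial>lebesgue)"
    if f[measurable]: "f \<in> borel_measurable lebesgue" and f0: "\<And>x. 0 \<le> f x"
      and f\<Omega>: "\<And>x. x \<notin> \<Omega> \<Longrightarrow> f x = 0"
      and mod: "(\<integral>\<^sup>+x\<in>\<Omega>. \<phi> x (f x) * ennreal (\<omega> x) \<partial>lebesgue) \<le> 1"
      and r: "0 < r" and Q[measurable]: "Q \<in> sets lebesgue" and QB: "Q \<subseteq> ball c r" and g: "0 \<le> g"
      and gf: "ennreal g * emeasure lebesgue (ball c r) \<le> (\<integral>\<^sup>+x\<in>ball c r. ennreal (f x) \<partial>lebesgue)"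
    for f c r Q g
  proof -
    let ?B = "ball c r"
    note [measurable] = ball_sets_lebesgue
    define \<Phi> where "\<Phi> = (\<lambda>x. \<phi> x (f x) * indicator \<Omega> x)"
    have \<Phi>m[measurable]: "\<Phi> \<in> borel_measurable lebesgue"
      unfolding \<Phi>_def
      by (rule Phi_prefunction_measurable[OF Phi _ sets_\<Omega>]) (auto intro: measurable_restrict_space1 f0)
    \<comment> \<open>A real-valued version of \<Phi>, for taking the power 1/p. The two agree
      almost everywhere, as the modular is finite and \<omega> > 0.\<close>
    define H where "H = (\<lambda>x. enn2real (\<Phi> x))"
    have Hm[measurable]: "H \<in> borel_measurable lebesgue" unfolding H_def by measurable
    have H0: "\<And>x. 0 \<le> H x" by (simp add: H_def)
    have "(\<integral>\<^sup>+x. \<Phi> x * ennreal (\<omega> x) \<partial>lebesgue) \<le> 1"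
      using mod by (simp add: \<Phi>_def mult_ac)
    then have "(\<integral>\<^sup>+x. \<Phi> x * ennreal (\<omega> x) \<partial>lebesgue) \<noteq> \<infinity>"
      by (auto simp: top_unique)
    then have "AE x in lebesgue. \<Phi> x * ennreal (\<omega> x) \<noteq> \<infinity>"
      by (intro nn_integral_PInf_AE) auto
    with \<omega>_pos have \<Phi>H: "AE x in lebesgue. \<Phi> x = ennreal (H x)"
    proof eventually_elim
      case (elim x)
      then have "\<Phi> x \<noteq> top"
        by (auto simp: ennreal_mult_eq_top_iff ennreal_eq_0_iff)
      then show ?case by (simp add: H_def less_top)
    qed
    define h where "h = (\<lambda>x. H x powr (1 / p))"
    have [measurable]: "h \<in> borel_measurable lebesgue" unfolding h_def by measurable
    have h0: "\<And>x. 0 \<le> h x" by (simp add: h_def)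
    have hp: "h x powr p = H x" for x using p H0[of x] by (simp add: h_def powr_powr)
    let ?J = "\<integral>\<^sup>+x\<in>?B \<inter> \<Omega>. \<phi> x (f x) * ennreal (\<omega> x) \<partial>lebesgue"
    have Jh: "(\<integral>\<^sup>+x\<in>?B. ennreal (h x powr p * \<omega> x) \<partial>lebesgue) = ?J"
      using \<Phi>H by (intro nn_integral_cong_AE, eventually_elim)
        (auto simp: hp ennreal_mult'' H0 \<omega>_nonneg \<Phi>_def indicator_def split: if_splits)
    have J1: "?J \<le> 1"
      by (rule order_trans[OF _ mod]) (auto intro!: nn_integral_mono simp: indicator_def)
    then have "?J < \<infinity>" by (auto simp: less_top[symmetric] top_unique)
    then obtain a where a: "0 \<le> a"
      "(\<integral>\<^sup>+x\<in>?B. ennreal (h x) \<partial>lebesgue) \<le> ennreal a * emeasure lebesgue ?B"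
      "ennreal (a powr p) * weight_of \<omega> ?B \<le> ennreal K * ?J"
      using avg[OF r, of h c] h0 unfolding Jh by auto
    obtain W where W: "weight_of \<omega> ?B = ennreal W" "0 < W"
      using weight_of_finite[OF weight bounded_ball, of c r] weight_of_ball_pos[OF weight \<omega>_pos r, of c]
      by (cases "weight_of \<omega> ?B") auto
    obtain V where V: "emeasure lebesgue ?B = ennreal V" "0 < V"
      using emeasure_lebesgue_ball[OF r, of c] by (cases "emeasure lebesgue ?B") auto
    have aW: "a powr p * W \<le> K"
    proof -
      have "ennreal (a powr p) * ennreal W \<le> ennreal K * 1"
        using a(3) J1 unfolding W(1) by (meson mult_left_mono order_trans zero_le)
      then show ?thesis using W K by (simp add: ennreal_mult''[symmetric])
    qed
    \<comment> \<open>The level must satisfy 1 <= T and T \<omega>(B) <= 1 for (A1); for \<omega>(B)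
      <= 1 the latter follows from a^p \<omega>(B) <= K.\<close>
    define T where "T = max 1 (a powr p / K)"
    have T1: "1 \<le> T" by (simp add: T_def)
    have "\<exists>S>0. AE y in lebesgue. y \<in> ?B \<inter> \<Omega> \<longrightarrow>
        b * S \<le> left_inverse \<phi> y T \<and> left_inverse \<phi> y T \<le> S"
    proof (cases "W \<le> 1")
      case True
      have "T * W \<le> 1"
        using aW True K by (auto simp: T_def max_def field_simps)
      then obtain S where S: "0 < S" "AE y in lebesgue. y \<in> ball c r \<inter> \<Omega> \<longrightarrow>
        b1 * S \<le> left_inverse \<phi> y T \<and> left_inverse \<phi> y T \<le> S"
        using lev[OF r, of c T] T1 True W ennreal_le_inverse[of W T] by auto
      have "b * S \<le> b1 * S" using S(1) by (intro mult_right_mono) (auto simp: b_def)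
      with S(2) have "AE y in lebesgue. y \<in> ?B \<inter> \<Omega> \<longrightarrow>
          b * S \<le> left_inverse \<phi> y T \<and> left_inverse \<phi> y T \<le> S"
        by eventually_elim (use \<open>b * S \<le> b1 * S\<close> in auto)
      with S(1) show ?thesis by (intro exI[of _ S] conjI)
    next
      case False
      \<comment> \<open>On a ball of weight above 1 the same bound forces a^p <= K, so T = 1 and the
        bounds valid on all of \<Omega> apply.\<close>
      have "a powr p * 1 \<le> a powr p * W" using False by (intro mult_left_mono) auto
      then have "T = 1" using aW K by (simp add: T_def field_simps)
      have "b * S1 \<le> m / S1 * S1" using m(2) by (intro mult_right_mono) (auto simp: b_def)
      then have "b * S1 \<le> m" using m by simp
      with lev1 have "AE y in lebesgue. y \<in> ?B \<inter> \<Omega> \<longrightarrow>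
          b * S1 \<le> left_inverse \<phi> y T \<and> left_inverse \<phi> y T \<le> S1"
        unfolding \<open>T = 1\<close> by eventually_elim (use \<open>b * S1 \<le> m\<close> in auto)
      with m(2) show ?thesis by (intro exI[of _ S1] conjI)
    qed
    then obtain S where S: "0 < S" and AS: "AE y in lebesgue. y \<in> ?B \<inter> \<Omega> \<longrightarrow>
        b * S \<le> left_inverse \<phi> y T \<and> left_inverse \<phi> y T \<le> S" by blast
    \<comment> \<open>Where f > 2 S, (aInc)_p between 2 S and f gives (f / (2 S))^p T <= L h^p, and
      N is the coefficient after taking p-th roots; elsewhere f <= 2 S.\<close>
    define N where "N = (L / T) powr (1 / p)"
    have fh: "AE y in lebesgue. y \<in> ?B \<longrightarrow> f y \<le> 2 * S * (1 + N * h y)"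
      using AS \<Phi>H
    proof eventually_elim
      case (elim y)
      show ?case
      proof
        assume y: "y \<in> ?B"
        have N0: "0 \<le> N * h y" by (simp add: N_def h0)
        show "f y \<le> 2 * S * (1 + N * h y)"
        proof (cases "y \<in> \<Omega> \<and> f y > 2 * S")
          case False
          have "f y \<le> 2 * S * 1" using False f\<Omega>[of y] S by (cases "y \<in> \<Omega>") auto
          also have "\<dots> \<le> 2 * S * (1 + N * h y)" using S N0 by (intro mult_left_mono) auto
          finally show ?thesis .
        next
          case True
          then have y\<Omega>: "y \<in> \<Omega>" and fy: "2 * S < f y" by auto
          \<comment> \<open>2 S rather than S, because \<phi> is known to reach T only strictly
            above the left inverse.\<close>
          have "ennreal T \<le> \<phi> y (2 * S)"
            using left_inverse_less[OF Phi y\<Omega>, of T "2 * S"] elim y y\<Omega> S T1 by auto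
          then have "ennreal ((f y / (2 * S)) powr p) * ennreal T \<le> ennreal ((f y / (2 * S)) powr p) * \<phi> y (2 * S)"
            by (intro mult_left_mono) auto
          also have "\<dots> \<le> ennreal L * \<phi> y (f y)"
            using scale[OF y\<Omega>, of "2 * S" "f y"] S fy by auto
          also have "\<phi> y (f y) = ennreal (H y)"
            using elim y\<Omega> by (simp add: \<Phi>_def)
          finally have "(f y / (2 * S)) powr p * T \<le> L * H y"
            using T1 L H0 by (simp add: ennreal_mult''[symmetric] ennreal_le_iff mult_nonneg_nonneg)
          then have "(f y / (2 * S)) powr p \<le> L / T * H y"
            using T1 by (simp add: field_simps)
          then have "((f y / (2 * S)) powr p) powr (1 / p) \<le> (L / T * H y) powr (1 / p)"
            using p by (intro powr_mono2) auto
          moreover have "(L / T * H y) powr (1 / p) = N * h y"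
            unfolding N_def h_def by (simp only: powr_mult)
          moreover have "((f y / (2 * S)) powr p) powr (1 / p) = f y / (2 * S)"
            using p S f0[of y] by (simp add: powr_powr)
          ultimately have "f y / (2 * S) \<le> N * h y" by simp
          then have "2 * S * (f y / (2 * S)) \<le> 2 * S * (N * h y)"
            using S by (intro mult_left_mono) auto
          then show ?thesis using S by (simp add: distrib_left)
        qed
      qed
    qed
    have "ennreal (g * V) \<le> (\<integral>\<^sup>+x\<in>?B. ennreal (f x) \<partial>lebesgue)"
      using gf g V by (simp add: ennreal_mult'')
    also have "\<dots> \<le> (\<integral>\<^sup>+x. ennreal (2 * S) * indicator ?B x + ennreal (2 * S * N) * (ennreal (h x) * indicator ?B x) \<partial>lebesgue)"
    proof (rule nn_integral_mono_AE)
      show "AE x in lebesgue. ennreal (f x) * indicator ?B x \<le>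
          ennreal (2 * S) * indicator ?B x + ennreal (2 * S * N) * (ennreal (h x) * indicator ?B x)"
        using fh
      proof eventually_elim
        case (elim x)
        show ?case
        proof (cases "x \<in> ?B")
          case True
          then have "ennreal (f x) \<le> ennreal (2 * S + 2 * S * N * h x)"
            using elim by (intro ennreal_leI) (simp add: algebra_simps)
          also have "\<dots> = ennreal (2 * S) + ennreal (2 * S * N) * ennreal (h x)"
            using S h0[of x] by (simp add: ennreal_mult''[symmetric] N_def)
          finally show ?thesis using True by simp
        qed auto
      qed
    qed
    also have "\<dots> = ennreal (2 * S) * ennreal V + ennreal (2 * S * N) * (\<integral>\<^sup>+x\<in>?B. ennreal (h x) \<partial>lebesgue)"
      using V by (subst nn_integral_add) (auto simp: nn_integral_cmult nn_integral_cmult_indicator)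
    also have "\<dots> \<le> ennreal (2 * S) * ennreal V + ennreal (2 * S * N) * (ennreal a * ennreal V)"
      using a(2) V by (intro add_left_mono mult_left_mono) auto
    also have "\<dots> = ennreal (2 * S * (1 + N * a) * V)"
      using S V a by (simp add: ennreal_mult''[symmetric] N_def ennreal_plus[symmetric] algebra_simps del: ennreal_plus)
    finally have "g * V \<le> 2 * S * (1 + N * a) * V"
      using S V a g by (subst (asm) ennreal_le_iff) (auto simp: N_def)
    then have "g \<le> 2 * S * (1 + N * a)" using V by simp
    \<comment> \<open>The level cancels: a^p <= K T, while N carries T^(-1/p). Hence the bound on g
      is S times a constant independent of ball and level.\<close>
    also have "N * a \<le> (L * K) powr (1 / p)"
    proof -
      have "a powr p \<le> K * T" using K by (auto simp: T_def field_simps max_def)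
      then have "(a powr p) powr (1 / p) \<le> (K * T) powr (1 / p)"
        using p by (intro powr_mono2) auto
      then have "a \<le> (K * T) powr (1 / p)" using a p by (simp add: powr_powr)
      then have "N * a \<le> (L / T) powr (1 / p) * (K * T) powr (1 / p)"
        unfolding N_def by (intro mult_left_mono) auto
      also have "\<dots> = (L / T * (K * T)) powr (1 / p)" by (simp only: powr_mult)
      also have "L / T * (K * T) = L * K" using T1 by simp
      finally show ?thesis .
    qed
    finally have gM: "g \<le> 2 * S * M"
      using S unfolding M_def by simp
    have "\<kappa> * g \<le> \<kappa> * (2 * S * M)" using gM \<kappa> by (intro mult_left_mono) auto
    also have "\<dots> = b * S / 2" using M by (simp add: \<kappa>_def field_simps)
    also have "\<dots> < b * S" using b S by simp
    finally have \<kappa>g: "\<kappa> * g < b * S" .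
    have "(\<integral>\<^sup>+x\<in>Q \<inter> \<Omega>. \<phi> x (\<kappa> * g) * ennreal (\<omega> x) \<partial>lebesgue)
        \<le> (\<integral>\<^sup>+x. ennreal T * (ennreal (\<omega> x) * indicator (Q \<inter> \<Omega>) x) \<partial>lebesgue)"
    proof (rule nn_integral_mono_AE)
      show "AE x in lebesgue. \<phi> x (\<kappa> * g) * ennreal (\<omega> x) * indicator (Q \<inter> \<Omega>) x
        \<le> ennreal T * (ennreal (\<omega> x) * indicator (Q \<inter> \<Omega>) x)"
        using AS
      proof eventually_elim
        case (elim x)
        show ?case
        proof (cases "x \<in> Q \<inter> \<Omega>")
          case True
          then have "\<kappa> * g < left_inverse \<phi> x T" using elim QB \<kappa>g by auto
          then have "\<phi> x (\<kappa> * g) \<le> ennreal T"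
            using less_left_inverse[OF Phi, of x T "\<kappa> * g"] True T1 \<kappa> g by auto
          then show ?thesis using True by (simp add: mult_right_mono)
        qed simp
      qed
    qed
    also have "\<dots> = ennreal T * weight_of \<omega> (Q \<inter> \<Omega>)"
      unfolding weight_of_def by (subst nn_integral_cmult) auto
    \<comment> \<open>Bounding the maximum T by a sum separates the weight of Q from a term to which
      a^p \<omega>(B) <= K \<open>?J\<close>, the second use of A_p, applies.\<close>
    also have "\<dots> \<le> ennreal (1 + a powr p / K) * weight_of \<omega> (Q \<inter> \<Omega>)"
      using K by (intro mult_right_mono ennreal_leI) (auto simp: T_def)
    also have "\<dots> = weight_of \<omega> (Q \<inter> \<Omega>) + ennreal (a powr p / K) * weight_of \<omega> (Q \<inter> \<Omega>)"
      using K by (subst ennreal_plus) (auto simp: distrib_right)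
    also have "ennreal (a powr p / K) * weight_of \<omega> (Q \<inter> \<Omega>) \<le> ennreal (a powr p / K) * weight_of \<omega> ?B"
      using QB by (intro mult_left_mono weight_of_mono) auto
    also have "\<dots> = ennreal (1 / K) * (ennreal (a powr p) * weight_of \<omega> ?B)"
      using K by (simp add: mult.assoc[symmetric] ennreal_mult''[symmetric])
    also have "\<dots> \<le> ennreal (1 / K) * (ennreal K * ?J)"
      using a(3) by (intro mult_left_mono) auto
    also have "\<dots> = ?J"
      using K by (simp add: mult.assoc[symmetric] ennreal_mult''[symmetric])
    finally show ?thesis by (simp add: add_left_mono)
  qed
  with \<kappa> show ?thesis by blast
qed

end

section \<open>Grid cells and their balls\<close>

definition grid_index :: "real \<Rightarrow> real ^ 'n \<Rightarrow> int ^ 'n" where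
  "grid_index h x = (\<chi> i. \<lfloor>x $ i / h\<rfloor>)"

text \<open>The centre is the lower corner of the cell, at distance at most n h from its points (n
  the dimension). The remaining 3 h is the reach of the segments x + t z with t <= h and norm z <=
  3.\<close>

definition grid_ball :: "real \<Rightarrow> int ^ 'n \<Rightarrow> (real ^ 'n) set" where
  "grid_ball h m = ball (\<chi> i. h * of_int (m $ i)) ((3 + real CARD('n)) * h)"

lemma grid_ball_superset:
  fixes x :: "real ^ 'n"
  assumes "0 < h" "grid_index h x = m"
  shows "ball x (3 * h) \<subseteq> grid_ball h m"
proof -
  have "\<bar>(x - (\<chi> i. h * of_int (m $ i))) $ i\<bar> \<le> h" for i
  proof -
    have "m $ i = \<lfloor>x $ i / h\<rfloor>" using assms(2) by (auto simp: grid_index_def)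
    then have "of_int (m $ i) \<le> x $ i / h" "x $ i / h < of_int (m $ i) + 1"
      by linarith+
    then have "h * of_int (m $ i) \<le> x $ i" "x $ i < h * of_int (m $ i) + h"
      using assms(1) by (auto simp: field_simps)
    then show ?thesis by (simp add: abs_le_iff)
  qed
  then have "norm (x - (\<chi> i. h * of_int (m $ i))) \<le> (\<Sum>i\<in>(UNIV :: 'n set). h)"
    by (intro order_trans[OF norm_le_l1_cart] sum_mono)
  then have "dist (\<chi> i. h * of_int (m $ i)) x \<le> real CARD('n) * h"
    by (simp add: dist_norm norm_minus_commute)
  then show ?thesis
    unfolding grid_ball_def by (intro subset_iff[THEN iffD2] allI impI)
      (auto simp: algebra_simps intro: le_less_trans[OF dist_triangle[of _ _ x]])
qed

text \<open>After scaling by h, the index m of a ball containing y differs from the index of the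
  cell of y by an integer vector in a fixed finite cube F, so the count is bounded independently of
  h and y.\<close>

lemma grid_ball_overlap:
  "\<exists>N::nat. \<forall>h>0. \<forall>y :: real ^ 'n. finite {m. y \<in> grid_ball h m} \<and> card {m. y \<in> grid_ball h m} \<le> N"
proof -
  define M :: int where "M = 3 + int CARD('n)"
  \<comment> \<open>Rounding y / h down raises the difference of the indices by less than 1; hence
    the upper end M + 1.\<close>
  define F where "F = {v :: int ^ 'n. \<forall>i. v $ i \<in> {-M..M+1}}"
  have "finite (vec_lambda ` (PiE UNIV (\<lambda>_ :: 'n. {-M..M+1})) :: (int ^ 'n) set)"
    by (intro finite_imageI finite_PiE) auto
  moreover have "F \<subseteq> vec_lambda ` (PiE UNIV (\<lambda>_ :: 'n. {-M..M+1}))"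
  proof
    fix v assume "v \<in> F"
    then have "v = vec_lambda (vec_nth v)" "vec_nth v \<in> PiE UNIV (\<lambda>_ :: 'n. {-M..M+1})"
      by (auto simp: F_def)
    then show "v \<in> vec_lambda ` (PiE UNIV (\<lambda>_ :: 'n. {-M..M+1}))" by (rule image_eqI)
  qed
  ultimately have F: "finite F" by (rule finite_subset[rotated])
  have sub: "{m. y \<in> grid_ball h m} \<subseteq> (\<lambda>v. v + grid_index h y) ` F" if h: "0 < h" for h and y :: "real ^ 'n"
  proof
    fix m assume "m \<in> {m. y \<in> grid_ball h m}"
    then have *: "norm (y - (\<chi> i. h * of_int (m $ i))) < (3 + real CARD('n)) * h"
      by (simp add: grid_ball_def dist_norm norm_minus_commute)
    have "m - grid_index h y \<in> F"
      unfolding F_def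
    proof (intro CollectI allI)
      fix i
      have "\<bar>y $ i - h * of_int (m $ i)\<bar> < (3 + real CARD('n)) * h"
        using component_le_norm_cart[of "y - (\<chi> i. h * of_int (m $ i))" i] * by simp
      moreover have "y $ i - h * of_int (m $ i) = (y $ i / h - of_int (m $ i)) * h"
        using h by (simp add: field_simps)
      ultimately have "\<bar>y $ i / h - of_int (m $ i)\<bar> * h < (3 + real CARD('n)) * h"
        using h by (simp add: abs_mult)
      then have "\<bar>y $ i / h - of_int (m $ i)\<bar> < of_int M"
        using h by (simp add: M_def)
      then have "m $ i - \<lfloor>y $ i / h\<rfloor> \<in> {-M..M+1}"
        by (simp add: abs_less_iff) linarith
      then show "(m - grid_index h y) $ i \<in> {-M..M+1}" by (simp add: grid_index_def)
    qed
    then show "m \<in> (\<lambda>v. v + grid_index h y) ` F" by (intro image_eqI[of _ _ "m - grid_index h y"]) auto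
  qed
  have "finite {m. y \<in> grid_ball h m} \<and> card {m. y \<in> grid_ball h m} \<le> card F" if h: "0 < h" for h and y :: "real ^ 'n"
  proof -
    have "finite ((\<lambda>v. v + grid_index h y) ` F)" using F by simp
    then show ?thesis
      using sub[OF h, of y] card_image_le[OF F, of "\<lambda>v. v + grid_index h y"]
      by (meson card_mono finite_subset order_trans)
  qed
  then show ?thesis by blast
qed

lemma grid_index_measurable [measurable]: "{x. grid_index h x = m} \<in> sets lebesgue"
proof -
  have "{x. grid_index h x = m} = (\<Inter>i. {x. \<lfloor>x $ i / h\<rfloor> = m $ i})"
    by (auto simp: grid_index_def vec_eq_iff)
  also have "\<dots> \<in> sets borel" by measurable
  finally show ?thesis by (simp add: sets_completionI_sets)
qed

text \<open>Sums over cells are written as integrals over a counting measure so that they can be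
  exchanged with the integral in x. For fixed x only the cell of x contributes.\<close>

lemma nn_integral_count_space_indicator_eq:
  "(\<integral>\<^sup>+m. F m * indicator {x. I x = m} x \<partial>count_space UNIV) = (F (I x) :: ennreal)"
proof -
  have "(\<integral>\<^sup>+m. F m * indicator {x. I x = m} x \<partial>count_space UNIV) =
      (\<integral>\<^sup>+m. F m * indicator {I x} m \<partial>count_space UNIV)"
    by (intro nn_integral_cong) (auto simp: indicator_def)
  also have "\<dots> = F (I x)" by (subst nn_integral_indicator_singleton) auto
  finally show ?thesis .
qed

context weighted_orlicz
begin

text \<open>\<open>modular_average_ball\<close> is summed over the cells, which partition the space
  and whose balls overlap boundedly. That A and \<kappa> do not depend on the scale h is what later
  permits summation over scales.\<close>

lemma modular_average_grid:
  "\<exists>\<kappa>>0. \<exists>A>0. \<forall>f h G. f \<in> borel_measurable lebesgue \<longrightarrow> (\<forall>x. 0 \<le> f x) \<longrightarrow> (\<forall>x. x \<notin> \<Omega> \<longrightarrow> f x = 0) \<longrightarrow>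
     (\<integral>\<^sup>+x\<in>\<Omega>. \<phi> x (f x) * ennreal (\<omega> x) \<partial>lebesgue) \<le> 1 \<longrightarrow> 0 < h \<longrightarrow>
     (\<forall>m. 0 \<le> G m \<and> ennreal (G m) * emeasure lebesgue (grid_ball h m)
        \<le> (\<integral>\<^sup>+x\<in>grid_ball h m. ennreal (f x) \<partial>lebesgue)) \<longrightarrow>
     (\<integral>\<^sup>+x\<in>\<Omega>. \<phi> x (\<kappa> * G (grid_index h x)) * ennreal (\<omega> x) \<partial>lebesgue) \<le> ennreal A"
proof -
  obtain \<kappa> where \<kappa>: "\<kappa> > 0" and main:
    "\<And>f c r Q g. f \<in> borel_measurable lebesgue \<Longrightarrow> (\<forall>x. 0 \<le> f x) \<Longrightarrow> (\<forall>x. x \<notin> \<Omega> \<longrightarrow> f x = 0) \<Longrightarrow>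
     (\<integral>\<^sup>+x\<in>\<Omega>. \<phi> x (f x) * ennreal (\<omega> x) \<partial>lebesgue) \<le> 1 \<Longrightarrow>
     0 < r \<Longrightarrow> Q \<in> sets lebesgue \<Longrightarrow> Q \<subseteq> ball c r \<Longrightarrow> 0 \<le> g \<Longrightarrow>
     ennreal g * emeasure lebesgue (ball c r) \<le> (\<integral>\<^sup>+x\<in>ball c r. ennreal (f x) \<partial>lebesgue) \<Longrightarrow>
     (\<integral>\<^sup>+x\<in>Q \<inter> \<Omega>. \<phi> x (\<kappa> * g) * ennreal (\<omega> x) \<partial>lebesgue)
       \<le> weight_of \<omega> (Q \<inter> \<Omega>) + (\<integral>\<^sup>+x\<in>ball c r \<inter> \<Omega>. \<phi> x (f x) * ennreal (\<omega> x) \<partial>lebesgue)"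
    using modular_average_ball by blast
  obtain N :: nat where N: "\<And>h y. 0 < h \<Longrightarrow> finite {m. y \<in> (grid_ball h m :: (real ^ 'n) set)}"
      "\<And>h y. 0 < h \<Longrightarrow> card {m. y \<in> (grid_ball h m :: (real ^ 'n) set)} \<le> N"
    using grid_ball_overlap[where 'n = 'n] by blast
  obtain W where W: "weight_of \<omega> \<Omega> = ennreal W" "0 \<le> W"
    using weight_of_finite[OF weight bounded_\<Omega>] by (cases "weight_of \<omega> \<Omega>") auto
  \<comment> \<open>W bounds the sum of the weights of the cells, N the overlapping integrals of a
    modular at most 1; the 1 ensures positivity.\<close>
  define A where "A = W + N + 1"
  have A: "A > 0" using W by (simp add: A_def)
  have "(\<integral>\<^sup>+x\<in>\<Omega>. \<phi> x (\<kappa> * G (grid_index h x)) * ennreal (\<omega> x) \<partial>lebesgue) \<le> ennreal A"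
    if f[measurable]: "f \<in> borel_measurable lebesgue" and f0: "\<And>x. 0 \<le> f x"
      and f\<Omega>: "\<And>x. x \<notin> \<Omega> \<Longrightarrow> f x = 0"
      and mod: "(\<integral>\<^sup>+x\<in>\<Omega>. \<phi> x (f x) * ennreal (\<omega> x) \<partial>lebesgue) \<le> 1"
      and h: "0 < h" and G0: "\<And>m. 0 \<le> G m" and G: "\<And>m. ennreal (G m) * emeasure lebesgue (grid_ball h m)
        \<le> (\<integral>\<^sup>+x\<in>grid_ball h m. ennreal (f x) \<partial>lebesgue)" for f h G
  proof -
    let ?C = "\<lambda>m. {x. grid_index h x = m}"
    define u where "u = (\<lambda>m x. \<phi> x (\<kappa> * G m) * indicator \<Omega> x)"
    have [measurable]: "u m \<in> borel_measurable lebesgue" for m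
      unfolding u_def by (rule Phi_prefunction_measurable[OF Phi _ sets_\<Omega>]) (use \<kappa> G0 in auto)
    define \<Phi> where "\<Phi> = (\<lambda>x. \<phi> x (f x) * indicator \<Omega> x)"
    have [measurable]: "\<Phi> \<in> borel_measurable lebesgue"
      unfolding \<Phi>_def
      by (rule Phi_prefunction_measurable[OF Phi _ sets_\<Omega>]) (auto intro: measurable_restrict_space1 f0)
    have [measurable]: "grid_ball h m \<in> sets lebesgue" for m :: "int ^ 'n"
      by (simp add: grid_ball_def)
    have sub: "?C m \<subseteq> grid_ball h m" for m :: "int ^ 'n"
      using grid_ball_superset[OF h] h by (fastforce simp: subset_iff)
    have "(\<integral>\<^sup>+x\<in>\<Omega>. \<phi> x (\<kappa> * G (grid_index h x)) * ennreal (\<omega> x) \<partial>lebesgue) =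
        (\<integral>\<^sup>+x. \<integral>\<^sup>+m. (u m x * ennreal (\<omega> x)) * indicator (?C m) x \<partial>count_space UNIV \<partial>lebesgue)"
      by (intro nn_integral_cong) (simp only: nn_integral_count_space_indicator_eq, simp add: u_def mult_ac)
    also have "\<dots> = (\<integral>\<^sup>+m. \<integral>\<^sup>+x. (u m x * ennreal (\<omega> x)) * indicator (?C m) x \<partial>lebesgue \<partial>count_space UNIV)"
      by (rule nn_integral_count_space_nn_integral) auto
    also have "\<dots> \<le> (\<integral>\<^sup>+m. weight_of \<omega> (?C m \<inter> \<Omega>) +
        (\<integral>\<^sup>+x. (\<Phi> x * ennreal (\<omega> x)) * indicator (grid_ball h m) x \<partial>lebesgue) \<partial>count_space UNIV)"
    proof (rule nn_integral_mono)
      fix m :: "int ^ 'n"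
      have "(\<integral>\<^sup>+x. (u m x * ennreal (\<omega> x)) * indicator (?C m) x \<partial>lebesgue) =
          (\<integral>\<^sup>+x\<in>?C m \<inter> \<Omega>. \<phi> x (\<kappa> * G m) * ennreal (\<omega> x) \<partial>lebesgue)"
        by (intro nn_integral_cong) (auto simp: u_def indicator_def)
      also have "\<dots> \<le> weight_of \<omega> (?C m \<inter> \<Omega>) + (\<integral>\<^sup>+x\<in>grid_ball h m \<inter> \<Omega>. \<phi> x (f x) * ennreal (\<omega> x) \<partial>lebesgue)"
        unfolding grid_ball_def
        by (rule main) (use f f0 f\<Omega> mod h G0 G sub in \<open>auto simp: grid_ball_def\<close>)
      also have "(\<integral>\<^sup>+x\<in>grid_ball h m \<inter> \<Omega>. \<phi> x (f x) * ennreal (\<omega> x) \<partial>lebesgue)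
          = (\<integral>\<^sup>+x. (\<Phi> x * ennreal (\<omega> x)) * indicator (grid_ball h m) x \<partial>lebesgue)"
        by (intro nn_integral_cong) (auto simp: \<Phi>_def indicator_def)
      finally show "(\<integral>\<^sup>+x. (u m x * ennreal (\<omega> x)) * indicator (?C m) x \<partial>lebesgue) \<le> weight_of \<omega> (?C m \<inter> \<Omega>) +
        (\<integral>\<^sup>+x. (\<Phi> x * ennreal (\<omega> x)) * indicator (grid_ball h m) x \<partial>lebesgue)" .
    qed
    also have "\<dots> = (\<integral>\<^sup>+m. weight_of \<omega> (?C m \<inter> \<Omega>) \<partial>count_space UNIV) +
        (\<integral>\<^sup>+m. \<integral>\<^sup>+x. (\<Phi> x * ennreal (\<omega> x)) * indicator (grid_ball h m) x \<partial>lebesgue \<partial>count_space UNIV)"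
      by (rule nn_integral_add) auto
    also have "(\<integral>\<^sup>+m. weight_of \<omega> (?C m \<inter> \<Omega>) \<partial>count_space UNIV) =
        (\<integral>\<^sup>+m. \<integral>\<^sup>+x. (ennreal (\<omega> x) * indicator \<Omega> x) * indicator (?C m) x \<partial>lebesgue \<partial>count_space UNIV)"
      unfolding weight_of_def by (intro nn_integral_cong) (auto simp: indicator_def)
    also have "\<dots> = (\<integral>\<^sup>+x. \<integral>\<^sup>+m. (ennreal (\<omega> x) * indicator \<Omega> x) * indicator (?C m) x \<partial>count_space UNIV \<partial>lebesgue)"
      by (rule nn_integral_count_space_nn_integral[symmetric]) auto
    also have "\<dots> = weight_of \<omega> \<Omega>"
      unfolding weight_of_def by (simp add: nn_integral_count_space_indicator_eq)
    also have "(\<integral>\<^sup>+m. \<integral>\<^sup>+x. (\<Phi> x * ennreal (\<omega> x)) * indicator (grid_ball h m) x \<partial>lebesgue \<partial>count_space UNIV)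
        = (\<integral>\<^sup>+x. \<integral>\<^sup>+m. (\<Phi> x * ennreal (\<omega> x)) * indicator (grid_ball h m) x \<partial>count_space UNIV \<partial>lebesgue)"
      by (rule nn_integral_count_space_nn_integral[symmetric]) auto
    also have "\<dots> \<le> (\<integral>\<^sup>+x. of_nat N * (\<Phi> x * ennreal (\<omega> x)) \<partial>lebesgue)"
    proof (rule nn_integral_mono)
      fix x
      have "(\<integral>\<^sup>+m. (\<Phi> x * ennreal (\<omega> x)) * indicator (grid_ball h m) x \<partial>count_space UNIV) =
          (\<integral>\<^sup>+m. (\<Phi> x * ennreal (\<omega> x)) * indicator {m. x \<in> grid_ball h m} m \<partial>count_space UNIV)"
        by (intro nn_integral_cong) (auto simp: indicator_def)
      also have "\<dots> = (\<Phi> x * ennreal (\<omega> x)) * of_nat (card {m. x \<in> grid_ball h m})"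
        using N(1)[OF h, of x] by (subst nn_integral_cmult_indicator) (auto simp: emeasure_count_space_finite)
      also have "\<dots> \<le> (\<Phi> x * ennreal (\<omega> x)) * of_nat N"
        using N(2)[OF h, of x] by (intro mult_left_mono) auto
      finally show "(\<integral>\<^sup>+m. (\<Phi> x * ennreal (\<omega> x)) * indicator (grid_ball h m) x \<partial>count_space UNIV)
          \<le> of_nat N * (\<Phi> x * ennreal (\<omega> x))" by (simp add: mult_ac)
    qed
    also have "\<dots> = of_nat N * (\<integral>\<^sup>+x. \<Phi> x * ennreal (\<omega> x) \<partial>lebesgue)"
      by (rule nn_integral_cmult) auto
    also have "\<dots> \<le> of_nat N * 1"
      using mod by (intro mult_left_mono) (auto simp: \<Phi>_def mult_ac)
    also have "weight_of \<omega> \<Omega> + of_nat N * 1 \<le> ennreal A"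
      using W by (simp add: A_def ennreal_of_nat_eq_real_of_nat flip: ennreal_plus)
    finally show ?thesis by (simp add: add_left_mono)
  qed
  then have "\<forall>f h G. f \<in> borel_measurable lebesgue \<longrightarrow> (\<forall>x. 0 \<le> f x) \<longrightarrow> (\<forall>x. x \<notin> \<Omega> \<longrightarrow> f x = 0) \<longrightarrow>
     (\<integral>\<^sup>+x\<in>\<Omega>. \<phi> x (f x) * ennreal (\<omega> x) \<partial>lebesgue) \<le> 1 \<longrightarrow> 0 < h \<longrightarrow>
     (\<forall>m. 0 \<le> G m \<and> ennreal (G m) * emeasure lebesgue (grid_ball h m)
        \<le> (\<integral>\<^sup>+x\<in>grid_ball h m. ennreal (f x) \<partial>lebesgue)) \<longrightarrow>
     (\<integral>\<^sup>+x\<in>\<Omega>. \<phi> x (\<kappa> * G (grid_index h x)) * ennreal (\<omega> x) \<partial>lebesgue) \<le> ennreal A"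
    by blast
  with \<kappa> A show ?thesis by (intro exI[of _ \<kappa>] exI[of _ A] conjI)
qed

end

section \<open>Integration along segments\<close>

text \<open>A substitute for Jensen's inequality. If the weighted mean of the g k is at least 2 s,
  the positive parts of g k / s - 1 have weighted sum at least 1; only terms with g k >= s
  contribute, and for these (aInc)_1 gives (g k / s) \<phi> s <= L \<phi> (g k).\<close>

lemma aInc1_countable_average:
  fixes w g :: "nat \<Rightarrow> real"
  assumes scale: "\<And>s t. 0 < s \<Longrightarrow> s \<le> t \<Longrightarrow> ennreal (t / s) * \<phi> s \<le> ennreal L * \<phi> t"
    and w: "\<And>k. 0 \<le> w k" "(\<Sum>k. ennreal (w k)) = 1"
    and g: "\<And>k. 0 \<le> g k" and s: "0 < s" "ennreal (2 * s) \<le> (\<Sum>k. ennreal (w k * g k))"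
  shows "\<phi> s \<le> ennreal L * (\<Sum>k. ennreal (w k) * \<phi> (g k))"
proof -
  have "2 = ennreal (1 / s) * ennreal (2 * s)"
    using s(1) by (simp add: ennreal_mult''[symmetric])
  also have "\<dots> \<le> ennreal (1 / s) * (\<Sum>k. ennreal (w k * g k))"
    using s(2) by (intro mult_left_mono) auto
  also have "\<dots> = (\<Sum>k. ennreal (1 / s) * ennreal (w k * g k))"
    by (rule ennreal_suminf_cmult[symmetric])
  also have "\<dots> \<le> (\<Sum>k. ennreal (w k) + ennreal (w k * (g k / s - 1)))"
  proof (rule suminf_le)
    fix k
    have "ennreal (1 / s) * ennreal (w k * g k) = ennreal (w k + w k * (g k / s - 1))"
      using s(1) w(1)[of k] g[of k] by (simp add: ennreal_mult''[symmetric] field_simps)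
    \<comment> \<open>\<open>ennreal\<close> sends negative numbers to 0, so the last summand is the
      positive part.\<close>
    also have "\<dots> \<le> ennreal (w k) + ennreal (w k * (g k / s - 1))"
      using w(1)[of k] by (cases "0 \<le> w k * (g k / s - 1)")
        (auto simp: ennreal_neg intro!: ennreal_leI)
    finally show "ennreal (1 / s) * ennreal (w k * g k) \<le> ennreal (w k) + ennreal (w k * (g k / s - 1))" .
  qed auto
  also have "\<dots> = 1 + (\<Sum>k. ennreal (w k * (g k / s - 1)))"
    by (subst suminf_add[symmetric]) (auto simp: w(2))
  finally have "1 + 1 \<le> 1 + (\<Sum>k. ennreal (w k * (g k / s - 1)))" by simp
  then have one: "1 \<le> (\<Sum>k. ennreal (w k * (g k / s - 1)))"
    by (subst (asm) ennreal_add_left_cancel_le) auto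
  have "\<phi> s \<le> (\<Sum>k. ennreal (w k * (g k / s - 1))) * \<phi> s"
    using mult_right_mono[OF one, of "\<phi> s"] by simp
  also have "\<dots> = (\<Sum>k. ennreal (w k * (g k / s - 1)) * \<phi> s)"
    by (rule ennreal_suminf_multc[symmetric])
  also have "\<dots> \<le> (\<Sum>k. ennreal L * (ennreal (w k) * \<phi> (g k)))"
  proof (rule suminf_le)
    fix k
    show "ennreal (w k * (g k / s - 1)) * \<phi> s \<le> ennreal L * (ennreal (w k) * \<phi> (g k))"
    proof (cases "s \<le> g k")
      case True
      have "ennreal (w k * (g k / s - 1)) \<le> ennreal (w k * (g k / s))"
        using w(1)[of k] by (intro ennreal_leI mult_left_mono) auto
      also have "\<dots> = ennreal (w k) * ennreal (g k / s)"
        using w(1)[of k] g[of k] s(1) by (intro ennreal_mult) auto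
      finally have "ennreal (w k * (g k / s - 1)) * \<phi> s \<le> ennreal (w k) * (ennreal (g k / s) * \<phi> s)"
        unfolding mult.assoc[symmetric] by (rule mult_right_mono) auto
      also have "\<dots> \<le> ennreal (w k) * (ennreal L * \<phi> (g k))"
        using scale[OF s(1) True] by (intro mult_left_mono) auto
      finally show ?thesis by (simp add: mult_ac)
    next
      case False
      then have "w k * (g k / s - 1) \<le> 0"
        using s(1) w(1)[of k] by (intro mult_nonneg_nonpos) auto
      then show ?thesis by (simp add: ennreal_neg)
    qed
  qed auto
  also have "\<dots> = ennreal L * (\<Sum>k. ennreal (w k) * \<phi> (g k))"
    by (rule ennreal_suminf_cmult)
  finally show ?thesis .
qed

definition grid_average :: "(real ^ 'n \<Rightarrow> real) \<Rightarrow> real \<Rightarrow> int ^ 'n \<Rightarrow> real" where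
  "grid_average f h m =
     enn2real (\<integral>\<^sup>+x\<in>grid_ball h m. ennreal (f x) \<partial>lebesgue) / measure lebesgue (grid_ball h m)"

lemma grid_average_nonneg: "0 \<le> grid_average f h m"
  by (simp add: grid_average_def)

text \<open>A continuous f is bounded above on the ball, so the integral is finite and
  \<open>enn2real\<close> loses nothing.\<close>

lemma grid_average_eq:
  fixes f :: "real ^ 'n \<Rightarrow> real"
  assumes "continuous_on UNIV f" "0 < h"
  shows "ennreal (grid_average f h m) * emeasure lebesgue (grid_ball h m)
    = (\<integral>\<^sup>+x\<in>grid_ball h m. ennreal (f x) \<partial>lebesgue)"
proof -
  let ?B = "grid_ball h m"
  have r: "0 < (3 + real CARD('n)) * h" using assms(2) by (simp add: add_pos_nonneg)
  obtain c r where B: "?B = ball c r" "0 < r" unfolding grid_ball_def using r by blast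
  have fin: "emeasure lebesgue ?B < \<infinity>" "emeasure lebesgue ?B > 0"
    using emeasure_lebesgue_ball[OF B(2), of c] unfolding B(1) by auto
  have "compact (f ` cball c r)"
    using assms(1) by (intro compact_continuous_image) (auto intro: continuous_on_subset)
  then have "bounded (f ` cball c r)" by (rule compact_imp_bounded)
  then obtain b where "\<forall>y\<in>f ` cball c r. norm y \<le> b" unfolding bounded_iff by (rule exE)
  then have b: "f x \<le> b" if "x \<in> ball c r" for x
    using that by (force simp: abs_le_iff)
  have "(\<integral>\<^sup>+x\<in>?B. ennreal (f x) \<partial>lebesgue) \<le> (\<integral>\<^sup>+x. ennreal b * indicator ?B x \<partial>lebesgue)"
    by (intro nn_integral_mono) (auto simp: B(1) indicator_def intro!: ennreal_leI b)
  also have "\<dots> = ennreal b * emeasure lebesgue ?B"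
    by (subst nn_integral_cmult_indicator) (auto simp: B(1))
  also have "\<dots> < \<infinity>" using fin by (simp add: ennreal_mult_less_top)
  finally have I: "(\<integral>\<^sup>+x\<in>?B. ennreal (f x) \<partial>lebesgue) < \<infinity>" .
  have e: "emeasure lebesgue ?B = ennreal (measure lebesgue ?B)"
    using fin by (intro emeasure_eq_ennreal_measure) auto
  then have "0 < measure lebesgue ?B" using fin(2) by (metis ennreal_less_zero_iff)
  then have "ennreal (grid_average f h m) * emeasure lebesgue ?B
      = ennreal (enn2real (\<integral>\<^sup>+x\<in>?B. ennreal (f x) \<partial>lebesgue))"
    unfolding e grid_average_def by (simp add: ennreal_mult''[symmetric])
  then show ?thesis using I by simp
qed

section \<open>Line integrals decomposed into dyadic scales\<close>

lemma abs_le_line_integral: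
  fixes \<eta> :: "'a::euclidean_space \<Rightarrow> real"
  assumes der: "\<And>y. (\<eta> has_derivative (\<lambda>v. F y \<bullet> v)) (at y)" and cont: "continuous_on UNIV F"
    and "0 < R" "\<eta> (x + R *\<^sub>R z) = 0" "norm z \<le> M"
  shows "ennreal \<bar>\<eta> x\<bar> \<le> (\<integral>\<^sup>+t\<in>{0..R}. ennreal (M * norm (F (x + t *\<^sub>R z))) \<partial>lborel)"
proof -
  have cF: "continuous_on S (\<lambda>t. F (x + t *\<^sub>R z))" for S
    by (rule continuous_on_compose2[OF cont]) (auto intro!: continuous_intros)
  have "((\<lambda>t. F (x + t *\<^sub>R z) \<bullet> z) has_integral (\<eta> (x + R *\<^sub>R z) - \<eta> (x + 0 *\<^sub>R z))) {0..R}"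
  proof (rule fundamental_theorem_of_calculus)
    fix t
    have "((\<lambda>t. \<eta> (x + t *\<^sub>R z)) has_derivative (\<lambda>s. F (x + t *\<^sub>R z) \<bullet> (s *\<^sub>R z))) (at t within {0..R})"
      by (rule has_derivative_compose[OF _ der]) (auto intro!: derivative_eq_intros)
    then show "((\<lambda>t. \<eta> (x + t *\<^sub>R z)) has_vector_derivative F (x + t *\<^sub>R z) \<bullet> z) (at t within {0..R})"
      by (simp add: has_vector_derivative_def)
  qed (use assms in auto)
  then have I: "((\<lambda>t. F (x + t *\<^sub>R z) \<bullet> z) has_integral (- \<eta> x)) {0..R}"
    using assms by simp
  have J: "((\<lambda>t. M * norm (F (x + t *\<^sub>R z))) has_integral integral {0..R} (\<lambda>t. M * norm (F (x + t *\<^sub>R z)))) {0..R}"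
    by (intro integrable_integral integrable_continuous_real continuous_intros cF)
  have M0: "0 \<le> M" using assms(5) norm_ge_zero order_trans by blast
  have "norm (integral {0..R} (\<lambda>t. F (x + t *\<^sub>R z) \<bullet> z)) \<le> integral {0..R} (\<lambda>t. M * norm (F (x + t *\<^sub>R z)))"
  proof (rule integral_norm_bound_integral)
    fix t
    have "\<bar>F (x + t *\<^sub>R z) \<bullet> z\<bar> \<le> norm (F (x + t *\<^sub>R z)) * norm z" by (rule Cauchy_Schwarz_ineq2)
    also have "\<dots> \<le> norm (F (x + t *\<^sub>R z)) * M" using assms(5) by (intro mult_left_mono) auto
    finally show "norm (F (x + t *\<^sub>R z) \<bullet> z) \<le> M * norm (F (x + t *\<^sub>R z))" by (simp add: mult.commute)
  qed (use I J in auto)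
  also have "integral {0..R} (\<lambda>t. F (x + t *\<^sub>R z) \<bullet> z) = - \<eta> x" using I by (rule integral_unique)
  finally have "\<bar>\<eta> x\<bar> \<le> integral {0..R} (\<lambda>t. M * norm (F (x + t *\<^sub>R z)))" by simp
  moreover have "(\<integral>\<^sup>+t\<in>{0..R}. ennreal (M * norm (F (x + t *\<^sub>R z))) \<partial>lborel)
      = ennreal (integral {0..R} (\<lambda>t. M * norm (F (x + t *\<^sub>R z))))"
    by (rule nn_integral_has_integral_lebesgue'[OF _ J]) (use M0 in auto)
  ultimately show ?thesis by (simp add: ennreal_leI)
qed

text \<open>The substitution y = x + t z has Jacobian t^n, whence the factor t^(-n).\<close>

lemma nn_integral_ball_affine_le:
  fixes f :: "real ^ 'n \<Rightarrow> real"
  assumes f[measurable]: "f \<in> borel_measurable borel" and t: "0 < t" and sub: "\<And>z. z \<in> A \<Longrightarrow> x + t *\<^sub>R z \<in> B"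
    and B[measurable]: "B \<in> sets borel"
  shows "(\<integral>\<^sup>+z\<in>A. ennreal (f (x + t *\<^sub>R z)) \<partial>lborel)
    \<le> ennreal ((1 / t) ^ CARD('n)) * (\<integral>\<^sup>+y\<in>B. ennreal (f y) \<partial>lborel)"
proof -
  have "(\<integral>\<^sup>+y\<in>B. ennreal (f y) \<partial>lborel) =
     (\<integral>\<^sup>+y\<in>B. ennreal (f y) \<partial>(density (distr lborel borel (\<lambda>z. x + t *\<^sub>R z)) (\<lambda>_. \<bar>t\<bar> ^ DIM(real ^ 'n))))"
    using lborel_affine[of t x] t by simp
  also have "\<dots> = (\<integral>\<^sup>+z. ennreal (t ^ CARD('n)) * (ennreal (f (x + t *\<^sub>R z)) * indicator B (x + t *\<^sub>R z)) \<partial>lborel)"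
    using t by (subst nn_integral_density) (auto simp: nn_integral_distr ennreal_power)
  also have "\<dots> = ennreal (t ^ CARD('n)) * (\<integral>\<^sup>+z. ennreal (f (x + t *\<^sub>R z)) * indicator B (x + t *\<^sub>R z) \<partial>lborel)"
    by (rule nn_integral_cmult) measurable
  finally have "ennreal ((1 / t) ^ CARD('n)) * (\<integral>\<^sup>+y\<in>B. ennreal (f y) \<partial>lborel)
     = ennreal ((1 / t) ^ CARD('n)) * ennreal (t ^ CARD('n)) *
        (\<integral>\<^sup>+z. ennreal (f (x + t *\<^sub>R z)) * indicator B (x + t *\<^sub>R z) \<partial>lborel)"
    by (simp add: mult.assoc)
  also have "ennreal ((1 / t) ^ CARD('n)) * ennreal (t ^ CARD('n)) = 1"
    using t by (simp add: ennreal_mult''[symmetric] power_divide)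
  finally have "ennreal ((1 / t) ^ CARD('n)) * (\<integral>\<^sup>+y\<in>B. ennreal (f y) \<partial>lborel)
     = (\<integral>\<^sup>+z. ennreal (f (x + t *\<^sub>R z)) * indicator B (x + t *\<^sub>R z) \<partial>lborel)" by simp
  then show ?thesis
    using sub by (auto intro!: nn_integral_mono simp: indicator_def)
qed

lemma ennreal_le_suminf: "f k \<le> (\<Sum>k. f k :: ennreal)"
  using sum_le_suminf[of f "{k}"] by simp

lemma dyadic_scale:
  fixes t R :: real
  assumes "0 < t" "t \<le> R"
  shows "\<exists>k. R / 2 ^ k / 2 < t \<and> t \<le> R / 2 ^ k"
proof -
  have "0 < t / R" using assms by simp
  then obtain j where "(1 / 2) ^ j < t / R"
    using real_arch_pow_inv[of "t / R" "1 / 2"] by auto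
  then have "R / 2 ^ j < t" using assms by (simp add: power_divide field_simps)
  moreover have "y / 2 < y" if "0 < y" for y :: real using that by simp
  then have "R / 2 ^ j / 2 < R / 2 ^ j" using assms by (meson divide_pos_pos less_le_trans zero_less_numeral zero_less_power)
  ultimately have ex: "\<exists>k. R / 2 ^ k / 2 < t" by (meson order.strict_trans)
  define k where "k = (LEAST k. R / 2 ^ k / 2 < t)"
  have k: "R / 2 ^ k / 2 < t" unfolding k_def by (rule LeastI_ex[OF ex])
  have "t \<le> R / 2 ^ k"
  proof (cases k)
    case 0
    then show ?thesis using assms by simp
  next
    case (Suc i)
    then have "\<not> R / 2 ^ i / 2 < t"
      using not_less_Least[of i "\<lambda>k. R / 2 ^ k / 2 < t"] unfolding k_def by simp
    then show ?thesis using Suc by (simp add: not_less field_simps)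
  qed
  with k show ?thesis by blast
qed

text \<open>The lines run in the directions \<open>z\<close> of a ball that stays away from the origin;
  averaging over this ball makes the sets \<open>x + t z\<close> comparable to balls of radius \<open>t\<close>.\<close>

lemma abs_le_grid_averages:
  fixes \<eta> :: "real ^ 'n \<Rightarrow> real"
  assumes der: "\<And>y. (\<eta> has_derivative (\<lambda>v. F y \<bullet> v)) (at y)" and cont: "continuous_on UNIV F"
    and R: "0 < R" and zero: "\<And>z. 1 \<le> norm z \<Longrightarrow> \<eta> (x + R *\<^sub>R z) = 0"
  shows "ennreal \<bar>\<eta> x\<bar> \<le> (\<Sum>k. ennreal (3 * R * (2 * (3 + real CARD('n))) ^ CARD('n) * (1 / 2) ^ Suc k *
     grid_average (\<lambda>y. norm (F y)) (R / 2 ^ k) (grid_index (R / 2 ^ k) x)))"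
proof -
  let ?n = "CARD('n)"
  define f where "f = (\<lambda>y. norm (F y))"
  have cf: "continuous_on UNIV f" unfolding f_def by (intro continuous_intros cont)
  have [measurable]: "f \<in> borel_measurable borel" using cf by (rule borel_measurable_continuous_onI)
  have f0: "0 \<le> f y" for y by (simp add: f_def)
  \<comment> \<open>With a centre of norm 2 all directions satisfy 1 <= norm z <= 3. The lower end
    makes \<eta> vanish at x + R z; the upper end gives the factor 3 and the reach of the grid
    balls.\<close>
  define e :: "real ^ 'n" where "e = 2 *\<^sub>R axis undefined 1"
  have e: "norm e = 2" by (simp add: e_def)
  have [measurable]: "ball e 1 \<in> sets borel" by simp
  have normz: "1 \<le> norm z" "norm z \<le> 3" if "z \<in> ball e 1" for z
    using that norm_triangle_ineq2[of e "e - z"] norm_triangle_ineq2[of z e] e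
    by (auto simp: dist_norm norm_minus_commute)
  define v where "v = unit_ball_vol (real ?n)"
  have v: "0 < v" by (simp add: v_def)
  define h where "h k = R / 2 ^ k" for k :: nat
  have h: "0 < h k" for k using R by (simp add: h_def)
  let ?B = "\<lambda>k. grid_ball (h k) (grid_index (h k) x)"
  let ?I = "\<lambda>k. \<integral>\<^sup>+y\<in>?B k. ennreal (f y) \<partial>lborel"
  let ?\<Psi> = "\<lambda>t. \<integral>\<^sup>+z\<in>ball e 1. ennreal (3 * f (x + t *\<^sub>R z)) \<partial>lborel"
  have "ennreal v * ennreal \<bar>\<eta> x\<bar> = (\<integral>\<^sup>+z\<in>ball e 1. ennreal \<bar>\<eta> x\<bar> \<partial>lborel)"
    by (subst nn_integral_cmult_indicator) (auto simp: emeasure_ball v_def mult.commute)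
  also have "\<dots> \<le> (\<integral>\<^sup>+z. (\<integral>\<^sup>+t. ennreal (3 * f (x + t *\<^sub>R z)) * indicator (ball e 1) z * indicator {0..R} t \<partial>lborel) \<partial>lborel)"
  proof (rule nn_integral_mono)
    fix z
    show "ennreal \<bar>\<eta> x\<bar> * indicator (ball e 1) z
       \<le> (\<integral>\<^sup>+t. ennreal (3 * f (x + t *\<^sub>R z)) * indicator (ball e 1) z * indicator {0..R} t \<partial>lborel)"
    proof (cases "z \<in> ball e 1")
      case True
      then show ?thesis
        using abs_le_line_integral[OF der cont R zero normz(2), of z] normz(1)[OF True] by (simp add: f_def)
    qed simp
  qed
  \<comment> \<open>With t outermost, the inner integral over directions becomes, up to t^(-n), an
    integral over a region of size t around x.\<close>
  also have "\<dots> = (\<integral>\<^sup>+t. (\<integral>\<^sup>+z. ennreal (3 * f (x + t *\<^sub>R z)) * indicator (ball e 1) z * indicator {0..R} t \<partial>lborel) \<partial>lborel)"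
  proof (rule lborel_pair.Fubini')
    have [measurable]: "(\<lambda>p. indicator (ball e 1) (snd p) :: ennreal) \<in> borel_measurable (lborel \<Otimes>\<^sub>M lborel)"
      by (rule measurable_compose[OF measurable_snd borel_measurable_indicator]) simp
    have [measurable]: "(\<lambda>p. indicator {0..R} (fst p) :: ennreal) \<in> borel_measurable (lborel \<Otimes>\<^sub>M lborel)"
      by (rule measurable_compose[OF measurable_fst borel_measurable_indicator]) simp
    show "(\<lambda>(t, z). ennreal (3 * f (x + t *\<^sub>R z)) * indicator (ball e 1) z * indicator {0..R} t)
        \<in> borel_measurable (lborel \<Otimes>\<^sub>M lborel)"
      by measurable
  qed
  also have "\<dots> = (\<integral>\<^sup>+t. ?\<Psi> t * indicator {0..R} t \<partial>lborel)"
    by (intro nn_integral_cong nn_integral_multc) measurable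
  \<comment> \<open>The intervals (h k / 2, h k] cover (0, R]. On each of them t^(-n) <= (2 / h
    k)^n, and x + t z stays in the grid ball of width h k.\<close>
  also have "\<dots> \<le> (\<integral>\<^sup>+t. (\<Sum>k. 3 * ennreal ((2 / h k) ^ ?n) * ?I k * indicator {h k / 2<..h k} t) \<partial>lborel)"
  proof (rule nn_integral_mono_AE)
    \<comment> \<open>The value t = 0 lies in none of the dyadic intervals and is discarded as a
      null set.\<close>
    show "AE t in lborel. ?\<Psi> t * indicator {0..R} t
        \<le> (\<Sum>k. 3 * ennreal ((2 / h k) ^ ?n) * ?I k * indicator {h k / 2<..h k} t)"
      using AE_lborel_singleton[of 0]
    proof eventually_elim
      case (elim t)
      show ?case
      proof (cases "t \<in> {0..R}")
        case True
        then have t: "0 < t" "t \<le> R" using elim by auto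
        then obtain k where k: "h k / 2 < t" "t \<le> h k"
          using dyadic_scale[of t R] unfolding h_def by blast
        have "?\<Psi> t = (\<integral>\<^sup>+z. 3 * (ennreal (f (x + t *\<^sub>R z)) * indicator (ball e 1) z) \<partial>lborel)"
          by (intro nn_integral_cong) (auto simp: ennreal_mult f0 indicator_def)
        also have "\<dots> = 3 * (\<integral>\<^sup>+z\<in>ball e 1. ennreal (f (x + t *\<^sub>R z)) \<partial>lborel)"
          by (rule nn_integral_cmult) measurable
        also have "\<dots> \<le> 3 * (ennreal ((1 / t) ^ ?n) * ?I k)"
        proof (intro mult_left_mono nn_integral_ball_affine_le)
          fix z assume z: "z \<in> ball e 1"
          have "norm z < 3"
            using z norm_triangle_ineq2[of z e] e by (auto simp: dist_norm norm_minus_commute)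
          then have "t * norm z < h k * 3"
            using t k by (intro mult_le_less_imp_less) (auto simp: normz)
          then have "x + t *\<^sub>R z \<in> ball x (3 * h k)"
            using t by (simp add: dist_norm mult.commute)
          then show "x + t *\<^sub>R z \<in> ?B k"
            using grid_ball_superset[OF h[of k], of x "grid_index (h k) x"] by auto
        qed (use t in \<open>auto simp: grid_ball_def\<close>)
        also have "\<dots> \<le> 3 * (ennreal ((2 / h k) ^ ?n) * ?I k)"
          using k h[of k] t by (intro mult_left_mono mult_right_mono ennreal_leI power_mono) (auto simp: field_simps)
        also have "\<dots> = 3 * ennreal ((2 / h k) ^ ?n) * ?I k * indicator {h k / 2<..h k} t"
          using k by (simp add: mult_ac)
        also have "\<dots> \<le> (\<Sum>k. 3 * ennreal ((2 / h k) ^ ?n) * ?I k * indicator {h k / 2<..h k} t)"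
          by (rule ennreal_le_suminf[of "\<lambda>k. 3 * ennreal ((2 / h k) ^ ?n) * ?I k * indicator {h k / 2<..h k} t"])
        finally show ?thesis using True by simp
      qed simp
    qed
  qed
  also have "\<dots> = (\<Sum>k. \<integral>\<^sup>+t. 3 * ennreal ((2 / h k) ^ ?n) * ?I k * indicator {h k / 2<..h k} t \<partial>lborel)"
    by (rule nn_integral_suminf) measurable
  also have "\<dots> = (\<Sum>k. ennreal v * ennreal (3 * R * (2 * (3 + real ?n)) ^ ?n * (1 / 2) ^ Suc k *
     grid_average f (h k) (grid_index (h k) x)))"
  proof (intro suminf_cong)
    fix k
    let ?g = "grid_average f (h k) (grid_index (h k) x)"
    have "?I k = (\<integral>\<^sup>+y\<in>?B k. ennreal (f y) \<partial>lebesgue)"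
      by (rule nn_integral_completion[symmetric])
    also have "\<dots> = ennreal ?g * emeasure lebesgue (?B k)"
      by (rule grid_average_eq[OF cf h, symmetric])
    also have "emeasure lebesgue (?B k) = ennreal (v * ((3 + real ?n) * h k) ^ ?n)"
      using h[of k] by (simp add: grid_ball_def emeasure_ball v_def)
    finally have I: "?I k = ennreal (?g * (v * ((3 + real ?n) * h k) ^ ?n))"
      using grid_average_nonneg v h[of k] by (subst ennreal_mult) (auto intro!: mult_nonneg_nonneg)
    have "(\<integral>\<^sup>+t. 3 * ennreal ((2 / h k) ^ ?n) * ?I k * indicator {h k / 2<..h k} t \<partial>lborel)
      = 3 * ennreal ((2 / h k) ^ ?n) * ?I k * ennreal (h k / 2)"
      using h[of k] by (subst nn_integral_cmult_indicator) auto
    also have "\<dots> = ennreal (3 * (2 / h k) ^ ?n * (?g * (v * ((3 + real ?n) * h k) ^ ?n)) * (h k / 2))"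
    proof -
      have E: "3 * ennreal P * ennreal Q * ennreal H = ennreal (3 * P * Q * H)"
        if "0 \<le> P" "0 \<le> Q" "0 \<le> H" for P Q H
        using that by (simp add: ennreal_mult)
      show ?thesis unfolding I
        by (rule E) (use grid_average_nonneg v h[of k] in \<open>auto intro!: mult_nonneg_nonneg\<close>)
    qed
    \<comment> \<open>The volume v ((3 + n) h)^n cancels the power of h in (2 / h)^n; what is left
      is the interval length h / 2 = R (1/2)^(k + 1), the source of the summable weights.\<close>
    also have "3 * (2 / h k) ^ ?n * (?g * (v * ((3 + real ?n) * h k) ^ ?n)) * (h k / 2)
        = v * (3 * R * (2 * (3 + real ?n)) ^ ?n * (1 / 2) ^ Suc k * ?g)"
    proof -
      have alg: "3 * P * (g * (v * Q)) * H = v * (3 * H * (P * Q) * g)" for P Q g H :: real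
        by (simp add: algebra_simps)
      have alg': "v * (3 * (R * P) * Q * g) = v * (3 * R * Q * P * g)" for P Q g :: real
        by (simp add: algebra_simps)
      have "3 * (2 / h k) ^ ?n * (?g * (v * ((3 + real ?n) * h k) ^ ?n)) * (h k / 2)
          = v * (3 * (h k / 2) * ((2 / h k) ^ ?n * ((3 + real ?n) * h k) ^ ?n) * ?g)"
        by (rule alg)
      also have "(2 / h k) ^ ?n * ((3 + real ?n) * h k) ^ ?n = (2 / h k * ((3 + real ?n) * h k)) ^ ?n"
        by (simp only: power_mult_distrib)
      also have "2 / h k * ((3 + real ?n) * h k) = 2 * (3 + real ?n)" using h[of k] by simp
      finally have "3 * (2 / h k) ^ ?n * (?g * (v * ((3 + real ?n) * h k) ^ ?n)) * (h k / 2)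
          = v * (3 * (h k / 2) * (2 * (3 + real ?n)) ^ ?n * ?g)" .
      moreover have "h k / 2 = R * (1 / 2) ^ Suc k" by (simp add: h_def power_divide)
      ultimately show ?thesis by (simp only: alg')
    qed
    also have "ennreal \<dots> = ennreal v * ennreal (3 * R * (2 * (3 + real ?n)) ^ ?n * (1 / 2) ^ Suc k * ?g)"
      using v by (intro ennreal_mult') auto
    finally show "(\<integral>\<^sup>+t. 3 * ennreal ((2 / h k) ^ ?n) * ?I k * indicator {h k / 2<..h k} t \<partial>lborel) =
       ennreal v * ennreal (3 * R * (2 * (3 + real ?n)) ^ ?n * (1 / 2) ^ Suc k * ?g)" .
  qed
  also have "\<dots> = ennreal v * (\<Sum>k. ennreal (3 * R * (2 * (3 + real ?n)) ^ ?n * (1 / 2) ^ Suc k *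
     grid_average f (h k) (grid_index (h k) x)))"
    by (rule ennreal_suminf_cmult)
  finally have "ennreal (1 / v) * (ennreal v * ennreal \<bar>\<eta> x\<bar>) \<le> ennreal (1 / v) * (ennreal v *
     (\<Sum>k. ennreal (3 * R * (2 * (3 + real ?n)) ^ ?n * (1 / 2) ^ Suc k * grid_average f (h k) (grid_index (h k) x))))"
    by (rule mult_left_mono) simp
  moreover have "ennreal (1 / v) * (ennreal v * X) = X" for X
    using v by (simp add: mult.assoc[symmetric] ennreal_mult''[symmetric])
  ultimately show ?thesis by (simp add: f_def h_def)
qed

section \<open>The modular inequality for smooth functions\<close>

context weighted_orlicz
begin

lemma aInc_1: "aInc \<Omega> 1 \<phi>"
  using Phi_w by (simp add: Phi_w_def)

lemma aInc_1_scale: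
  obtains L where "1 \<le> L" "\<And>x s t. x \<in> \<Omega> \<Longrightarrow> 0 < s \<Longrightarrow> s \<le> t \<Longrightarrow> ennreal (t / s) * \<phi> x s \<le> ennreal L * \<phi> x t"
proof -
  obtain L where "1 \<le> L" "\<And>x s t. x \<in> \<Omega> \<Longrightarrow> 0 < s \<Longrightarrow> s \<le> t \<Longrightarrow>
     ennreal ((t / s) powr 1) * \<phi> x s \<le> ennreal L * \<phi> x t"
    using aInc_scale[OF aInc_1] by blast
  with that[of L] show ?thesis by simp
qed

text \<open>In place of convexity: dividing the argument by k gains a factor L / k, which turns a
  bound of a modular by some constant into a bound by 1.\<close>

lemma aInc_1_divide:
  obtains L where "1 \<le> L" "\<And>x t k. x \<in> \<Omega> \<Longrightarrow> 0 \<le> t \<Longrightarrow> 1 \<le> k \<Longrightarrow> \<phi> x (t / k) \<le> ennreal (L / k) * \<phi> x t"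
proof -
  obtain L where L: "1 \<le> L" "\<And>x s t. x \<in> \<Omega> \<Longrightarrow> 0 < s \<Longrightarrow> s \<le> t \<Longrightarrow> ennreal (t / s) * \<phi> x s \<le> ennreal L * \<phi> x t"
    using aInc_1_scale by blast
  have "\<phi> x (t / k) \<le> ennreal (L / k) * \<phi> x t" if "x \<in> \<Omega>" "0 \<le> t" "1 \<le> k" for x t k
  proof (cases "t = 0")
    case True
    then show ?thesis using \<phi>_0 that by simp
  next
    case False
    then have "0 < t / k" "t / k \<le> t" using that by (auto simp: divide_le_eq)
    then have "ennreal (t / (t / k)) * \<phi> x (t / k) \<le> ennreal L * \<phi> x t"
      by (rule L(2)[OF that(1)])
    then have "ennreal k * \<phi> x (t / k) \<le> ennreal L * \<phi> x t" using False that by simp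
    then have "ennreal (1 / k) * (ennreal k * \<phi> x (t / k)) \<le> ennreal (1 / k) * (ennreal L * \<phi> x t)"
      by (rule mult_left_mono) simp
    then show ?thesis using that L(1)
      by (simp add: mult.assoc[symmetric] ennreal_mult''[symmetric])
  qed
  with L(1) that show ?thesis by blast
qed

lemma modular_le_divide:
  assumes "f \<in> borel_measurable lebesgue" "\<And>x. 0 \<le> f x" "1 \<le> k" "0 \<le> L"
    and L: "\<And>x t k. x \<in> \<Omega> \<Longrightarrow> 0 \<le> t \<Longrightarrow> 1 \<le> k \<Longrightarrow> \<phi> x (t / k) \<le> ennreal (L / k) * \<phi> x t"
  shows "(\<integral>\<^sup>+x\<in>\<Omega>. \<phi> x (f x / k) * ennreal (\<omega> x) \<partial>lebesgue)
    \<le> ennreal (L / k) * (\<integral>\<^sup>+x\<in>\<Omega>. \<phi> x (f x) * ennreal (\<omega> x) \<partial>lebesgue)"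
proof -
  have m: "(\<lambda>x. \<phi> x (f x) * indicator \<Omega> x) \<in> borel_measurable lebesgue"
    by (rule Phi_prefunction_measurable[OF Phi _ sets_\<Omega>]) (auto intro: measurable_restrict_space1 assms)
  have "(\<integral>\<^sup>+x\<in>\<Omega>. \<phi> x (f x / k) * ennreal (\<omega> x) \<partial>lebesgue)
      \<le> (\<integral>\<^sup>+x. ennreal (L / k) * ((\<phi> x (f x) * indicator \<Omega> x) * ennreal (\<omega> x)) \<partial>lebesgue)"
  proof (rule nn_integral_mono)
    fix x
    show "\<phi> x (f x / k) * ennreal (\<omega> x) * indicator \<Omega> x
      \<le> ennreal (L / k) * ((\<phi> x (f x) * indicator \<Omega> x) * ennreal (\<omega> x))"
      using mult_right_mono[OF L[of x "f x" k], of "ennreal (\<omega> x)"] assms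
      by (auto simp: indicator_def mult_ac)
  qed
  also have "\<dots> = ennreal (L / k) * (\<integral>\<^sup>+x. (\<phi> x (f x) * indicator \<Omega> x) * ennreal (\<omega> x) \<partial>lebesgue)"
    by (rule nn_integral_cmult) (use m in measurable)
  finally show ?thesis by (simp add: mult_ac)
qed

text \<open>Stated for each level l, since the infimum in \<open>lux_norm\<close> is not known to be
  attained. The function norm F / l has modular at most 1, as the grid estimate requires.\<close>

lemma smooth_Poincare_modular:
  "\<exists>C>0. \<forall>\<eta> F l. (\<forall>y. (\<eta> has_derivative (\<lambda>v. F y \<bullet> v)) (at y)) \<longrightarrow> continuous_on UNIV F \<longrightarrow>
     (\<forall>x. x \<notin> \<Omega> \<longrightarrow> \<eta> x = 0 \<and> F x = 0) \<longrightarrow> 0 < l \<longrightarrow>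
     (\<integral>\<^sup>+x\<in>\<Omega>. \<phi> x (norm (F x) / l) * ennreal (\<omega> x) \<partial>lebesgue) \<le> 1 \<longrightarrow>
     (\<integral>\<^sup>+x\<in>\<Omega>. \<phi> x (\<bar>\<eta> x\<bar> / (C * l)) * ennreal (\<omega> x) \<partial>lebesgue) \<le> 1"
proof -
  obtain L where L: "1 \<le> L" and scale: "\<And>x s t. x \<in> \<Omega> \<Longrightarrow> 0 < s \<Longrightarrow> s \<le> t \<Longrightarrow>
      ennreal (t / s) * \<phi> x s \<le> ennreal L * \<phi> x t"
    using aInc_1_scale by blast
  obtain L' where L': "1 \<le> L'" and div: "\<And>x t k. x \<in> \<Omega> \<Longrightarrow> 0 \<le> t \<Longrightarrow> 1 \<le> k \<Longrightarrow>
      \<phi> x (t / k) \<le> ennreal (L' / k) * \<phi> x t"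
    using aInc_1_divide by blast
  obtain \<kappa> A where \<kappa>: "0 < \<kappa>" and A: "0 < A" and grid:
    "\<And>f h G. f \<in> borel_measurable lebesgue \<Longrightarrow> (\<forall>x. 0 \<le> f x) \<Longrightarrow> (\<forall>x. x \<notin> \<Omega> \<longrightarrow> f x = 0) \<Longrightarrow>
     (\<integral>\<^sup>+x\<in>\<Omega>. \<phi> x (f x) * ennreal (\<omega> x) \<partial>lebesgue) \<le> 1 \<Longrightarrow> 0 < h \<Longrightarrow>
     (\<forall>m. 0 \<le> G m \<and> ennreal (G m) * emeasure lebesgue (grid_ball h m)
        \<le> (\<integral>\<^sup>+x\<in>grid_ball h m. ennreal (f x) \<partial>lebesgue)) \<Longrightarrow>
     (\<integral>\<^sup>+x\<in>\<Omega>. \<phi> x (\<kappa> * G (grid_index h x)) * ennreal (\<omega> x) \<partial>lebesgue) \<le> ennreal A"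
    using modular_average_grid by blast
  obtain \<rho> where \<rho>: "0 < \<rho>" "\<Omega> \<subseteq> ball 0 \<rho>"
    using bounded_subset_ballD[OF bounded_\<Omega>] by blast
  \<comment> \<open>From x in \<Omega> a step of length at least 2 \<rho> leaves the ball of radius
    \<rho> and hence \<Omega>.\<close>
  define R where "R = 2 * \<rho>"
  have R: "0 < R" using \<rho> by (simp add: R_def)
  define C0 where "C0 = 3 * R * (2 * (3 + real CARD('n))) ^ CARD('n)"
  have C0: "0 < C0" using R by (simp add: C0_def add_pos_nonneg)
  \<comment> \<open>The modular of s below is at most L A; division of s by D brings it down to 1. C
    is then chosen so that s / D = |\<eta>| / (C l).\<close>
  define D where "D = max 1 (L' * L * A)"
  have D: "1 \<le> D" "L' * L * A \<le> D" by (auto simp: D_def)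
  define C where "C = 2 * C0 * D / \<kappa>"
  have C: "0 < C" using C0 D \<kappa> by (simp add: C_def)
  have "(\<integral>\<^sup>+x\<in>\<Omega>. \<phi> x (\<bar>\<eta> x\<bar> / (C * l)) * ennreal (\<omega> x) \<partial>lebesgue) \<le> 1"
    if der: "\<And>y. (\<eta> has_derivative (\<lambda>v. F y \<bullet> v)) (at y)" and cont: "continuous_on UNIV F"
      and out: "\<And>x. x \<notin> \<Omega> \<Longrightarrow> \<eta> x = 0" "\<And>x. x \<notin> \<Omega> \<Longrightarrow> F x = 0" and l: "0 < l"
      and mod: "(\<integral>\<^sup>+x\<in>\<Omega>. \<phi> x (norm (F x) / l) * ennreal (\<omega> x) \<partial>lebesgue) \<le> 1" for \<eta> F l
  proof -
    define f where "f = (\<lambda>x. norm (F x /\<^sub>R l))"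
    have f: "f x = norm (F x) / l" for x using l by (simp add: f_def divide_inverse mult.commute)
    have cf: "continuous_on UNIV f" unfolding f_def by (intro continuous_intros cont)
    have "f \<in> borel_measurable borel" using cf by (rule borel_measurable_continuous_onI)
    then have fm: "f \<in> borel_measurable lebesgue" by (intro measurable_completion) simp
    have "continuous_on UNIV \<eta>"
      by (intro continuous_at_imp_continuous_on ballI has_derivative_continuous[OF der])
    then have "\<eta> \<in> borel_measurable borel" by (rule borel_measurable_continuous_onI)
    then have \<eta>m[measurable]: "\<eta> \<in> borel_measurable lebesgue" by (intro measurable_completion) simp
    define h where "h k = R / 2 ^ k" for k :: nat
    have h: "0 < h k" for k using R by (simp add: h_def)
    define w where "w k = (1 / 2 :: real) ^ Suc k" for k
    have w0: "0 \<le> w k" for k by (simp add: w_def)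
    have w1: "(\<Sum>k. ennreal (w k)) = 1"
    proof -
      have "(\<Sum>k. ennreal (w k)) = ennreal 1"
        unfolding w_def using power_half_series by (intro suminf_ennreal_eq) auto
      then show ?thesis by simp
    qed
    define g where "g k x = grid_average f (h k) (grid_index (h k) x)" for k x
    \<comment> \<open>The 2 in the denominator is the one demanded by
      \<open>aInc1_countable_average\<close>; \<kappa> / C0 matches the arguments \<kappa> g of the
      grid estimate.\<close>
    define s where "s x = \<kappa> / (2 * C0) * (\<bar>\<eta> x\<bar> / l)" for x
    have s0: "0 \<le> s x" for x using \<kappa> C0 l by (simp add: s_def)
    have g0: "0 \<le> g k x" for k x by (simp add: g_def grid_average_nonneg)
    have pt: "\<phi> x (s x) \<le> ennreal L * (\<Sum>k. ennreal (w k) * \<phi> x (\<kappa> * g k x))" if x: "x \<in> \<Omega>" for x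
    proof (cases "s x = 0")
      case True
      then show ?thesis using \<phi>_0[OF x] by simp
    next
      case False
      show ?thesis
      proof (rule aInc1_countable_average[OF scale[OF x] w0 w1])
        show "0 \<le> \<kappa> * g k x" for k using \<kappa> g0 by simp
        show "0 < s x" using False s0[of x] by simp
        have "ennreal \<bar>\<eta> x / l\<bar> \<le> (\<Sum>k. ennreal (C0 * (1 / 2) ^ Suc k * grid_average f (R / 2 ^ k) (grid_index (R / 2 ^ k) x)))"
          unfolding f_def C0_def
        proof (rule abs_le_grid_averages[OF _ _ R])
          show "((\<lambda>y. \<eta> y / l) has_derivative (\<lambda>v. (F y /\<^sub>R l) \<bullet> v)) (at y)" for y
            by (auto intro!: derivative_eq_intros der simp: divide_inverse mult.commute)
          show "continuous_on UNIV (\<lambda>x. F x /\<^sub>R l)" by (intro continuous_intros cont)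
          show "\<eta> (x + R *\<^sub>R z) / l = 0" if "1 \<le> norm z" for z
          proof -
            have "R * 1 \<le> R * norm z" using that R by (intro mult_left_mono) auto
            moreover have "norm x < \<rho>" using x \<rho> by auto
            moreover have "norm (R *\<^sub>R z) \<le> norm (x + R *\<^sub>R z) + norm x"
              using norm_triangle_ineq4[of "x + R *\<^sub>R z" x] by simp
            moreover have "norm (R *\<^sub>R z) = R * norm z" using R by simp
            ultimately have "\<rho> < norm (x + R *\<^sub>R z)" using R_def by linarith
            then have "x + R *\<^sub>R z \<notin> \<Omega>" using \<rho> by auto
            then show ?thesis using out by simp
          qed
        qed
        then have "ennreal (\<kappa> / C0) * ennreal \<bar>\<eta> x / l\<bar> \<le> ennreal (\<kappa> / C0) * (\<Sum>k. ennreal (C0 * w k * g k x))"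
          unfolding w_def g_def h_def by (rule mult_left_mono) simp
        also have "\<dots> = (\<Sum>k. ennreal (\<kappa> / C0) * ennreal (C0 * w k * g k x))"
          by (rule ennreal_suminf_cmult[symmetric])
        also have "\<dots> = (\<Sum>k. ennreal (w k * (\<kappa> * g k x)))"
          using \<kappa> C0 w0 g0 by (intro suminf_cong) (simp add: ennreal_mult''[symmetric] mult_ac)
        also have "ennreal (\<kappa> / C0) * ennreal \<bar>\<eta> x / l\<bar> = ennreal (2 * s x)"
          using \<kappa> C0 l by (simp add: s_def ennreal_mult''[symmetric])
        finally show "ennreal (2 * s x) \<le> (\<Sum>k. ennreal (w k * (\<kappa> * g k x)))" .
      qed
    qed
    have gm[measurable]: "g k \<in> borel_measurable lebesgue" for k
    proof -
      have "(\<lambda>x. grid_index (h k) x) \<in> lebesgue \<rightarrow>\<^sub>M count_space UNIV"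
      proof (rule measurable_count_space_eq_countable[THEN iffD2])
        show "grid_index (h k) \<in> space lebesgue \<rightarrow> UNIV \<and>
          (\<forall>a\<in>UNIV. grid_index (h k) -` {a} \<inter> space lebesgue \<in> sets lebesgue)"
          using grid_index_measurable[of "h k"] by (auto simp: vimage_def)
      qed auto
      then show ?thesis unfolding g_def by (rule measurable_compose) simp
    qed
    have um[measurable]: "(\<lambda>x. \<phi> x (\<kappa> * g k x) * indicator \<Omega> x) \<in> borel_measurable lebesgue" for k
      by (rule Phi_prefunction_measurable[OF Phi _ sets_\<Omega>])
        (auto intro!: measurable_restrict_space1 mult_nonneg_nonneg g0 less_imp_le[OF \<kappa>])
    have int: "(\<integral>\<^sup>+x\<in>\<Omega>. \<phi> x (s x) * ennreal (\<omega> x) \<partial>lebesgue) \<le> ennreal (L * A)"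
    proof -
      have "(\<integral>\<^sup>+x\<in>\<Omega>. \<phi> x (s x) * ennreal (\<omega> x) \<partial>lebesgue) \<le>
        (\<integral>\<^sup>+x. (\<Sum>k. ennreal L * (ennreal (w k) * ((\<phi> x (\<kappa> * g k x) * indicator \<Omega> x) * ennreal (\<omega> x)))) \<partial>lebesgue)"
      proof (rule nn_integral_mono)
        fix x
        show "\<phi> x (s x) * ennreal (\<omega> x) * indicator \<Omega> x \<le>
           (\<Sum>k. ennreal L * (ennreal (w k) * ((\<phi> x (\<kappa> * g k x) * indicator \<Omega> x) * ennreal (\<omega> x))))"
        proof (cases "x \<in> \<Omega>")
          case True
          have "\<phi> x (s x) * ennreal (\<omega> x) \<le> ennreal L * (\<Sum>k. ennreal (w k) * \<phi> x (\<kappa> * g k x)) * ennreal (\<omega> x)"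
            by (rule mult_right_mono[OF pt[OF True]]) simp
          also have "\<dots> = (\<Sum>k. ennreal L * (ennreal (w k) * (\<phi> x (\<kappa> * g k x) * ennreal (\<omega> x))))"
            by (simp only: ennreal_suminf_cmult[symmetric] ennreal_suminf_multc[symmetric] mult.assoc)
          finally show ?thesis using True by simp
        qed simp
      qed
      also have "\<dots> = (\<Sum>k. \<integral>\<^sup>+x. ennreal L * (ennreal (w k) * ((\<phi> x (\<kappa> * g k x) * indicator \<Omega> x) * ennreal (\<omega> x))) \<partial>lebesgue)"
        by (rule nn_integral_suminf) measurable
      also have "\<dots> = (\<Sum>k. ennreal L * (ennreal (w k) * (\<integral>\<^sup>+x. (\<phi> x (\<kappa> * g k x) * indicator \<Omega> x) * ennreal (\<omega> x) \<partial>lebesgue)))"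
        by (subst nn_integral_cmult, measurable)+
      \<comment> \<open>The bound A is the same at every scale and the weights sum to 1, so the
        series over scales costs nothing.\<close>
      also have "\<dots> \<le> (\<Sum>k. ennreal L * (ennreal (w k) * ennreal A))"
      proof (intro suminf_le mult_left_mono)
        fix k
        have "(\<integral>\<^sup>+x\<in>\<Omega>. \<phi> x (\<kappa> * grid_average f (h k) (grid_index (h k) x)) * ennreal (\<omega> x) \<partial>lebesgue) \<le> ennreal A"
        proof (rule grid[OF fm _ _ _ h])
          show "(\<integral>\<^sup>+x\<in>\<Omega>. \<phi> x (f x) * ennreal (\<omega> x) \<partial>lebesgue) \<le> 1" using mod by (simp add: f)
          show "\<forall>m. 0 \<le> grid_average f (h k) m \<and> ennreal (grid_average f (h k) m) * emeasure lebesgue (grid_ball (h k) m)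
            \<le> (\<integral>\<^sup>+x\<in>grid_ball (h k) m. ennreal (f x) \<partial>lebesgue)"
            using grid_average_nonneg grid_average_eq[OF cf h] by auto
        qed (use out l in \<open>auto simp: f\<close>)
        then show "(\<integral>\<^sup>+x. (\<phi> x (\<kappa> * g k x) * indicator \<Omega> x) * ennreal (\<omega> x) \<partial>lebesgue) \<le> ennreal A"
          by (simp add: g_def mult_ac)
      qed auto
      also have "\<dots> = ennreal L * ((\<Sum>k. ennreal (w k)) * ennreal A)"
        by (simp only: ennreal_suminf_cmult ennreal_suminf_multc)
      also have "\<dots> = ennreal (L * A)" using L A by (simp add: w1 ennreal_mult)
      finally show ?thesis .
    qed
    have "(\<integral>\<^sup>+x\<in>\<Omega>. \<phi> x (s x / D) * ennreal (\<omega> x) \<partial>lebesgue)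
      \<le> ennreal (L' / D) * (\<integral>\<^sup>+x\<in>\<Omega>. \<phi> x (s x) * ennreal (\<omega> x) \<partial>lebesgue)"
    proof (rule modular_le_divide[OF _ s0 D(1) _ div])
      show "s \<in> borel_measurable lebesgue" unfolding s_def by measurable
    qed (use L' in auto)
    also have "\<dots> \<le> ennreal (L' / D) * ennreal (L * A)" by (rule mult_left_mono[OF int]) simp
    also have "\<dots> = ennreal (L' * L * A / D)" using L L' A D by (simp add: ennreal_mult''[symmetric])
    also have "\<dots> \<le> 1" using D by (simp add: divide_le_eq_1)
    finally have "(\<integral>\<^sup>+x\<in>\<Omega>. \<phi> x (s x / D) * ennreal (\<omega> x) \<partial>lebesgue) \<le> 1" .
    moreover have "s x / D = \<bar>\<eta> x\<bar> / (C * l)" for x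
      using \<kappa> C0 D by (simp add: s_def C_def mult_ac)
    ultimately show ?thesis by simp
  qed
  with C show ?thesis by blast
qed

end

section \<open>Smooth bumps on boxes\<close>

text \<open>With q = (t - a)(b - t), these functions P / q^m exp(-c / q), extended by zero, form a
  family closed under differentiation. This gives derivatives of all orders by one induction; c is
  kept free to tend to 0 later.\<close>

definition bump_term :: "real \<Rightarrow> real \<Rightarrow> real \<Rightarrow> real poly \<Rightarrow> nat \<Rightarrow> real \<Rightarrow> real" where
  "bump_term a b c P m t = (if a < t \<and> t < b
     then poly P t / ((t - a) * (b - t)) ^ m * exp (- c / ((t - a) * (b - t))) else 0)"

text \<open>The inequality (1 + y / N)^N <= exp y for y = c / q and N = m + 2: two powers more than
  the singularity leave the factor q^2.\<close>

lemma exp_inverse_power_bound: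
  fixes q c :: real
  assumes "0 < q" "0 < c"
  shows "1 / q ^ m * exp (- c / q) \<le> (real (m + 2) / c) ^ (m + 2) * q\<^sup>2"
proof -
  let ?N = "m + 2"
  have "((c / q) / real ?N) ^ ?N \<le> (1 + (c / q) / real ?N) ^ ?N"
    using assms by (intro power_mono) auto
  also have "\<dots> \<le> exp (c / q)"
    using assms by (intro exp_ge_one_plus_x_over_n_power_n) (auto intro: order_trans[of _ 0])
  finally have 1: "(c / (q * real ?N)) ^ ?N \<le> exp (c / q)" by (simp add: divide_divide_eq_left)
  have pos: "0 < (c / (q * real ?N)) ^ ?N" using assms by (intro zero_less_power divide_pos_pos mult_pos_pos) auto
  have "1 / q ^ m * exp (- c / q) = q\<^sup>2 * (1 / q ^ ?N) * (1 / exp (c / q))"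
    using assms by (simp add: exp_minus power_add inverse_eq_divide power2_eq_square)
  also have "\<dots> \<le> q\<^sup>2 * (1 / q ^ ?N) * (1 / (c / (q * real ?N)) ^ ?N)"
    using assms by (intro mult_left_mono divide_left_mono[OF 1] mult_pos_pos pos) auto
  also have "1 / (c / (q * real ?N)) ^ ?N = q ^ ?N * (real ?N / c) ^ ?N"
    using assms by (simp only: power_divide power_mult_distrib) (simp add: field_simps del: of_nat_add)
  also have "q\<^sup>2 * (1 / q ^ ?N) * (q ^ ?N * (real ?N / c) ^ ?N) = (real ?N / c) ^ ?N * q\<^sup>2"
    using assms by simp
  finally show ?thesis .
qed

text \<open>Quadratic vanishing gives derivative 0 at the end points, where the formula changes, as
  well as outside the interval.\<close>

lemma bump_term_quadratic_bound:
  assumes "a < b" "0 < c"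
  shows "\<exists>K. \<forall>t t0. t0 \<le> a \<or> b \<le> t0 \<longrightarrow> \<bar>bump_term a b c P m t\<bar> \<le> K * (t - t0)\<^sup>2"
proof -
  have "compact (poly P ` {a..b})"
    by (intro compact_continuous_image continuous_intros compact_Icc)
  then have "bounded (poly P ` {a..b})" by (rule compact_imp_bounded)
  then obtain M where "\<forall>y\<in>poly P ` {a..b}. norm y \<le> M" unfolding bounded_iff by (rule exE)
  then have M: "\<bar>poly P t\<bar> \<le> M" if "t \<in> {a..b}" for t using that by auto
  have M0: "0 \<le> M" using M[of a] assms by auto
  define D where "D = (real (m + 2) / c) ^ (m + 2)"
  have D0: "0 \<le> D" unfolding D_def using assms by (intro zero_le_power divide_nonneg_pos) auto
  have "\<bar>bump_term a b c P m t\<bar> \<le> M * D * (b - a)\<^sup>2 * (t - t0)\<^sup>2" if t0: "t0 \<le> a \<or> b \<le> t0" for t t0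
  proof (cases "a < t \<and> t < b")
    case True
    define q where "q = (t - a) * (b - t)"
    have q: "0 < q" using True by (simp add: q_def)
    \<comment> \<open>One factor of q is at most the length of the interval, the other at most the
      distance from t to t0.\<close>
    have "q \<le> (b - a) * \<bar>t - t0\<bar>"
    proof -
      consider "t0 \<le> a" | "b \<le> t0" using t0 by blast
      then show ?thesis
      proof cases
        case 1
        have "(t - a) * (b - t) \<le> \<bar>t - t0\<bar> * (b - a)" using True 1 by (intro mult_mono) auto
        then show ?thesis by (simp add: q_def mult.commute)
      next
        case 2
        have "(t - a) * (b - t) \<le> (b - a) * \<bar>t - t0\<bar>" using True 2 by (intro mult_mono) auto
        then show ?thesis by (simp add: q_def)
      qed
    qed
    then have "q\<^sup>2 \<le> ((b - a) * \<bar>t - t0\<bar>)\<^sup>2" using q by (intro power_mono) auto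
    then have q2: "q\<^sup>2 \<le> (b - a)\<^sup>2 * (t - t0)\<^sup>2" by (simp add: power_mult_distrib)
    have "\<bar>bump_term a b c P m t\<bar> = \<bar>poly P t\<bar> * (1 / q ^ m * exp (- c / q))"
      using True q by (simp add: bump_term_def q_def[symmetric] abs_mult)
    also have "\<dots> \<le> M * (D * q\<^sup>2)"
      using M[of t] True exp_inverse_power_bound[OF q assms(2), of m] M0 q
      unfolding D_def[symmetric] by (intro mult_mono[where c = "1 / q ^ m * exp (- c / q)"]) auto
    also have "\<dots> \<le> M * (D * ((b - a)\<^sup>2 * (t - t0)\<^sup>2))"
      using q2 M0 D0 by (intro mult_left_mono) auto
    finally show ?thesis by (simp add: mult_ac)
  qed (use M0 D0 in \<open>auto simp: bump_term_def\<close>)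
  then show ?thesis by blast
qed

lemma DERIV_zero_of_quadratic_bound:
  fixes g :: "real \<Rightarrow> real"
  assumes "\<And>t. \<bar>g t - g t0\<bar> \<le> K * (t - t0)\<^sup>2"
  shows "DERIV g t0 :> 0"
proof -
  have "((\<lambda>t. (g t - g t0) / (t - t0)) \<longlongrightarrow> 0) (at t0)"
  proof (rule Lim_null_comparison)
    show "\<forall>\<^sub>F t in at t0. norm ((g t - g t0) / (t - t0)) \<le> K * \<bar>t - t0\<bar>"
    proof (rule eventually_at_topological[THEN iffD2], intro exI[of _ UNIV] conjI ballI impI)
      fix t :: real assume "t \<noteq> t0"
      then have "\<bar>g t - g t0\<bar> / \<bar>t - t0\<bar> \<le> K * (t - t0)\<^sup>2 / \<bar>t - t0\<bar>"
        using assms[of t] by (intro divide_right_mono) auto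
      also have "\<dots> = K * \<bar>t - t0\<bar>"
      proof -
        have "K * d\<^sup>2 / \<bar>d\<bar> = K * \<bar>d\<bar>" for d :: real
          by (cases "0 < d") (auto simp: abs_if power2_eq_square)
        then show ?thesis .
      qed
      finally show "norm ((g t - g t0) / (t - t0)) \<le> K * \<bar>t - t0\<bar>" by simp
    qed auto
    have "((\<lambda>t. K * \<bar>t - t0\<bar>) \<longlongrightarrow> K * \<bar>t0 - t0\<bar>) (at t0)" by (intro tendsto_intros)
    then show "((\<lambda>t. K * \<bar>t - t0\<bar>) \<longlongrightarrow> 0) (at t0)" by simp
  qed
  then show ?thesis by (simp add: has_field_derivative_iff)
qed

lemma DERIV_bump_term:
  assumes "a < b" "0 < c"
  shows "\<exists>Q k. \<forall>t. DERIV (bump_term a b c P m) t :> bump_term a b c Q k t"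
proof -
  define q where "q = [:-a, 1:] * [:b, -1:]"
  have q: "poly q t = (t - a) * (b - t)" for t by (simp add: q_def algebra_simps)
  \<comment> \<open>The derivative of P q^(-m) exp(-c / q), brought over the common denominator q^(m
    + 2).\<close>
  define Q where "Q = pderiv P * q\<^sup>2 - smult (real m) (P * q * pderiv q) + smult c (P * pderiv q)"
  have "DERIV (bump_term a b c P m) t :> bump_term a b c Q (m + 2) t" for t
  proof (cases "a < t \<and> t < b")
    case True
    then have qp: "0 < poly q t" by (simp add: q)
    have "((\<lambda>t. poly P t / poly q t ^ m * exp (- c / poly q t)) has_real_derivative
        bump_term a b c Q (m + 2) t) (at t)"
    proof -
      have *: "((\<lambda>t. poly P t / poly q t ^ m * exp (- c / poly q t)) has_real_derivative
          (poly (pderiv P) t * poly q t ^ m - poly P t * (real m * poly q t ^ (m - Suc 0) * poly (pderiv q) t)) /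
             (poly q t ^ m * poly q t ^ m) * exp (- c / poly q t) +
          c * poly (pderiv q) t / (poly q t * poly q t) * exp (- c / poly q t) * (poly P t / poly q t ^ m)) (at t)"
        using qp by (auto intro!: derivative_eq_intros simp: field_simps)
      have "(poly (pderiv P) t * poly q t ^ m - poly P t * (real m * poly q t ^ (m - Suc 0) * poly (pderiv q) t)) /
             (poly q t ^ m * poly q t ^ m) * exp (- c / poly q t) +
          c * poly (pderiv q) t / (poly q t * poly q t) * exp (- c / poly q t) * (poly P t / poly q t ^ m)
        = bump_term a b c Q (m + 2) t"
      proof -
        define x where "x = poly q t"
        define p' where "p' = poly (pderiv P) t"
        define q' where "q' = poly (pderiv q) t"
        define y where "y = poly P t"
        define e where "e = exp (- c / x)"
        have x: "x \<noteq> 0" using qp by (simp add: x_def)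
        have "bump_term a b c Q (m + 2) t = (p' * x\<^sup>2 - m * (y * x * q') + c * (y * q')) / x ^ (m + 2) * e"
          using True by (simp add: bump_term_def Q_def q[symmetric] x_def p'_def q'_def y_def e_def)
        \<comment> \<open>For m = 0 the exponent m - Suc 0 is truncated to 0, which is harmless
          because of the factor m; hence the case distinction.\<close>
        moreover have "(p' * x ^ m - y * (real m * x ^ (m - Suc 0) * q')) / (x ^ m * x ^ m) * e +
          c * q' / (x * x) * e * (y / x ^ m) = (p' * x\<^sup>2 - m * (y * x * q') + c * (y * q')) / x ^ (m + 2) * e"
          using x by (cases m) (simp_all add: field_simps power2_eq_square)
        ultimately show ?thesis by (simp add: x_def p'_def q'_def y_def e_def)
      qed
      with * show ?thesis by simp
    qed
    then show ?thesis
    proof (rule has_field_derivative_transform_within_open)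
      show "open {a<..<b}" "t \<in> {a<..<b}" using True by auto
    qed (auto simp: bump_term_def q)
  next
    case False
    then have t: "t \<le> a \<or> b \<le> t" by auto
    obtain K where K: "\<And>s t0. t0 \<le> a \<or> b \<le> t0 \<Longrightarrow> \<bar>bump_term a b c P m s\<bar> \<le> K * (s - t0)\<^sup>2"
      using bump_term_quadratic_bound[OF assms] by blast
    have 0: "bump_term a b c R k t = 0" for R k using False by (auto simp: bump_term_def)
    show ?thesis unfolding 0
      by (rule DERIV_zero_of_quadratic_bound[where K = K]) (use K[OF t] in \<open>simp add: 0\<close>)
  qed
  then show ?thesis by blast
qed

text \<open>Each coordinate has its own P i and m i because a partial derivative changes only one
  factor; this makes the set closed under all partial derivatives.\<close>

definition bump_products :: "real ^ 'n \<Rightarrow> real ^ 'n \<Rightarrow> real \<Rightarrow> (real ^ 'n \<Rightarrow> real) set" where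
  "bump_products a b c = {\<lambda>x. \<Prod>i\<in>UNIV. bump_term (a $ i) (b $ i) c (P i) (m i) (x $ i) | P m. True}"

lemma bump_products_derivative:
  fixes a b :: "real ^ 'n"
  assumes ab: "\<And>i. a $ i < b $ i" and c: "0 < c" and f: "f \<in> bump_products a b c"
  shows "f differentiable (at x)" "partial_deriv j f \<in> bump_products a b c"
proof -
  obtain P m where f_eq: "f = (\<lambda>x. \<Prod>i\<in>UNIV. bump_term (a $ i) (b $ i) c (P i) (m i) (x $ i))"
    using f by (auto simp: bump_products_def)
  let ?g = "\<lambda>i. bump_term (a $ i) (b $ i) c (P i) (m i)"
  have "\<forall>i. \<exists>Q k. \<forall>t. DERIV (?g i) t :> bump_term (a $ i) (b $ i) c Q k t"
    using DERIV_bump_term[OF ab c] by blast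
  then obtain Q k where D: "\<And>i t. DERIV (?g i) t :> bump_term (a $ i) (b $ i) c (Q i) (k i) t"
    by metis
  let ?d = "\<lambda>i. bump_term (a $ i) (b $ i) c (Q i) (k i)"
  have H: "(f has_derivative (\<lambda>y. \<Sum>i\<in>UNIV. (?d i (x $ i) * y $ i) * (\<Prod>l\<in>UNIV - {i}. ?g l (x $ l)))) (at x)" for x
    unfolding f_eq
  proof (rule has_derivative_prod)
    fix i
    have "((\<lambda>x. ?g i (x $ i)) has_derivative (\<lambda>y. ?d i (x $ i) * (y $ i))) (at x)"
      by (rule has_derivative_compose[of "\<lambda>x. x $ i" "\<lambda>y. y $ i"])
        (use D[of i "x $ i"] in \<open>auto simp: has_field_derivative_def bounded_linear_vec_nth intro!: bounded_linear.has_derivative[OF bounded_linear_vec_nth has_derivative_ident, simplified]\<close>)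
    then show "((\<lambda>x. ?g i (x $ i)) has_derivative (\<lambda>y. ?d i (x $ i) * y $ i)) (at x)" .
  qed
  from H show "f differentiable (at x)" by (rule differentiableI)
  have "partial_deriv j f x = (\<Prod>i\<in>UNIV. bump_term (a $ i) (b $ i) c ((P(j := Q j)) i) ((m(j := k j)) i) (x $ i))" for x
  proof -
    have "partial_deriv j f x = (\<Sum>i\<in>UNIV. (?d i (x $ i) * axis j 1 $ i) * (\<Prod>l\<in>UNIV - {i}. ?g l (x $ l)))"
      unfolding partial_deriv_def frechet_derivative_at[OF H, symmetric] ..
    also have "\<dots> = ?d j (x $ j) * (\<Prod>l\<in>UNIV - {j}. ?g l (x $ l))"
    proof -
      have "(\<Sum>i\<in>UNIV. (?d i (x $ i) * axis j 1 $ i) * (\<Prod>l\<in>UNIV - {i}. ?g l (x $ l)))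
          = (\<Sum>i\<in>UNIV. if i = j then ?d j (x $ j) * (\<Prod>l\<in>UNIV - {j}. ?g l (x $ l)) else 0)"
        by (intro sum.cong) (auto simp: axis_def)
      then show ?thesis by simp
    qed
    also have "\<dots> = (\<Prod>i\<in>UNIV. bump_term (a $ i) (b $ i) c ((P(j := Q j)) i) ((m(j := k j)) i) (x $ i))"
      by (subst prod.remove[of UNIV j]) (auto intro!: prod.cong)
    finally show ?thesis .
  qed
  then have "partial_deriv j f =
      (\<lambda>x. \<Prod>i\<in>UNIV. bump_term (a $ i) (b $ i) c ((P(j := Q j)) i) ((m(j := k j)) i) (x $ i))" by (rule ext)
  then show "partial_deriv j f \<in> bump_products a b c"
    unfolding bump_products_def by blast
qed

lemma bump_products_C_diff:
  fixes a b :: "real ^ 'n"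
  assumes "\<And>i. a $ i < b $ i" "0 < c" "f \<in> bump_products a b c"
  shows "C_diff k f"
  using assms(3)
proof (induction k arbitrary: f)
  case 0
  have "continuous_on UNIV f"
    using bump_products_derivative(1)[OF assms(1,2) 0]
    by (intro continuous_at_imp_continuous_on ballI differentiable_imp_continuous_within)
  then show ?case by simp
next
  case (Suc k)
  then show ?case using bump_products_derivative[OF assms(1,2) Suc.prems] by simp
qed

text \<open>The member with P = 1 and m = 0 in every coordinate: it takes values in [0, 1] and tends
  to the indicator of the open box as c tends to 0.\<close>

definition box_bump :: "real ^ 'n \<Rightarrow> real ^ 'n \<Rightarrow> real \<Rightarrow> real ^ 'n \<Rightarrow> real" where
  "box_bump a b c x = (\<Prod>i\<in>UNIV. bump_term (a $ i) (b $ i) c 1 0 (x $ i))"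

lemma box_bump_nonzero: "box_bump a b c x \<noteq> 0 \<Longrightarrow> x \<in> box a b"
  by (auto simp: box_bump_def mem_box_cart bump_term_def split: if_splits)

lemma box_bump_bounds:
  assumes "0 < c"
  shows "0 \<le> box_bump a b c x" "box_bump a b c x \<le> 1"
  using assms unfolding box_bump_def
  by (auto intro!: prod_nonneg prod_le_1 simp: bump_term_def divide_le_0_iff)

lemma box_bump_test_function:
  fixes a b :: "real ^ 'n"
  assumes "\<And>i. a $ i < b $ i" "0 < c" "cbox a b \<subseteq> \<Omega>"
  shows "box_bump a b c \<in> test_functions \<Omega>"
proof -
  have "box_bump a b c \<in> bump_products a b c"
    unfolding bump_products_def box_bump_def[abs_def]
    by (rule CollectI, rule exI[of _ "\<lambda>_. 1"], rule exI[of _ "\<lambda>_. 0"]) simp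
  then have "\<forall>k. C_diff k (box_bump a b c)" using bump_products_C_diff[OF assms(1,2)] by blast
  moreover have sub: "closure {x. box_bump a b c x \<noteq> 0} \<subseteq> cbox a b"
    by (rule closure_minimal) (use box_bump_nonzero box_subset_cbox in blast)+
  moreover have "compact (closure {x. box_bump a b c x \<noteq> 0})"
    using sub compact_cbox closed_closure by (metis compact_Int_closed inf.absorb_iff2)
  ultimately show ?thesis using assms(3) by (auto simp: test_functions_def)
qed

lemma box_bump_tendsto:
  assumes "x \<in> box a b"
  shows "(\<lambda>n. box_bump a b (1 / real (Suc n)) x) \<longlonglongrightarrow> 1"
proof -
  have "(\<lambda>n. \<Prod>i\<in>UNIV. exp (- (1 / real (Suc n)) / ((x $ i - a $ i) * (b $ i - x $ i)))) \<longlonglongrightarrow> (\<Prod>i\<in>(UNIV::'a set). exp (- 0 / ((x $ i - a $ i) * (b $ i - x $ i))))"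
    using LIMSEQ_inverse_real_of_nat assms
    by (intro tendsto_intros) (auto simp: inverse_eq_divide mem_box_cart, (metis less_irrefl)+)
  then show ?thesis
    using assms by (simp add: box_bump_def bump_term_def mem_box_cart)
qed

section \<open>Weak gradients\<close>

definition gradient :: "(real ^ 'n \<Rightarrow> real) \<Rightarrow> real ^ 'n \<Rightarrow> real ^ 'n" where
  "gradient f x = (\<chi> i. partial_deriv i f x)"

lemma test_function_has_derivative:
  assumes "\<eta> \<in> test_functions \<Omega>"
  shows "(\<eta> has_derivative (\<lambda>v. gradient \<eta> x \<bullet> v)) (at x)"
proof -
  have "C_diff (Suc 0) \<eta>" using assms by (auto simp: test_functions_def)
  then have "\<eta> differentiable (at x)" by simp
  then have d: "(\<eta> has_derivative frechet_derivative \<eta> (at x)) (at x)"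
    by (simp add: frechet_derivative_works)
  interpret bounded_linear "frechet_derivative \<eta> (at x)" using d by (rule has_derivative_bounded_linear)
  have "frechet_derivative \<eta> (at x) v = gradient \<eta> x \<bullet> v" for v
  proof -
    have "frechet_derivative \<eta> (at x) v = frechet_derivative \<eta> (at x) (\<Sum>i\<in>UNIV. v $ i *\<^sub>R axis i 1)"
      using basis_expansion[of v] by (simp add: scalar_mult_eq_scaleR)
    also have "\<dots> = (\<Sum>i\<in>UNIV. v $ i * partial_deriv i \<eta> x)"
      by (simp add: sum scaleR partial_deriv_def)
    finally show ?thesis by (simp add: inner_vec_def gradient_def mult.commute)
  qed
  then have eq: "frechet_derivative \<eta> (at x) = (\<lambda>v. gradient \<eta> x \<bullet> v)" by (rule ext)
  show ?thesis using d unfolding eq .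
qed

lemma test_function_continuous:
  assumes "\<eta> \<in> test_functions \<Omega>"
  shows "continuous_on UNIV \<eta>" "continuous_on UNIV (partial_deriv i \<eta>)" "continuous_on UNIV (gradient \<eta>)"
proof -
  have C: "C_diff 0 \<eta>" "C_diff (Suc 0) \<eta>" using assms by (auto simp: test_functions_def)
  then show "continuous_on UNIV \<eta>" "continuous_on UNIV (partial_deriv i \<eta>)" by auto
  show "continuous_on UNIV (gradient \<eta>)"
    unfolding gradient_def[abs_def] using C by (intro continuous_on_vec_lambda) auto
qed

lemma test_function_outside:
  assumes "\<eta> \<in> test_functions \<Omega>" "x \<notin> closure {x. \<eta> x \<noteq> 0}"
  shows "\<eta> x = 0" "gradient \<eta> x = 0" "partial_deriv i \<eta> x = 0"
proof -
  show "\<eta> x = 0" using assms(2) closure_subset[of "{x. \<eta> x \<noteq> 0}"] by auto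
  have "(\<eta> has_derivative (\<lambda>_. 0)) (at x)"
  proof (rule has_derivative_transform_within_open)
    show "((\<lambda>_. 0) has_derivative (\<lambda>_. 0)) (at x)" by simp
    show "open (- closure {x. \<eta> x \<noteq> 0})" "x \<in> - closure {x. \<eta> x \<noteq> 0}" using assms(2) by auto
    show "0 = \<eta> y" if "y \<in> - closure {x. \<eta> x \<noteq> 0}" for y
      using that closure_subset[of "{x. \<eta> x \<noteq> 0}"] by auto
  qed
  then have "frechet_derivative \<eta> (at x) = (\<lambda>_. 0)" by (rule frechet_derivative_at[symmetric])
  then have "partial_deriv j \<eta> x = 0" for j by (simp add: partial_deriv_def)
  then show "gradient \<eta> x = 0" "partial_deriv i \<eta> x = 0" by (simp_all add: gradient_def vec_eq_iff)
qed

lemma test_function_outside_domain: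
  assumes "\<eta> \<in> test_functions \<Omega>" "x \<notin> \<Omega>"
  shows "\<eta> x = 0" "gradient \<eta> x = 0" "partial_deriv i \<eta> x = 0"
  using test_function_outside[OF assms(1), of x] assms by (auto simp: test_functions_def)

section \<open>Classical gradients of test functions are weak gradients\<close>

lemma continuous_compact_support_integrable:
  fixes f :: "'a :: euclidean_space \<Rightarrow> 'b :: euclidean_space"
  assumes "continuous_on UNIV f" "compact K" "\<And>x. x \<notin> K \<Longrightarrow> f x = 0"
  shows "integrable lborel f"
proof -
  have "integrable lborel (\<lambda>x. indicator K x *\<^sub>R f x)"
    by (rule borel_integrable_compact) (use assms in \<open>auto intro: continuous_on_subset\<close>)
  also have "(\<lambda>x. indicator K x *\<^sub>R f x) = f" using assms(3) by (auto simp: indicator_def fun_eq_iff)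
  finally show ?thesis .
qed

lemma continuous_L1_loc:
  fixes f :: "real ^ 'n \<Rightarrow> 'b :: euclidean_space"
  assumes "continuous_on UNIV f"
  shows "f \<in> L1_loc \<Omega>"
proof -
  have "f absolutely_integrable_on K" if "compact K" for K
  proof -
    have "integrable lborel (\<lambda>x. indicator K x *\<^sub>R f x)"
      by (rule borel_integrable_compact) (use assms that in \<open>auto intro: continuous_on_subset\<close>)
    then show ?thesis
      unfolding set_integrable_def by (subst integrable_completion) auto
  qed
  then show ?thesis by (auto simp: L1_loc_def)
qed

lemma lborel_integral_translation:
  fixes g :: "'a :: euclidean_space \<Rightarrow> real"
  assumes "g \<in> borel_measurable borel"
  shows "(\<integral>x. g (x + c) \<partial>lborel) = (\<integral>x. g x \<partial>lborel)"
proof -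
  have "(\<integral>x. g x \<partial>lborel) = (\<integral>x. g x \<partial>distr lborel borel ((+) c))" by (simp add: lborel_distr_plus)
  also have "\<dots> = (\<integral>x. g (c + x) \<partial>lborel)" by (rule integral_distr) (use assms in auto)
  finally show ?thesis by (simp add: add.commute)
qed

text \<open>Difference quotients of g in direction e have integral 0 by translation invariance, and
  they converge to F x \<bullet> e under an integrable bound from the mean value theorem. This is
  integration by parts without iterated integrals.\<close>

lemma integral_directional_derivative_eq_0:
  fixes g :: "'a :: euclidean_space \<Rightarrow> real"
  assumes der: "\<And>x. (g has_derivative (\<lambda>v. F x \<bullet> v)) (at x)" and cont: "continuous_on UNIV F"
    and K: "compact K" "\<And>x. x \<notin> K \<Longrightarrow> g x = 0" "\<And>x. x \<notin> K \<Longrightarrow> F x = 0"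
  shows "(\<integral>x. F x \<bullet> e \<partial>lborel) = 0"
proof -
  let ?G = "\<lambda>x. F x \<bullet> e"
  have cg: "continuous_on UNIV g"
    by (intro continuous_at_imp_continuous_on ballI has_derivative_continuous[OF der])
  have cG: "continuous_on UNIV ?G" by (intro continuous_intros cont)
  have [measurable]: "g \<in> borel_measurable borel" "?G \<in> borel_measurable borel"
    using cg cG by (auto intro: borel_measurable_continuous_onI)
  have ig: "integrable lborel g" by (rule continuous_compact_support_integrable[OF cg K(1,2)])
  have "bounded (?G ` K)"
    by (intro compact_imp_bounded compact_continuous_image K continuous_on_subset[OF cG]) auto
  then obtain M where "\<forall>y\<in>?G ` K. norm y \<le> M" unfolding bounded_iff by (rule exE)
  then have M: "\<bar>?G x\<bar> \<le> max M 0" for x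
    using K(3)[of x] by (cases "x \<in> K") (auto simp: le_max_iff_disj)
  have line: "DERIV (\<lambda>t. g (x + t *\<^sub>R e)) t :> ?G (x + t *\<^sub>R e)" for x t
  proof -
    have "((\<lambda>t. g (x + t *\<^sub>R e)) has_derivative (\<lambda>s. F (x + t *\<^sub>R e) \<bullet> (s *\<^sub>R e))) (at t)"
      by (rule has_derivative_compose[OF _ der]) (auto intro!: derivative_eq_intros)
    then show ?thesis by (simp add: has_field_derivative_def mult_commute_abs)
  qed
  obtain \<rho> where \<rho>: "K \<subseteq> ball 0 \<rho>" using bounded_subset_ballD[OF compact_imp_bounded[OF K(1)]] by blast
  define s where "s n = 1 / real (Suc n)" for n
  have s: "0 < s n" "s n \<le> 1" for n by (auto simp: s_def)
  let ?d = "\<lambda>n x. (g (x + s n *\<^sub>R e) - g x) / s n"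
  \<comment> \<open>The steps have size at most 1, so outside this ball both x and x + s n e miss K
    and the quotient vanishes.\<close>
  let ?B = "cball (0 :: 'a) (\<rho> + norm e)"
  have "(\<lambda>n. \<integral>x. ?d n x \<partial>lborel) \<longlonglongrightarrow> (\<integral>x. ?G x \<partial>lborel)"
  proof (rule integral_dominated_convergence[where w = "\<lambda>x. indicator ?B x *\<^sub>R max M 0"])
    show "?G \<in> borel_measurable lborel" "\<And>n. ?d n \<in> borel_measurable lborel" by measurable
    show "integrable lborel (\<lambda>x. indicator ?B x *\<^sub>R max M 0)"
      by (rule borel_integrable_compact) auto
    show "AE x in lborel. (\<lambda>n. ?d n x) \<longlonglongrightarrow> ?G x"
    proof (rule AE_I2)
      fix x
      have "((\<lambda>h. (g (x + h *\<^sub>R e) - g x) / h) \<longlongrightarrow> ?G x) (at 0)"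
        using line[of x 0] by (simp add: has_field_derivative_iff)
      moreover have "s \<longlonglongrightarrow> 0"
        using LIMSEQ_inverse_real_of_nat by (simp add: s_def[abs_def] inverse_eq_divide)
      moreover have "\<forall>n. s n \<in> UNIV - {0}" using s(1) by (auto simp: less_le)
      ultimately show "(\<lambda>n. ?d n x) \<longlonglongrightarrow> ?G x"
        unfolding tendsto_at_iff_sequentially by (auto simp: comp_def)
    qed
    show "AE x in lborel. norm (?d n x) \<le> indicator ?B x *\<^sub>R max M 0" for n
    proof (rule AE_I2)
      fix x
      show "norm (?d n x) \<le> indicator ?B x *\<^sub>R max M 0"
      proof (cases "x \<in> ?B")
        case True
        obtain z where "0 < z" "z < s n" "g (x + s n *\<^sub>R e) - g (x + 0 *\<^sub>R e) = (s n - 0) * ?G (x + z *\<^sub>R e)"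
          using MVT2[OF s(1), of n "\<lambda>t. g (x + t *\<^sub>R e)" "\<lambda>t. ?G (x + t *\<^sub>R e)"] line by blast
        then have "?d n x = ?G (x + z *\<^sub>R e)" using s(1)[of n] by simp
        then show ?thesis using True M[of "x + z *\<^sub>R e"] by simp
      next
        case False
        then have "\<rho> + norm e < norm x" by simp
        moreover have "norm (s n *\<^sub>R e) \<le> norm e" using s[of n] by (simp add: mult_left_le_one_le)
        moreover have "norm x \<le> norm (x + s n *\<^sub>R e) + norm (s n *\<^sub>R e)"
          using norm_triangle_ineq4[of "x + s n *\<^sub>R e" "s n *\<^sub>R e"] by simp
        ultimately have "\<rho> < norm (x + s n *\<^sub>R e)" "\<rho> < norm x" using norm_ge_zero[of e] by linarith+
        then have "x + s n *\<^sub>R e \<notin> K" "x \<notin> K" using \<rho> by auto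
        then show ?thesis using K(2) by simp
      qed
    qed
  qed
  moreover have "(\<integral>x. ?d n x \<partial>lborel) = 0" for n
  proof -
    have "integrable lborel (\<lambda>x. g (x + s n *\<^sub>R e))"
    proof (rule continuous_compact_support_integrable)
      show "continuous_on UNIV (\<lambda>x. g (x + s n *\<^sub>R e))"
        by (rule continuous_on_compose2[OF cg]) (auto intro!: continuous_intros)
      show "compact ((\<lambda>x. x - s n *\<^sub>R e) ` K)"
        by (intro compact_continuous_image K continuous_intros)
      show "g (x + s n *\<^sub>R e) = 0" if "x \<notin> (\<lambda>x. x - s n *\<^sub>R e) ` K" for x
      proof (rule K(2))
        show "x + s n *\<^sub>R e \<notin> K"
          using that by (auto simp: image_iff)
      qed
    qed
    with ig show ?thesis by (simp add: lborel_integral_translation)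
  qed
  ultimately have "(\<lambda>n::nat. 0) \<longlonglongrightarrow> (\<integral>x. F x \<bullet> e \<partial>lborel)" by (simp only:)
  then show ?thesis by (simp add: LIMSEQ_const_iff)
qed

lemma integral_lebesgue_on_eq_lborel:
  fixes f :: "real ^ 'n \<Rightarrow> real"
  assumes "\<Omega> \<in> sets lebesgue" "\<And>x. x \<notin> \<Omega> \<Longrightarrow> f x = 0" "f \<in> borel_measurable borel"
  shows "(\<integral>x. f x \<partial>lebesgue_on \<Omega>) = (\<integral>x. f x \<partial>lborel)"
proof -
  have "(\<integral>x. f x \<partial>lebesgue_on \<Omega>) = (\<integral>x. indicator \<Omega> x *\<^sub>R f x \<partial>lebesgue)"
    using assms(1) by (intro integral_restrict_space) simp
  also have "(\<lambda>x. indicator \<Omega> x *\<^sub>R f x) = f" using assms(2) by (auto simp: indicator_def fun_eq_iff)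
  also have "(\<integral>x. f x \<partial>lebesgue) = (\<integral>x. f x \<partial>lborel)"
    by (rule integral_completion) (use assms(3) in simp)
  finally show ?thesis .
qed

text \<open>Integrates the product rule for \<eta> \<zeta>, whose support is compact.\<close>

lemma test_function_weak_gradient:
  assumes "open \<Omega>" "\<eta> \<in> test_functions \<Omega>"
  shows "has_weak_gradient \<Omega> \<eta> (gradient \<eta>)"
  unfolding has_weak_gradient_def
proof (intro conjI ballI allI)
  show "\<eta> \<in> L1_loc \<Omega>" "gradient \<eta> \<in> L1_loc \<Omega>"
    using test_function_continuous[OF assms(2)] by (auto intro: continuous_L1_loc)
  fix \<zeta> i assume \<zeta>: "\<zeta> \<in> test_functions \<Omega>"
  note c\<eta> = test_function_continuous[OF assms(2)] and c\<zeta> = test_function_continuous[OF \<zeta>]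
  note o\<eta> = test_function_outside_domain[OF assms(2)] and o\<zeta> = test_function_outside_domain[OF \<zeta>]
  have [measurable]: "\<eta> \<in> borel_measurable borel" "\<zeta> \<in> borel_measurable borel"
    "partial_deriv i \<eta> \<in> borel_measurable borel" "partial_deriv i \<zeta> \<in> borel_measurable borel"
    using c\<eta> c\<zeta> by (auto intro: borel_measurable_continuous_onI)
  have \<Omega>: "\<Omega> \<in> sets lebesgue" using assms(1) by simp
  let ?K = "closure {x. \<eta> x \<noteq> 0}"
  have K: "compact ?K" using assms(2) by (simp add: test_functions_def)
  note K0 = test_function_outside[OF assms(2)]
  have "(\<integral>x. (\<eta> x *\<^sub>R gradient \<zeta> x + \<zeta> x *\<^sub>R gradient \<eta> x) \<bullet> axis i 1 \<partial>lborel) = 0"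
  proof (rule integral_directional_derivative_eq_0[where g = "\<lambda>x. \<eta> x * \<zeta> x", OF _ _ K])
    show "((\<lambda>x. \<eta> x * \<zeta> x) has_derivative (\<lambda>v. (\<eta> x *\<^sub>R gradient \<zeta> x + \<zeta> x *\<^sub>R gradient \<eta> x) \<bullet> v)) (at x)" for x
      using has_derivative_mult[OF test_function_has_derivative[OF assms(2), of x] test_function_has_derivative[OF \<zeta>, of x]]
      by (simp add: inner_add_left mult.commute)
    show "continuous_on UNIV (\<lambda>x. \<eta> x *\<^sub>R gradient \<zeta> x + \<zeta> x *\<^sub>R gradient \<eta> x)"
      by (intro continuous_intros c\<eta> c\<zeta>)
    show "\<eta> x * \<zeta> x = 0" "\<eta> x *\<^sub>R gradient \<zeta> x + \<zeta> x *\<^sub>R gradient \<eta> x = 0" if "x \<notin> ?K" for x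
      using K0[OF that] by simp_all
  qed
  moreover have "(\<eta> x *\<^sub>R gradient \<zeta> x + \<zeta> x *\<^sub>R gradient \<eta> x) \<bullet> axis i 1
      = \<eta> x * partial_deriv i \<zeta> x + partial_deriv i \<eta> x * \<zeta> x" for x
    by (simp add: inner_add_left inner_axis gradient_def)
  ultimately have "(\<integral>x. \<eta> x * partial_deriv i \<zeta> x + partial_deriv i \<eta> x * \<zeta> x \<partial>lborel) = 0"
    by simp
  moreover have "integrable lborel (\<lambda>x. \<eta> x * partial_deriv i \<zeta> x)"
  proof (rule continuous_compact_support_integrable[OF _ K])
    show "\<eta> x * partial_deriv i \<zeta> x = 0" if "x \<notin> ?K" for x using K0(1)[OF that] by simp
  qed (intro continuous_intros c\<eta> c\<zeta>)
  moreover have "integrable lborel (\<lambda>x. partial_deriv i \<eta> x * \<zeta> x)"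
  proof (rule continuous_compact_support_integrable[OF _ K])
    show "partial_deriv i \<eta> x * \<zeta> x = 0" if "x \<notin> ?K" for x using K0(3)[OF that] by simp
  qed (intro continuous_intros c\<eta> c\<zeta>)
  ultimately have "(\<integral>x. \<eta> x * partial_deriv i \<zeta> x \<partial>lborel) = - (\<integral>x. partial_deriv i \<eta> x * \<zeta> x \<partial>lborel)"
    by simp
  moreover have "(\<integral>x. \<eta> x * partial_deriv i \<zeta> x \<partial>lebesgue_on \<Omega>) = (\<integral>x. \<eta> x * partial_deriv i \<zeta> x \<partial>lborel)"
    by (rule integral_lebesgue_on_eq_lborel[OF \<Omega>]) (auto simp: o\<eta>)
  moreover have "(\<integral>x. gradient \<eta> x $ i * \<zeta> x \<partial>lebesgue_on \<Omega>) = (\<integral>x. partial_deriv i \<eta> x * \<zeta> x \<partial>lborel)"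
    unfolding gradient_def by (simp, rule integral_lebesgue_on_eq_lborel[OF \<Omega>]) (auto simp: o\<eta> o\<zeta>)
  ultimately show "(\<integral>x. \<eta> x * partial_deriv i \<zeta> x \<partial>lebesgue_on \<Omega>) = - (\<integral>x. gradient \<eta> x $ i * \<zeta> x \<partial>lebesgue_on \<Omega>)"
    by simp
qed

section \<open>Pairing with test functions and uniqueness of weak gradients\<close>

lemma L1_loc_mult_integrable:
  fixes u :: "real ^ 'n \<Rightarrow> real"
  assumes "open \<Omega>" "u \<in> L1_loc \<Omega>" and c\<zeta>: "continuous_on UNIV \<zeta>"
    and K: "compact K" "K \<subseteq> \<Omega>" "\<And>x. x \<notin> K \<Longrightarrow> \<zeta> x = 0"
  shows "integrable (lebesgue_on \<Omega>) (\<lambda>x. u x * \<zeta> x)"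
proof -
  have [measurable]: "\<zeta> \<in> borel_measurable lebesgue"
    by (intro measurable_completion) (simp add: borel_measurable_continuous_onI[OF c\<zeta>])
  have uK: "integrable lebesgue (\<lambda>x. indicator K x *\<^sub>R u x)"
    using assms(2) K unfolding L1_loc_def set_integrable_def by auto
  have [measurable]: "(\<lambda>x. indicator K x *\<^sub>R u x) \<in> borel_measurable lebesgue" using uK by simp
  have "bounded (\<zeta> ` K)"
    by (intro compact_imp_bounded compact_continuous_image K continuous_on_subset[OF c\<zeta>]) auto
  then obtain M where "\<forall>y\<in>\<zeta> ` K. norm y \<le> M" unfolding bounded_iff by (rule exE)
  then have M: "\<bar>\<zeta> x\<bar> \<le> max M 0" for x
    using K(3)[of x] by (cases "x \<in> K") (auto simp: le_max_iff_disj)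
  have eq: "indicator \<Omega> x *\<^sub>R (u x * \<zeta> x) = \<zeta> x * (indicator K x *\<^sub>R u x)" for x
    using K(2) K(3)[of x] by (cases "x \<in> K") (auto simp: indicator_def)
  have "integrable lebesgue (\<lambda>x. \<zeta> x * (indicator K x *\<^sub>R u x))"
  proof (rule Bochner_Integration.integrable_bound)
    show "integrable lebesgue (\<lambda>x. max M 0 * (indicator K x *\<^sub>R u x))" using uK by simp
    show "AE x in lebesgue. norm (\<zeta> x * (indicator K x *\<^sub>R u x)) \<le> norm (max M 0 * (indicator K x *\<^sub>R u x))"
      using M by (intro AE_I2) (auto simp: abs_mult intro!: mult_right_mono)
  qed measurable
  then have "integrable lebesgue (\<lambda>x. indicator \<Omega> x *\<^sub>R (u x * \<zeta> x))" by (simp only: eq)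
  then show ?thesis using assms(1) by (subst integrable_restrict_space) auto
qed

lemma L1_loc_mult_test_integrable:
  fixes u :: "real ^ 'n \<Rightarrow> real"
  assumes "open \<Omega>" "u \<in> L1_loc \<Omega>" "\<zeta> \<in> test_functions \<Omega>"
  shows "integrable (lebesgue_on \<Omega>) (\<lambda>x. u x * \<zeta> x)"
    and "integrable (lebesgue_on \<Omega>) (\<lambda>x. u x * partial_deriv i \<zeta> x)"
proof -
  have K: "compact (closure {x. \<zeta> x \<noteq> 0})" "closure {x. \<zeta> x \<noteq> 0} \<subseteq> \<Omega>"
    using assms(3) by (auto simp: test_functions_def)
  show "integrable (lebesgue_on \<Omega>) (\<lambda>x. u x * \<zeta> x)"
    by (rule L1_loc_mult_integrable[OF assms(1,2) test_function_continuous(1)[OF assms(3)] K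
        test_function_outside(1)[OF assms(3)]])
  show "integrable (lebesgue_on \<Omega>) (\<lambda>x. u x * partial_deriv i \<zeta> x)"
    by (rule L1_loc_mult_integrable[OF assms(1,2) test_function_continuous(2)[OF assms(3)] K
        test_function_outside(3)[OF assms(3)]])
qed

text \<open>Box bumps with c = 1 / (n + 1) are test functions that converge boundedly to the
  indicator of the open box, and the frontier of the box is null.\<close>

lemma L1_loc_eq_0_on_cbox:
  fixes u :: "real ^ 'n \<Rightarrow> real"
  assumes \<Omega>: "open \<Omega>" and u: "u \<in> L1_loc \<Omega>"
    and test: "\<And>\<zeta>. \<zeta> \<in> test_functions \<Omega> \<Longrightarrow> (\<integral>x. u x * \<zeta> x \<partial>lebesgue_on \<Omega>) = 0"
    and ab: "\<And>i. a $ i < b $ i" and sub: "cbox a b \<subseteq> \<Omega>"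
  shows "integral (cbox a b) u = 0"
proof -
  let ?\<zeta> = "\<lambda>n. box_bump a b (1 / real (Suc n))"
  have t: "?\<zeta> n \<in> test_functions \<Omega>" for n by (rule box_bump_test_function[OF ab _ sub]) simp
  have ai: "u absolutely_integrable_on cbox a b" using u sub by (auto simp: L1_loc_def)
  then have i: "integrable lebesgue (\<lambda>x. indicator (cbox a b) x *\<^sub>R u x)" by (simp add: set_integrable_def)
  then have [measurable]: "(\<lambda>x. indicator (cbox a b) x *\<^sub>R u x) \<in> borel_measurable lebesgue" by simp
  have [measurable]: "?\<zeta> n \<in> borel_measurable lebesgue" for n
    using borel_measurable_continuous_onI[OF test_function_continuous(1)[OF t]]
    by (intro measurable_completion) (simp only: measurable_lborel2)
  have [measurable]: "box a b \<in> sets lebesgue" by simp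
  have out: "?\<zeta> n x = 0" if "x \<notin> box a b" for n x using that box_bump_nonzero by blast
  have bc: "x \<in> box a b \<Longrightarrow> x \<in> cbox a b" for x using box_subset_cbox by blast
  have eq: "indicator \<Omega> x *\<^sub>R (u x * ?\<zeta> n x) = ?\<zeta> n x * (indicator (cbox a b) x *\<^sub>R u x)" for x n
    using out[of x n] bc[of x] sub by (cases "x \<in> box a b") (auto simp: indicator_def)
  have "(\<lambda>n. \<integral>x. ?\<zeta> n x * (indicator (cbox a b) x *\<^sub>R u x) \<partial>lebesgue) \<longlonglongrightarrow> (\<integral>x. indicator (box a b) x * (indicator (cbox a b) x *\<^sub>R u x) \<partial>lebesgue)"
  proof (rule integral_dominated_convergence[where w = "\<lambda>x. norm (indicator (cbox a b) x *\<^sub>R u x)"])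
    show "integrable lebesgue (\<lambda>x. norm (indicator (cbox a b) x *\<^sub>R u x))" by (intro integrable_norm i)
    show "AE x in lebesgue. (\<lambda>n. ?\<zeta> n x * (indicator (cbox a b) x *\<^sub>R u x)) \<longlonglongrightarrow> indicator (box a b) x * (indicator (cbox a b) x *\<^sub>R u x)"
    proof (rule AE_I2)
      fix x
      have "(\<lambda>n. ?\<zeta> n x) \<longlonglongrightarrow> indicator (box a b) x"
        using box_bump_tendsto[of x a b] out[of x] by (cases "x \<in> box a b") auto
      then show "(\<lambda>n. ?\<zeta> n x * (indicator (cbox a b) x *\<^sub>R u x)) \<longlonglongrightarrow> indicator (box a b) x * (indicator (cbox a b) x *\<^sub>R u x)"
        by (intro tendsto_intros)
    qed
    show "AE x in lebesgue. norm (?\<zeta> n x * (indicator (cbox a b) x *\<^sub>R u x)) \<le> norm (indicator (cbox a b) x *\<^sub>R u x)" for n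
      using box_bump_bounds[of "1 / real (Suc n)" a b] by (intro AE_I2) (auto simp: abs_mult intro!: mult_left_le_one_le)
  qed measurable
  moreover have "(\<integral>x. ?\<zeta> n x * (indicator (cbox a b) x *\<^sub>R u x) \<partial>lebesgue) = 0" for n
  proof -
    have "(\<integral>x. u x * ?\<zeta> n x \<partial>lebesgue_on \<Omega>) = (\<integral>x. indicator \<Omega> x *\<^sub>R (u x * ?\<zeta> n x) \<partial>lebesgue)"
      using \<Omega> by (intro integral_restrict_space) simp
    then show ?thesis using test[OF t, of n] by (simp only: eq)
  qed
  ultimately have "(\<lambda>n::nat. 0) \<longlonglongrightarrow> (\<integral>x. indicator (box a b) x * (indicator (cbox a b) x *\<^sub>R u x) \<partial>lebesgue)" by (simp only:)
  then have 0: "(\<integral>x. indicator (box a b) x * (indicator (cbox a b) x *\<^sub>R u x) \<partial>lebesgue) = 0"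
    by (simp add: LIMSEQ_const_iff)
  have "cbox a b - box a b \<in> null_sets lebesgue"
    using negligible_frontier_interval[of a b] by (simp add: negligible_iff_null_sets)
  then have "AE x in lebesgue. x \<notin> cbox a b - box a b" by (rule AE_not_in)
  then have ae: "AE x in lebesgue. indicator (box a b) x * (indicator (cbox a b) x *\<^sub>R u x) = indicator (cbox a b) x *\<^sub>R u x"
    by eventually_elim (auto simp: indicator_def bc)
  have "integral (cbox a b) u = (LINT x:cbox a b|lebesgue. u x)"
    using set_lebesgue_integral_eq_integral(2)[OF ai] by simp
  also have "\<dots> = (\<integral>x. indicator (box a b) x * (indicator (cbox a b) x *\<^sub>R u x) \<partial>lebesgue)"
    unfolding set_lebesgue_integral_def
  proof (rule integral_cong_AE)
    show "AE x in lebesgue. indicator (cbox a b) x *\<^sub>R u x = indicator (box a b) x * (indicator (cbox a b) x *\<^sub>R u x)"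
      using ae by eventually_elim (rule sym)
  qed measurable
  finally show ?thesis using 0 by simp
qed

lemma cbox_One_bounds:
  fixes x :: "'a :: euclidean_space" and h :: real
  assumes "y \<in> cbox x (x + h *\<^sub>R One)"
  shows "norm (y - x) \<le> DIM('a) * h"
proof -
  have "norm (y - x) \<le> (\<Sum>b\<in>Basis. \<bar>(y - x) \<bullet> b\<bar>)" by (rule norm_le_l1)
  also have "\<dots> \<le> (\<Sum>b\<in>(Basis :: 'a set). h)"
    using assms by (intro sum_mono) (auto simp: mem_box inner_diff_left inner_add_left inner_sum_left_Basis abs_le_iff)
  finally show ?thesis by simp
qed

text \<open>All integrals of u over boxes in \<Omega> vanish, so Lebesgue differentiation along the
  cubes with lower corner x gives u x = 0; countably many boxes exhaust \<Omega>.\<close>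

lemma du_Bois_Reymond:
  fixes u :: "real ^ 'n \<Rightarrow> real"
  assumes \<Omega>: "open \<Omega>" and u: "u \<in> L1_loc \<Omega>"
    and test: "\<And>\<zeta>. \<zeta> \<in> test_functions \<Omega> \<Longrightarrow> (\<integral>x. u x * \<zeta> x \<partial>lebesgue_on \<Omega>) = 0"
  shows "AE x in lebesgue. x \<in> \<Omega> \<longrightarrow> u x = 0"
proof -
  have box: "AE x in lebesgue. x \<in> cbox A B \<longrightarrow> u x = 0" if AB: "cbox A B \<subseteq> \<Omega>" for A B
  proof -
    \<comment> \<open>The differentiation theorem wants a function integrable on every box of the
      whole space; near interior points of the box f agrees with u.\<close>
    define f where "f x = (if x \<in> cbox A B then u x else 0)" for x
    have "u absolutely_integrable_on cbox A B" using u AB by (auto simp: L1_loc_def)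
    then have "u integrable_on cbox A B" by (rule set_lebesgue_integral_eq_integral(1))
    then have "f integrable_on UNIV" unfolding f_def by (simp add: integrable_restrict_UNIV)
    then have "f integrable_on cbox a b" for a b by (rule integrable_on_subcbox) simp
    then obtain N where N: "negligible N" "\<And>x e. x \<notin> N \<Longrightarrow> 0 < e \<Longrightarrow>
        \<exists>d>0. \<forall>h. 0 < h \<and> h < d \<longrightarrow> norm (integral (cbox x (x + h *\<^sub>R One)) f /\<^sub>R h ^ DIM(real ^ 'n) - f x) < e"
      using integrable_ccontinuous_explicit by blast
    have "u x = 0" if x: "x \<in> box A B" "x \<notin> N" for x
    proof (rule ccontr)
      assume "u x \<noteq> 0"
      then have fx: "norm (f x) > 0" using x(1) box_subset_cbox by (auto simp: f_def)
      obtain d where d: "0 < d" "\<And>h. 0 < h \<Longrightarrow> h < d \<Longrightarrow>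
          norm (integral (cbox x (x + h *\<^sub>R One)) f /\<^sub>R h ^ DIM(real ^ 'n) - f x) < norm (f x)"
        using N(2)[OF x(2) fx] by blast
      obtain r where r: "0 < r" "ball x r \<subseteq> box A B"
        using x(1) open_box open_contains_ball by blast
      \<comment> \<open>Points of the cube of side h lie within n h of x; the factors 1/2 make both
        h < d and n h < r strict.\<close>
      define h where "h = min (d / 2) (r / (2 * CARD('n)))"
      have h: "0 < h" "h < d" using d r by (auto simp: h_def min_def)
      have "CARD('n) * h \<le> CARD('n) * (r / (2 * CARD('n)))" by (intro mult_left_mono) (auto simp: h_def)
      also have "\<dots> < r" using r by simp
      finally have hr: "CARD('n) * h < r" .
      have sub: "cbox x (x + h *\<^sub>R One) \<subseteq> ball x r"
      proof
        fix y assume "y \<in> cbox x (x + h *\<^sub>R One)"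
        from cbox_One_bounds[OF this] hr show "y \<in> ball x r" by (simp add: dist_norm norm_minus_commute)
      qed
      then have sub': "cbox x (x + h *\<^sub>R One) \<subseteq> cbox A B" using r box_subset_cbox by blast
      have "integral (cbox x (x + h *\<^sub>R One)) f = integral (cbox x (x + h *\<^sub>R One)) u"
        using sub' by (intro integral_cong) (auto simp: f_def)
      also have "\<dots> = 0"
      proof (rule L1_loc_eq_0_on_cbox[OF \<Omega> u test])
        have "(One :: real ^ 'n) $ i = 1" for i
          by (simp add: cart_eq_inner_axis inner_sum_left_Basis axis_in_Basis_iff)
        then show "x $ i < (x + h *\<^sub>R One) $ i" for i using h by simp
      qed (use sub' AB in auto)
      finally show False using d(2)[OF h] by simp
    qed
    moreover have "AE x in lebesgue. x \<notin> N"
      using N(1) by (intro AE_not_in) (simp add: negligible_iff_null_sets)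
    moreover have "AE x in lebesgue. x \<notin> cbox A B - box A B"
      by (intro AE_not_in) (simp flip: negligible_iff_null_sets add: negligible_frontier_interval)
    ultimately show ?thesis by (auto elim: eventually_elim2)
  qed
  obtain D where D: "countable D" "D \<subseteq> Pow \<Omega>" "\<And>X. X \<in> D \<Longrightarrow> \<exists>a b. X = cbox a b" "\<Union>D = \<Omega>"
    using open_countable_Union_open_cbox[OF \<Omega>] by metis
  have "AE x in lebesgue. \<forall>X\<in>D. x \<in> X \<longrightarrow> u x = 0"
  proof (subst AE_ball_countable[OF D(1)], rule ballI)
    fix X assume X: "X \<in> D"
    then obtain a b where "X = cbox a b" using D(3) by blast
    then show "AE x in lebesgue. x \<in> X \<longrightarrow> u x = 0" using box[of a b] X D(2) by auto
  qed
  then show ?thesis using D(4) by (auto elim!: eventually_mono)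
qed

lemma L1_loc_diff:
  assumes "f \<in> L1_loc \<Omega>" "g \<in> L1_loc \<Omega>"
  shows "(\<lambda>x. f x - g x) \<in> L1_loc \<Omega>"
  using assms by (auto simp: L1_loc_def intro: set_integral_diff)

lemma L1_loc_component:
  assumes "v \<in> L1_loc \<Omega>"
  shows "(\<lambda>x. v x $ i) \<in> L1_loc \<Omega>"
proof -
  have "(\<lambda>x. v x $ i) absolutely_integrable_on K" if "compact K" "K \<subseteq> \<Omega>" for K
  proof -
    have "integrable lebesgue (\<lambda>x. indicator K x *\<^sub>R v x)"
      using assms that by (auto simp: L1_loc_def set_integrable_def)
    from integrable_bounded_linear[OF bounded_linear_vec_nth this]
    show ?thesis by (simp add: set_integrable_def)
  qed
  then show ?thesis by (auto simp: L1_loc_def)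
qed

lemma has_weak_gradient_diff:
  fixes f g :: "real ^ 'n \<Rightarrow> real"
  assumes \<Omega>: "open \<Omega>" and f: "has_weak_gradient \<Omega> f v" and g: "has_weak_gradient \<Omega> g w"
  shows "has_weak_gradient \<Omega> (\<lambda>x. f x - g x) (\<lambda>x. v x - w x)"
  unfolding has_weak_gradient_def
proof (intro conjI ballI allI)
  have L: "f \<in> L1_loc \<Omega>" "g \<in> L1_loc \<Omega>" "v \<in> L1_loc \<Omega>" "w \<in> L1_loc \<Omega>"
    using f g by (auto simp: has_weak_gradient_def)
  then show "(\<lambda>x. f x - g x) \<in> L1_loc \<Omega>" "(\<lambda>x. v x - w x) \<in> L1_loc \<Omega>" by (auto intro: L1_loc_diff)
  fix \<zeta> i assume \<zeta>: "\<zeta> \<in> test_functions \<Omega>"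
  have "(\<integral>x. (f x - g x) * partial_deriv i \<zeta> x \<partial>lebesgue_on \<Omega>)
      = (\<integral>x. f x * partial_deriv i \<zeta> x \<partial>lebesgue_on \<Omega>) - (\<integral>x. g x * partial_deriv i \<zeta> x \<partial>lebesgue_on \<Omega>)"
    using L by (simp add: left_diff_distrib L1_loc_mult_test_integrable[OF \<Omega> _ \<zeta>])
  also have "\<dots> = - ((\<integral>x. v x $ i * \<zeta> x \<partial>lebesgue_on \<Omega>) - (\<integral>x. w x $ i * \<zeta> x \<partial>lebesgue_on \<Omega>))"
    using f g \<zeta> by (simp add: has_weak_gradient_def)
  also have "(\<integral>x. v x $ i * \<zeta> x \<partial>lebesgue_on \<Omega>) - (\<integral>x. w x $ i * \<zeta> x \<partial>lebesgue_on \<Omega>)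
      = (\<integral>x. (v x - w x) $ i * \<zeta> x \<partial>lebesgue_on \<Omega>)"
    using L by (simp add: left_diff_distrib L1_loc_mult_test_integrable[OF \<Omega> _ \<zeta>] L1_loc_component)
  finally show "(\<integral>x. (f x - g x) * partial_deriv i \<zeta> x \<partial>lebesgue_on \<Omega>)
      = - (\<integral>x. (v x - w x) $ i * \<zeta> x \<partial>lebesgue_on \<Omega>)" .
qed

text \<open>v - w is a weak gradient of f - f = 0, so each of its components is orthogonal to all
  test functions. This is needed to compare the unrelated choices made by
  \<open>weak_gradient\<close> for u and for u - \<eta>.\<close>

lemma weak_gradient_unique:
  fixes f :: "real ^ 'n \<Rightarrow> real"
  assumes \<Omega>: "open \<Omega>" and v: "has_weak_gradient \<Omega> f v" and w: "has_weak_gradient \<Omega> f w"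
  shows "AE x in lebesgue. x \<in> \<Omega> \<longrightarrow> v x = w x"
proof -
  have d: "has_weak_gradient \<Omega> (\<lambda>x. f x - f x) (\<lambda>x. v x - w x)"
    by (rule has_weak_gradient_diff[OF \<Omega> v w])
  have "AE x in lebesgue. x \<in> \<Omega> \<longrightarrow> (v x - w x) $ i = 0" for i
  proof (rule du_Bois_Reymond[OF \<Omega>])
    show "(\<lambda>x. (v x - w x) $ i) \<in> L1_loc \<Omega>"
      using d by (intro L1_loc_component) (simp add: has_weak_gradient_def)
    show "(\<integral>x. (v x - w x) $ i * \<zeta> x \<partial>lebesgue_on \<Omega>) = 0" if "\<zeta> \<in> test_functions \<Omega>" for \<zeta>
      using d that by (simp add: has_weak_gradient_def)
  qed
  then have "AE x in lebesgue. \<forall>i. x \<in> \<Omega> \<longrightarrow> (v x - w x) $ i = 0"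
    unfolding AE_all_countable by (rule allI)
  then show ?thesis by eventually_elim (auto simp: vec_eq_iff)
qed

section \<open>Passage to the Sobolev space\<close>

lemma ennreal_less_add:
  assumes "x < top" "0 < d"
  shows "x < x + ennreal d"
  using assms by (cases x) (auto simp flip: ennreal_plus intro: ennreal_lessI)

context weighted_orlicz
begin

abbreviation modular :: "(real ^ 'n \<Rightarrow> real) \<Rightarrow> real \<Rightarrow> ennreal" where
  "modular f l \<equiv> \<integral>\<^sup>+x\<in>\<Omega>. \<phi> x (\<bar>f x\<bar> / l) * ennreal (\<omega> x) \<partial>lebesgue"

lemma lux_norm_eq:
  "lux_norm \<Omega> (weighted \<phi> \<omega>) f = Inf {ennreal l | l. 0 < l \<and> modular f l \<le> 1}"
  unfolding lux_norm_def weighted_def by (simp add: nn_integral_restrict_space)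

lemma lux_norm_le: "0 < l \<Longrightarrow> modular f l \<le> 1 \<Longrightarrow> lux_norm \<Omega> (weighted \<phi> \<omega>) f \<le> ennreal l"
  unfolding lux_norm_eq by (intro Inf_lower) blast

lemma lux_norm_less:
  assumes "lux_norm \<Omega> (weighted \<phi> \<omega>) f < t"
  obtains l where "0 < l" "modular f l \<le> 1" "ennreal l < t"
  using assms unfolding lux_norm_eq Inf_less_iff by blast

lemma modular_measurable:
  assumes "f \<in> borel_measurable (lebesgue_on \<Omega>)" "0 < l"
  shows "(\<lambda>x. \<phi> x (\<bar>f x\<bar> / l) * ennreal (\<omega> x) * indicator \<Omega> x) \<in> borel_measurable lebesgue"
proof -
  have "(\<lambda>x. \<phi> x (\<bar>f x\<bar> / l) * indicator \<Omega> x) \<in> borel_measurable lebesgue"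
    by (rule Phi_prefunction_measurable[OF Phi _ sets_\<Omega>]) (use assms in auto)
  then have "(\<lambda>x. \<phi> x (\<bar>f x\<bar> / l) * indicator \<Omega> x * ennreal (\<omega> x)) \<in> borel_measurable lebesgue"
    by measurable
  then show ?thesis by (simp add: mult_ac)
qed

text \<open>\<phi> at the larger of two arguments is at most the sum of its values at both, and
  (aInc)_1 supplies the factor 1/2 that convexity would give. Domination of f only almost everywhere
  suits weak gradients.\<close>

lemma lux_norm_quasi_triangle:
  "\<exists>k\<ge>1. \<forall>f g h. g \<in> borel_measurable (lebesgue_on \<Omega>) \<longrightarrow> h \<in> borel_measurable (lebesgue_on \<Omega>) \<longrightarrow>
     (AE x in lebesgue. x \<in> \<Omega> \<longrightarrow> \<bar>f x\<bar> \<le> \<bar>g x\<bar> + \<bar>h x\<bar>) \<longrightarrow>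
     lux_norm \<Omega> (weighted \<phi> \<omega>) f
       \<le> ennreal k * (lux_norm \<Omega> (weighted \<phi> \<omega>) g + lux_norm \<Omega> (weighted \<phi> \<omega>) h)"
proof -
  obtain L where L: "1 \<le> L" and div: "\<And>x t k. x \<in> \<Omega> \<Longrightarrow> 0 \<le> t \<Longrightarrow> 1 \<le> k \<Longrightarrow>
      \<phi> x (t / k) \<le> ennreal (L / k) * \<phi> x t"
    using aInc_1_divide by blast
  \<comment> \<open>Makes L / k = 1/2, so that two modulars at most 1 combine to a modular at most
    1.\<close>
  define k where "k = 2 * L"
  have k: "1 \<le> k" "0 < k" using L by (auto simp: k_def)
  have Lk: "L / k = 1 / 2" using L by (simp add: k_def)
  let ?N = "lux_norm \<Omega> (weighted \<phi> \<omega>)"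
  have "?N f \<le> ennreal k * (?N g + ?N h)"
    if g: "g \<in> borel_measurable (lebesgue_on \<Omega>)" and h: "h \<in> borel_measurable (lebesgue_on \<Omega>)"
      and le: "AE x in lebesgue. x \<in> \<Omega> \<longrightarrow> \<bar>f x\<bar> \<le> \<bar>g x\<bar> + \<bar>h x\<bar>" for f g h
  proof (rule ennreal_le_epsilon)
    fix e :: real assume fin: "ennreal k * (?N g + ?N h) < top" and e: "0 < e"
    define d where "d = e / (2 * k)"
    have d: "0 < d" using e k by (simp add: d_def)
    have "?N g < top" "?N h < top"
      using fin k by (auto simp: ennreal_mult_less_top less_top)
    then have "?N g < ?N g + ennreal d" "?N h < ?N h + ennreal d"
      using d by (auto intro: ennreal_less_add)
    obtain l1 where l1: "0 < l1" "modular g l1 \<le> 1" "ennreal l1 < ?N g + ennreal d"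
      using \<open>?N g < ?N g + ennreal d\<close> by (rule lux_norm_less)
    obtain l2 where l2: "0 < l2" "modular h l2 \<le> 1" "ennreal l2 < ?N h + ennreal d"
      using \<open>?N h < ?N h + ennreal d\<close> by (rule lux_norm_less)
    let ?G = "\<lambda>x. \<phi> x (\<bar>g x\<bar> / l1) * ennreal (\<omega> x) * indicator \<Omega> x"
    let ?H = "\<lambda>x. \<phi> x (\<bar>h x\<bar> / l2) * ennreal (\<omega> x) * indicator \<Omega> x"
    have [measurable]: "?G \<in> borel_measurable lebesgue" "?H \<in> borel_measurable lebesgue"
      using modular_measurable g h l1 l2 by auto
    have "modular f (k * (l1 + l2)) \<le> (\<integral>\<^sup>+x. ennreal (1 / 2) * (?G x + ?H x) \<partial>lebesgue)"
    proof (rule nn_integral_mono_AE)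
      show "AE x in lebesgue. \<phi> x (\<bar>f x\<bar> / (k * (l1 + l2))) * ennreal (\<omega> x) * indicator \<Omega> x
          \<le> ennreal (1 / 2) * (?G x + ?H x)"
        using le
      proof eventually_elim
        case (elim x)
        show ?case
        proof (cases "x \<in> \<Omega>")
          case True
          define t where "t = max (\<bar>g x\<bar> / l1) (\<bar>h x\<bar> / l2)"
          have t0: "0 \<le> t" using l1 by (simp add: t_def le_max_iff_disj)
          have "\<bar>g x\<bar> / l1 \<le> t" "\<bar>h x\<bar> / l2 \<le> t" by (auto simp: t_def)
          then have "\<bar>g x\<bar> \<le> l1 * t" "\<bar>h x\<bar> \<le> l2 * t"
            using l1 l2 by (auto simp: pos_divide_le_eq mult.commute)
          then have "\<bar>f x\<bar> \<le> (l1 + l2) * t" using elim True by (simp add: distrib_right)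
          then have "\<bar>f x\<bar> / (l1 + l2) \<le> t" using l1 l2 by (simp add: pos_divide_le_eq mult.commute)
          then have "\<bar>f x\<bar> / (l1 + l2) / k \<le> t / k" using k by (intro divide_right_mono) auto
          then have "\<bar>f x\<bar> / (k * (l1 + l2)) \<le> t / k" by (simp add: mult.commute)
          then have "\<phi> x (\<bar>f x\<bar> / (k * (l1 + l2))) \<le> \<phi> x (t / k)"
            using k l1 l2 by (intro \<phi>_mono True) auto
          also have "\<dots> \<le> ennreal (1 / 2) * \<phi> x t" using div[OF True t0 k(1)] Lk by simp
          also have "\<phi> x t \<le> \<phi> x (\<bar>g x\<bar> / l1) + \<phi> x (\<bar>h x\<bar> / l2)"
            by (auto simp: t_def max_def add_increasing add_increasing2)
          finally have "\<phi> x (\<bar>f x\<bar> / (k * (l1 + l2))) \<le> ennreal (1 / 2) * (\<phi> x (\<bar>g x\<bar> / l1) + \<phi> x (\<bar>h x\<bar> / l2))"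
            by (simp add: mult_left_mono)
          from mult_right_mono[OF this, of "ennreal (\<omega> x)"] True
          show ?thesis by (simp add: distrib_left distrib_right mult.assoc)
        qed simp
      qed
    qed
    also have "\<dots> = ennreal (1 / 2) * (modular g l1 + modular h l2)"
      by (simp add: nn_integral_cmult nn_integral_add)
    also have "\<dots> \<le> ennreal (1 / 2) * (1 + 1)"
      using l1(2) l2(2) by (intro mult_left_mono add_mono) auto
    also have "(1 :: ennreal) + 1 = ennreal 2" by simp
    also have "ennreal (1 / 2) * ennreal 2 = 1" by (subst ennreal_mult''[symmetric]) auto
    finally have "?N f \<le> ennreal (k * (l1 + l2))"
      using k l1 l2 by (intro lux_norm_le mult_pos_pos) auto
    also have "\<dots> = ennreal k * (ennreal l1 + ennreal l2)"
      using k l1 l2 by (simp add: ennreal_mult)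
    also have "\<dots> \<le> ennreal k * ((?N g + ennreal d) + (?N h + ennreal d))"
      using l1(3) l2(3) by (intro mult_left_mono add_mono) auto
    also have "\<dots> = ennreal k * (?N g + ?N h) + ennreal k * (ennreal d + ennreal d)"
      by (simp add: distrib_left add_ac)
    also have "ennreal k * (ennreal d + ennreal d) = ennreal e"
      using d k by (simp add: d_def ennreal_mult''[symmetric] flip: ennreal_plus)
    finally show "?N f \<le> ennreal k * (?N g + ?N h) + ennreal e" .
  qed
  with k(1) show ?thesis by blast
qed

lemma test_function_Poincare:
  "\<exists>C>0. \<forall>\<eta>\<in>test_functions \<Omega>.
     lux_norm \<Omega> (weighted \<phi> \<omega>) \<eta> \<le> ennreal C * lux_norm \<Omega> (weighted \<phi> \<omega>) (\<lambda>x. norm (gradient \<eta> x))"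
proof -
  obtain C where C: "0 < C" and main: "\<And>\<eta> F l. (\<forall>y. (\<eta> has_derivative (\<lambda>v. F y \<bullet> v)) (at y)) \<Longrightarrow>
     continuous_on UNIV F \<Longrightarrow> (\<forall>x. x \<notin> \<Omega> \<longrightarrow> \<eta> x = 0 \<and> F x = 0) \<Longrightarrow> 0 < l \<Longrightarrow>
     (\<integral>\<^sup>+x\<in>\<Omega>. \<phi> x (norm (F x) / l) * ennreal (\<omega> x) \<partial>lebesgue) \<le> 1 \<Longrightarrow>
     (\<integral>\<^sup>+x\<in>\<Omega>. \<phi> x (\<bar>\<eta> x\<bar> / (C * l)) * ennreal (\<omega> x) \<partial>lebesgue) \<le> 1"
    using smooth_Poincare_modular by blast
  let ?N = "lux_norm \<Omega> (weighted \<phi> \<omega>)"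
  have "?N \<eta> \<le> ennreal C * ?N (\<lambda>x. norm (gradient \<eta> x))" if \<eta>: "\<eta> \<in> test_functions \<Omega>" for \<eta>
  proof (rule ennreal_le_epsilon)
    fix e :: real assume fin: "ennreal C * ?N (\<lambda>x. norm (gradient \<eta> x)) < top" and e: "0 < e"
    have "?N (\<lambda>x. norm (gradient \<eta> x)) < top"
      using fin C by (auto simp: ennreal_mult_less_top less_top)
    then have "?N (\<lambda>x. norm (gradient \<eta> x)) < ?N (\<lambda>x. norm (gradient \<eta> x)) + ennreal (e / C)"
      using e C by (auto intro: ennreal_less_add)
    then obtain l where l: "0 < l" "modular (\<lambda>x. norm (gradient \<eta> x)) l \<le> 1"
        "ennreal l < ?N (\<lambda>x. norm (gradient \<eta> x)) + ennreal (e / C)"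
      by (rule lux_norm_less)
    have "modular \<eta> (C * l) \<le> 1"
      by (rule main[of \<eta> "gradient \<eta>"])
        (use \<eta> l test_function_has_derivative[OF \<eta>] test_function_continuous[OF \<eta>] test_function_outside_domain[OF \<eta>] in auto)
    then have "?N \<eta> \<le> ennreal (C * l)" using C l by (intro lux_norm_le) auto
    also have "\<dots> = ennreal C * ennreal l" using C l by (simp add: ennreal_mult)
    also have "\<dots> \<le> ennreal C * (?N (\<lambda>x. norm (gradient \<eta> x)) + ennreal (e / C))"
      using l(3) by (intro mult_left_mono) auto
    also have "\<dots> = ennreal C * ?N (\<lambda>x. norm (gradient \<eta> x)) + ennreal e"
      using C e by (simp add: distrib_left ennreal_mult''[symmetric])
    finally show "?N \<eta> \<le> ennreal C * ?N (\<lambda>x. norm (gradient \<eta> x)) + ennreal e" .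
  qed
  with C show ?thesis by blast
qed

text \<open>The quasi-triangle inequality is applied to u = \<eta> + (u - \<eta>) and to the
  gradient of \<eta>, written as the difference of those of u and u - \<eta>; hence C' = k C
  k.\<close>

lemma Poincare_W1_0:
  "\<exists>C>0. \<forall>u\<in>W1_0 \<Omega> (weighted \<phi> \<omega>).
     lux_norm \<Omega> (weighted \<phi> \<omega>) u \<le> ennreal C * lux_norm \<Omega> (weighted \<phi> \<omega>) (\<lambda>x. norm (weak_gradient \<Omega> u x))"
proof -
  let ?N = "lux_norm \<Omega> (weighted \<phi> \<omega>)"
  obtain k where k: "1 \<le> k" and tri: "\<And>f g h. g \<in> borel_measurable (lebesgue_on \<Omega>) \<Longrightarrow>
     h \<in> borel_measurable (lebesgue_on \<Omega>) \<Longrightarrow>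
     (AE x in lebesgue. x \<in> \<Omega> \<longrightarrow> \<bar>f x\<bar> \<le> \<bar>g x\<bar> + \<bar>h x\<bar>) \<Longrightarrow> ?N f \<le> ennreal k * (?N g + ?N h)"
    using lux_norm_quasi_triangle by blast
  obtain C where C: "0 < C" and test: "\<And>\<eta>. \<eta> \<in> test_functions \<Omega> \<Longrightarrow> ?N \<eta> \<le> ennreal C * ?N (\<lambda>x. norm (gradient \<eta> x))"
    using test_function_Poincare by blast
  define C' where "C' = k * C * k"
  have C': "0 < C'" using k C by (simp add: C'_def)
  have "?N u \<le> ennreal C' * ?N (\<lambda>x. norm (weak_gradient \<Omega> u x))" if u: "u \<in> W1_0 \<Omega> (weighted \<phi> \<omega>)" for u
  proof (rule ennreal_le_epsilon)
    fix e :: real assume e: "0 < e"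
    \<comment> \<open>The error d enters once through the gradient, with factor C', and once through
      u - \<eta>, with factor k.\<close>
    define d where "d = e / (C' + k)"
    have d: "0 < d" using e C' k by (simp add: d_def)
    have uW: "u \<in> W1 \<Omega> (weighted \<phi> \<omega>)" using u by (simp add: W1_0_def)
    obtain \<eta> where \<eta>: "\<eta> \<in> test_functions \<Omega>" and ud: "W1_norm \<Omega> (weighted \<phi> \<omega>) (\<lambda>x. u x - \<eta> x) < ennreal d"
      using u d unfolding W1_0_def by blast
    define v where "v = weak_gradient \<Omega> u"
    define w where "w = weak_gradient \<Omega> (\<lambda>x. u x - \<eta> x)"
    have v: "has_weak_gradient \<Omega> u v"
    proof -
      obtain z where "has_weak_gradient \<Omega> u z" using uW by (auto simp: W1_def)
      then show ?thesis unfolding v_def weak_gradient_def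
        by (rule someI[where P = "has_weak_gradient \<Omega> u"])
    qed
    have d': "has_weak_gradient \<Omega> (\<lambda>x. u x - \<eta> x) (\<lambda>x. v x - gradient \<eta> x)"
      by (rule has_weak_gradient_diff[OF open_\<Omega> v test_function_weak_gradient[OF open_\<Omega> \<eta>]])
    then have w: "has_weak_gradient \<Omega> (\<lambda>x. u x - \<eta> x) w"
      unfolding w_def weak_gradient_def by (rule someI[where P = "has_weak_gradient \<Omega> (\<lambda>x. u x - \<eta> x)"])
    have vw: "AE x in lebesgue. x \<in> \<Omega> \<longrightarrow> v x - gradient \<eta> x = w x"
      by (rule weak_gradient_unique[OF open_\<Omega> d' w])
    have [measurable]: "v \<in> borel_measurable (lebesgue_on \<Omega>)" "w \<in> borel_measurable (lebesgue_on \<Omega>)"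
      using v w by (auto simp: has_weak_gradient_def intro!: L1_loc_measurable open_\<Omega>)
    have [measurable]: "u \<in> borel_measurable (lebesgue_on \<Omega>)" "(\<lambda>x. u x - \<eta> x) \<in> borel_measurable (lebesgue_on \<Omega>)"
        "\<eta> \<in> borel_measurable (lebesgue_on \<Omega>)"
      using v w test_function_weak_gradient[OF open_\<Omega> \<eta>]
      by (auto simp: has_weak_gradient_def intro!: L1_loc_measurable[OF open_\<Omega>])
    have small: "?N (\<lambda>x. u x - \<eta> x) \<le> ennreal d" "?N (\<lambda>x. norm (w x)) \<le> ennreal d"
      using ud unfolding W1_norm_def w_def[symmetric]
      by (auto intro: order_trans[OF _ less_imp_le[OF ud[unfolded W1_norm_def w_def[symmetric]]]] add_increasing add_increasing2)
    have "?N (\<lambda>x. norm (gradient \<eta> x)) \<le> ennreal k * (?N (\<lambda>x. norm (v x)) + ?N (\<lambda>x. norm (w x)))"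
    proof (rule tri)
      show "AE x in lebesgue. x \<in> \<Omega> \<longrightarrow> \<bar>norm (gradient \<eta> x)\<bar> \<le> \<bar>norm (v x)\<bar> + \<bar>norm (w x)\<bar>"
        using vw
      proof eventually_elim
        case (elim x)
        show ?case
        proof
          assume "x \<in> \<Omega>"
          then have "gradient \<eta> x = v x - w x" using elim by (auto simp: algebra_simps)
          then show "\<bar>norm (gradient \<eta> x)\<bar> \<le> \<bar>norm (v x)\<bar> + \<bar>norm (w x)\<bar>"
            by (simp add: norm_triangle_ineq4)
        qed
      qed
    qed measurable
    also have "\<dots> \<le> ennreal k * (?N (\<lambda>x. norm (v x)) + ennreal d)"
      using small(2) by (intro mult_left_mono add_left_mono) auto
    finally have grad: "?N (\<lambda>x. norm (gradient \<eta> x)) \<le> ennreal k * (?N (\<lambda>x. norm (v x)) + ennreal d)" .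
    have "?N u \<le> ennreal k * (?N \<eta> + ?N (\<lambda>x. u x - \<eta> x))"
      by (rule tri) (measurable, auto)
    also have "\<dots> \<le> ennreal k * (ennreal C * (ennreal k * (?N (\<lambda>x. norm (v x)) + ennreal d)) + ennreal d)"
      using small(1) by (intro mult_left_mono add_mono order_trans[OF test[OF \<eta>]] grad) auto
    also have "\<dots> = ennreal C' * ?N (\<lambda>x. norm (v x)) + (ennreal C' * ennreal d + ennreal k * ennreal d)"
      using k C by (simp add: C'_def ennreal_mult distrib_left add_ac mult_ac)
    also have "ennreal C' * ennreal d + ennreal k * ennreal d = ennreal ((C' + k) * d)"
      using C' k d by (simp add: distrib_right ennreal_mult)
    also have "(C' + k) * d = e" using C' k by (simp add: d_def)
    finally show "?N u \<le> ennreal C' * ?N (\<lambda>x. norm (weak_gradient \<Omega> u x)) + ennreal e" by (simp add: v_def)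
  qed
  with C' show ?thesis by blast
qed

end

lemma diameter_pos:
  fixes S :: "'a :: euclidean_space set"
  assumes "open S" "S \<noteq> {}" "bounded S"
  shows "0 < diameter S"
proof -
  obtain x where "x \<in> S" using assms(2) by blast
  then obtain e where e: "0 < e" "ball x e \<subseteq> S" using assms(1) open_contains_ball by blast
  obtain b :: 'a where b: "b \<in> Basis" using nonempty_Basis by blast
  have "x + (e / 2) *\<^sub>R b \<in> S" using e b by (intro subsetD[OF e(2)]) (simp add: dist_norm)
  from diameter_bounded_bound[OF assms(3) \<open>x \<in> S\<close> this] e b show ?thesis by (simp add: dist_norm)
qed

text \<open>Since \<infinity> * 0 = 0 in \<open>ennreal\<close>, the modular vanishes at every level
  l > 0, however large the values of \<phi>.\<close>

lemma lux_norm_null_weight: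
  assumes "\<Omega> \<in> sets lebesgue" "AE x in lebesgue. \<omega> x = 0"
  shows "lux_norm \<Omega> (weighted \<phi> \<omega>) f = 0"
proof -
  have "(\<integral>\<^sup>+x. weighted \<phi> \<omega> x (\<bar>f x\<bar> / l) \<partial>lebesgue_on \<Omega>) = (\<integral>\<^sup>+x. 0 \<partial>lebesgue_on \<Omega>)" for l
    using assms(1) by (intro nn_integral_cong_AE, subst AE_restrict_space_iff)
      (auto intro!: eventually_mono[OF assms(2)] simp: weighted_def)
  then have le: "lux_norm \<Omega> (weighted \<phi> \<omega>) f \<le> ennreal l" if "0 < l" for l
    unfolding lux_norm_def using that by (intro Inf_lower) auto
  have "lux_norm \<Omega> (weighted \<phi> \<omega>) f \<le> 0"
  proof (rule ennreal_le_epsilon)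
    fix e :: real assume "0 < e"
    then show "lux_norm \<Omega> (weighted \<phi> \<omega>) f \<le> 0 + ennreal e" using le by simp
  qed
  then show ?thesis by simp
qed

theorem theorem3p10:
  fixes \<Omega> :: "(real ^ 'n) set"
    and p :: real
    and \<omega> :: "real ^ 'n \<Rightarrow> real"
    and \<phi> :: "real ^ 'n \<Rightarrow> real \<Rightarrow> ennreal"
  assumes "CARD('n) \<ge> 2"
    and "open \<Omega>" and "connected \<Omega>" and "\<Omega> \<noteq> {}" and "bounded \<Omega>"
    and "1 < p"
    and "\<omega> \<in> Ap p"
    and "\<phi> \<in> Phi_w \<Omega>"
    and "A1 \<Omega> \<omega> \<phi>"
    and "aInc \<Omega> p \<phi>"
  shows "\<exists>C::real. C > 0 \<and>
    (\<forall>u \<in> W1_0 \<Omega> (weighted \<phi> \<omega>).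
       lux_norm \<Omega> (weighted \<phi> \<omega>) u
         \<le> ennreal (C * diameter \<Omega>)
             * lux_norm \<Omega> (weighted \<phi> \<omega>) (\<lambda>x. norm (weak_gradient \<Omega> u x)))"
proof (cases "AE x in lebesgue. \<omega> x = 0")
  case True
  have "lux_norm \<Omega> (weighted \<phi> \<omega>) u = 0" for u
    using assms(2) by (intro lux_norm_null_weight True) simp
  then show ?thesis by (intro exI[of _ 1]) simp
next
  case False
  interpret weighted_orlicz \<Omega> p \<omega> \<phi>
    by (rule weighted_orlicz.intro[OF assms(2,5-10) Ap_AE_pos[OF assms(7,6) False]])
  have diam: "0 < diameter \<Omega>" by (rule diameter_pos) (use assms in auto)
  obtain C where "0 < C" "\<forall>u\<in>W1_0 \<Omega> (weighted \<phi> \<omega>). lux_norm \<Omega> (weighted \<phi> \<omega>) u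
      \<le> ennreal C * lux_norm \<Omega> (weighted \<phi> \<omega>) (\<lambda>x. norm (weak_gradient \<Omega> u x))"
    using Poincare_W1_0 by blast
  \<comment> \<open>The constant obtained already depends on \<Omega>; dividing it by the diameter
    produces the stated factor.\<close>
  then show ?thesis using diam by (intro exI[of _ "C / diameter \<Omega>"]) simp
qed

end
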